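(* Let $J:\mathbb{R}\to[0,\infty)$ be smooth, radially symmetric (even), with $\int_{\mathbb{R}}J=1$, nonincreasing in $\mathbb{R}_+$ and supported in $(-d,d)$, $d>0$. Let $\mathfrak q=\frac12\int_{\mathbb{R}}J(z)z^2\,dz$, let $u_0\ge0$ be bounded with $u_0=0$ for $x<0$ and $u_0\in L^1(\mathbb{R}_+,(1+x+x^2)\,dx)$, and let $u$ be the solution to $$u_t=J*u-u\ \ (x\ge0,\ t>0),\qquad u(x,t)=0\ \ (x<0,\ t>0),\qquad u(x,0)=u_0(x)\ \ (x\in\mathbb{R}).$$ Let $M_1^*=\int_0^\infty u_0(x)\phi(x)\,dx$. Then $$t\,\|u(\cdot,t)+2M_1^*D(\cdot,\mathfrak q t)\|_{L^\infty(\mathbb{R}_+)}\to0\qquad\text{as }t\to\infty.$$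
   Context: $\mathbb{R}_+=(0,\infty)$; convolution is in the space variable $x$. "Supported in $(-d,d)$" means $J(z)=0$ for $|z|\ge d$. $\phi:(-d,\infty)\to\mathbb{R}$ is the unique solution to the stationary problem $J*\phi=\phi$ for $x\ge0$, $\phi=0$ for $-d<x<0$, $(\phi(x)-x)\in L^\infty(\mathbb{R}_+)$. $\Gamma(x,t)=(4\pi t)^{-1/2}e^{-x^2/(4t)}$ and $D(x,t)=\Gamma_x(x,t)$. The solution $u$ is the unique solution in $C([0,\infty);L^1(\mathbb{R}_+,(1+x)\,dx))$. *)

theory Defs
  imports "HOL-Analysis.Analysis" "HOL-Probability.Essential_Supremum"
begin

definition smooth_fun :: "(real \<Rightarrow> real) \<Rightarrow> bool" where
  "smooth_fun f \<longleftrightarrow> (\<forall>n. (deriv ^^ n) f differentiable_on UNIV)"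

definition convolve :: "(real \<Rightarrow> real) \<Rightarrow> (real \<Rightarrow> real) \<Rightarrow> real \<Rightarrow> real" where
  "convolve J f x = (\<integral>y. J (x - y) * f y \<partial>lebesgue)"

definition nonlocal_kernel :: "real \<Rightarrow> (real \<Rightarrow> real) \<Rightarrow> bool" where
  "nonlocal_kernel d J \<longleftrightarrow>
     smooth_fun J \<and> (\<forall>z. J z \<ge> 0) \<and> (\<forall>z. J (- z) = J z) \<and>
     integral\<^sup>L lebesgue J = 1 \<and>
     antimono_on {0<..} J \<and> (\<forall>z. \<bar>z\<bar> \<ge> d \<longrightarrow> J z = 0)"

definition L_infinity_on :: "real set \<Rightarrow> (real \<Rightarrow> real) \<Rightarrow> bool" where
  "L_infinity_on S f \<longleftrightarrow>
     f \<in> borel_measurable (lebesgue_on S) \<and> (\<exists>C. AE x in lebesgue_on S. \<bar>f x\<bar> \<le> C)"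

text \<open>A total function stands for one on \<open>(-d, \<infinity>)\<close>. Its values at \<open>y \<le> -d\<close> are
  irrelevant: for \<open>x \<ge> 0\<close> the convolution multiplies them by \<open>J (x - y) = 0\<close>.\<close>

definition stationary_solution :: "real \<Rightarrow> (real \<Rightarrow> real) \<Rightarrow> (real \<Rightarrow> real) \<Rightarrow> bool" where
  "stationary_solution d J \<phi> \<longleftrightarrow>
     (\<forall>x\<ge>0. convolve J \<phi> x = \<phi> x) \<and> (\<forall>x. - d < x \<and> x < 0 \<longrightarrow> \<phi> x = 0) \<and>
     L_infinity_on {0<..} (\<lambda>x. \<phi> x - x)"

text \<open>Membership of \<open>t \<mapsto> u(\<cdot>,t)\<close> in the space \<open>C([0,\<infinity>); L\<^sup>1((0,\<infinity>), (1+x) dx))\<close>.\<close>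

definition continuous_weighted_L1 :: "(real \<Rightarrow> real \<Rightarrow> real) \<Rightarrow> bool" where
  "continuous_weighted_L1 u \<longleftrightarrow>
     (\<forall>t\<ge>0. integrable (lebesgue_on {0<..}) (\<lambda>x. (1 + x) * u x t)) \<and>
     (\<forall>t\<ge>0. ((\<lambda>s. \<integral>x. (1 + x) * \<bar>u x s - u x t\<bar> \<partial>lebesgue_on {0<..}) \<longlongrightarrow> 0)
              (at t within {0..}))"

text \<open>Since \<open>u(\<cdot>,t)\<close> is an element of an \<open>L\<^sup>1\<close> space, the three conditions are imposed for
  almost every \<open>x\<close> only, with an exceptional null set that does not depend on \<open>t\<close>.\<close>

definition evolution_solution ::
  "(real \<Rightarrow> real) \<Rightarrow> (real \<Rightarrow> real) \<Rightarrow> (real \<Rightarrow> real \<Rightarrow> real) \<Rightarrow> bool" where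
  "evolution_solution J u0 u \<longleftrightarrow>
     continuous_weighted_L1 u \<and>
     (AE x in lebesgue. x \<ge> 0 \<longrightarrow>
        (\<forall>t>0. ((\<lambda>s. u x s) has_real_derivative (convolve J (\<lambda>y. u y t) x - u x t)) (at t))) \<and>
     (AE x in lebesgue. x < 0 \<longrightarrow> (\<forall>t>0. u x t = 0)) \<and>
     (AE x in lebesgue. u x 0 = u0 x)"

definition heat_kernel :: "real \<Rightarrow> real \<Rightarrow> real" where
  "heat_kernel x t = (4 * pi * t) powr (- 1 / 2) * exp (- (x\<^sup>2) / (4 * t))"

definition dipole :: "real \<Rightarrow> real \<Rightarrow> real" where
  "dipole x t = deriv (\<lambda>y. heat_kernel y t) x"

definition Linf_norm_on :: "real set \<Rightarrow> (real \<Rightarrow> real) \<Rightarrow> ereal" where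
  "Linf_norm_on S f = esssup (lebesgue_on S) (\<lambda>x. ereal \<bar>f x\<bar>)"

end

theory Submission
  imports Defs "HOL-Probability.Probability" "HOL-Real_Asymp.Real_Asymp"
begin

text \<open>
  Why the theorem is true. The equation describes the density of a particle that waits an
  exponential time of mean one, jumps by a displacement of law \<open>J\<close>, and is killed when a jump
  leads to the negative half-line. Hence \<open>u\<close> at time \<open>t\<close> is the average, over a Poisson number
  \<open>n\<close> of jumps with mean \<open>t\<close>, of the densities of the discrete killed walk
  (\<open>evolution_solution_poissonized\<close>). Everything reduces to that walk,
  \<open>K f = (J * f)\<close> restricted to the half-line, for which sums over \<open>n\<close> replace integrals over
  time and no regularity in time is at stake; the fluctuations of the Poisson number, of order
  \<open>sqrt t\<close>, do not matter because the dipole is Lipschitz in time with constant of order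
  \<open>1 / t\<^sup>2\<close> (\<open>poissonized_dipole_limit\<close>).

  The killed walk is compared with the free walk by odd reflection. The odd extension of
  \<open>K\<^sup>n f\<close> evolves freely except for a source: the mass that has just left the half-line, put
  back with the opposite sign on the positive side (\<open>killed_power_reflection\<close>). So \<open>K\<^sup>n f\<close> is
  the free evolution of the odd extension of \<open>f\<close> plus the free evolution of all exit fluxes.
  For the free walk there is a local limit theorem with an error of smaller order than \<open>1 / n\<close>:
  an odd function with first moment \<open>m\<close> on the positive side is
  carried to \<open>- 2 m D\<close>, where \<open>D\<close> is the dipole (\<open>odd_kernel_local_limit\<close>). It follows from
  Fourier inversion, the expansion \<open>1 - q \<xi>\<^sup>2\<close> of the symbol at the origin and a spectral gap
  away from it.

  Adding up, the coefficient of the dipole is the first moment of \<open>f\<close> plus that of all exit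
  fluxes, and this is the limit of the first moments of \<open>K\<^sup>n f\<close>, since one killed step raises
  the first moment by exactly that of the exit flux. The same limit is computed by pairing
  with the profile \<open>\<phi>\<close>: the pairing is conserved because \<open>\<phi>\<close> is harmonic for the killed walk,
  \<open>\<phi>\<close> is at bounded distance from the identity, and the mass of \<open>K\<^sup>n f\<close> tends to zero
  (\<open>first_moment_limit\<close>). This identifies the coefficient as \<open>M1\<close>.

  What makes the summation of the fluxes legitimate is their decay like \<open>n\<close> to the power
  \<open>-3/2\<close> (\<open>exit_flux_decay\<close>): it is summable, and it beats the logarithm that arises from the
  fluxes of the recent past, which have had no time to spread. The decay comes from splitting
  the time interval in three: survival, free spreading, and survival of the reversed walk each
  contribute \<open>1 / sqrt n\<close>. The survival estimate (\<open>survival_bound\<close>) interpolates between the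
  sup bound for the free walk and a superharmonic linear function.
\<close>

section \<open>The dispersal kernel\<close>

locale dispersal_kernel =
  fixes d :: real and J :: "real \<Rightarrow> real"
  assumes d_pos: "0 < d" and kernel: "nonlocal_kernel d J"
begin

lemma J_nonneg: "0 \<le> J z"
  and J_even: "J (- z) = J z"
  and J_supp: "d \<le> \<bar>z\<bar> \<Longrightarrow> J z = 0"
  and J_smooth: "smooth_fun J"
  using kernel by (auto simp: nonlocal_kernel_def)

lemma J_commute: "J (x - y) = J (y - x)"
  using J_even[of "x - y"] by simp

lemma J_deriv: "(J has_real_derivative deriv J x) (at x)"
  and J_deriv2: "(deriv J has_real_derivative deriv (deriv J) x) (at x)"
  and J_deriv2_continuous: "continuous_on A (deriv (deriv J))"
proof -
  have D: "(deriv ^^ n) J differentiable (at x)" for n and x :: real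
    using J_smooth unfolding smooth_fun_def differentiable_on_def by auto
  show "(J has_real_derivative deriv J x) (at x)"
    using D[of 0 x] DERIV_deriv_iff_real_differentiable by auto
  show "(deriv J has_real_derivative deriv (deriv J) x) (at x)"
    using D[of 1 x] DERIV_deriv_iff_real_differentiable by auto
  have "deriv (deriv J) differentiable (at x)" for x
    using D[of 2 x] by (simp add: numeral_2_eq_2)
  then show "continuous_on A (deriv (deriv J))"
    by (meson continuous_at_imp_continuous_on differentiable_imp_continuous_within)
qed

lemma J_continuous: "continuous_on A J"
  by (meson DERIV_isCont J_deriv continuous_at_imp_continuous_on)

lemma J_deriv_continuous: "continuous_on A (deriv J)"
  by (meson DERIV_isCont J_deriv2 continuous_at_imp_continuous_on)

lemma J_measurable [measurable]: "J \<in> borel_measurable borel"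
  using J_continuous borel_measurable_continuous_onI by blast

lemma J_deriv_supp: "d < \<bar>z\<bar> \<Longrightarrow> deriv J z = 0"
proof -
  assume z: "d < \<bar>z\<bar>"
  have "open {z::real. d < \<bar>z\<bar>}"
    by (intro open_Collect_less continuous_intros)
  then have "eventually (\<lambda>z. d < \<bar>z\<bar>) (nhds z)"
    using z eventually_nhds by auto
  then have "eventually (\<lambda>z. J z = 0) (nhds z)"
    by (rule eventually_mono) (simp add: J_supp)
  then have "(J has_real_derivative 0) (at z)"
    by (subst DERIV_cong_ev[OF refl, of _ "\<lambda>_. 0"]) auto
  then show "deriv J z = 0"
    by (rule DERIV_imp_deriv)
qed

lemma J_bounded: "\<exists>C>0. \<forall>z. J z \<le> C"
proof -
  have "bounded (J ` {-d..d})"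
    using J_continuous compact_continuous_image compact_imp_bounded by blast
  then obtain C where C: "\<And>z. z \<in> {-d..d} \<Longrightarrow> \<bar>J z\<bar> \<le> C"
    unfolding bounded_iff real_norm_def by blast
  have "J z \<le> \<bar>C\<bar> + 1" for z
  proof (cases "z \<in> {-d..d}")
    case True
    then show ?thesis using C[OF True] by linarith
  next
    case False
    then show ?thesis using J_supp[of z] by auto
  qed
  moreover have "0 < \<bar>C\<bar> + 1" by linarith
  ultimately show ?thesis by blast
qed

lemma J_lipschitz: "\<exists>C>0. \<forall>x y. \<bar>J x - J y\<bar> \<le> C * \<bar>x - y\<bar>"
proof -
  have "bounded (deriv J ` {-d..d})"
    using J_deriv_continuous compact_continuous_image compact_imp_bounded by blast
  then obtain C where C: "\<And>z. z \<in> {-d..d} \<Longrightarrow> \<bar>deriv J z\<bar> \<le> C"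
    unfolding bounded_iff real_norm_def by blast
  have B: "\<bar>deriv J z\<bar> \<le> \<bar>C\<bar> + 1" for z
  proof (cases "z \<in> {-d..d}")
    case True
    then show ?thesis using C[OF True] by linarith
  next
    case False
    then show ?thesis using J_deriv_supp[of z] by auto
  qed
  have "norm (J x - J y) \<le> (\<bar>C\<bar> + 1) * norm (x - y)" for x y
    by (rule field_differentiable_bound[of UNIV J "deriv J"])
       (use J_deriv B in \<open>auto intro: DERIV_subset\<close>)
  moreover have "0 < \<bar>C\<bar> + 1" by linarith
  ultimately show ?thesis by auto
qed

text \<open>Because the support is compact, a factor that is bounded only near the origin never spoils
  integrability; moments, Fourier factors and functions of linear growth are all covered.\<close>

lemma J_mult_integrable:
  assumes [measurable]: "g \<in> borel_measurable borel"
    and g: "\<And>z. \<bar>z\<bar> \<le> d \<Longrightarrow> \<bar>g z\<bar> \<le> C"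
  shows "integrable lborel (\<lambda>z. J z * g z)"
proof -
  obtain B where B: "B > 0" "\<And>z. J z \<le> B" using J_bounded by blast
  show ?thesis
  proof (rule integrableI_bounded_set[of "{-d..d}" _ _ "B * C"])
    show "AE x\<in>{- d..d} in lborel. norm (J x * g x) \<le> B * C"
      using B J_nonneg by (auto intro!: AE_I2 mult_mono g simp: abs_mult abs_le_iff)
    show "AE x in lborel. x \<notin> {- d..d} \<longrightarrow> J x * g x = 0"
      using J_supp by (auto intro!: AE_I2)
    show "emeasure lborel {-d..d} < \<infinity>"
      using d_pos by (simp add: emeasure_lborel_Icc)
  qed auto
qed

lemma J_integrable: "integrable lborel J"
  using J_mult_integrable[of "\<lambda>_. 1" 1] by simp

lemma J_integral: "(\<integral>z. J z \<partial>lborel) = 1"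
  using kernel integral_completion[of J lborel] by (simp add: nonlocal_kernel_def)

definition diffusivity :: real where
  "diffusivity = 1 / 2 * (\<integral>z. J z * z\<^sup>2 \<partial>lborel)"

lemma J_second_moment_integrable: "integrable lborel (\<lambda>z. J z * z\<^sup>2)"
  by (rule J_mult_integrable[of _ "d\<^sup>2"]) (auto simp: abs_le_square_iff[symmetric] d_pos)

lemma J_first_moment_integrable: "integrable lborel (\<lambda>z. J z * z)"
  by (rule J_mult_integrable[of _ "d"]) (auto simp: d_pos)

lemma J_first_moment: "(\<integral>z. J z * z \<partial>lborel) = 0"
proof -
  have "(\<integral>z. J z * z \<partial>lborel) = (\<integral>z. J (- z) * (- z) \<partial>lborel)"
    using lborel_integral_real_affine[of "-1" "\<lambda>z. J z * z" 0] by simp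
  then show ?thesis by (simp add: J_even)
qed

lemma diffusivity_pos: "0 < diffusivity"
proof -
  have "(\<integral>z. J z * z\<^sup>2 \<partial>lborel) \<noteq> 0"
  proof
    assume "(\<integral>z. J z * z\<^sup>2 \<partial>lborel) = 0"
    then have "AE z in lborel. J z * z\<^sup>2 = 0"
      using integral_nonneg_eq_0_iff_AE[OF J_second_moment_integrable] J_nonneg by auto
    moreover have "AE z in lborel. z \<noteq> (0::real)"
      by (rule AE_lborel_singleton)
    ultimately have "AE z in lborel. J z = 0"
      by eventually_elim auto
    then have "(\<integral>z. J z \<partial>lborel) = 0"
      using integral_eq_zero_AE by blast
    then show False using J_integral by simp
  qed
  moreover have "0 \<le> (\<integral>z. J z * z\<^sup>2 \<partial>lborel)"
    using J_nonneg by (intro integral_nonneg_AE) auto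
  ultimately show ?thesis by (simp add: diffusivity_def)
qed

end

section \<open>Gaussian integrals and the Fourier symbol\<close>

definition gauss_moment :: "nat \<Rightarrow> real" where
  "gauss_moment j = (\<integral>\<xi>. \<bar>\<xi>\<bar> ^ j * exp (- \<xi>\<^sup>2) \<partial>lborel)"

lemma gauss_moment_integrable:
  assumes "0 < c"
  shows "integrable lborel (\<lambda>\<xi>::real. \<bar>\<xi>\<bar> ^ j * exp (- (c * \<xi>\<^sup>2)))"
proof -
  have nd: "normal_density 0 (1 / sqrt 2) x = exp (- x\<^sup>2) / sqrt pi" for x
    by (simp add: normal_density_def power_divide)
  have "integrable lborel (\<lambda>x::real. exp (- x\<^sup>2) / sqrt pi * \<bar>x\<bar> ^ j)"
    using integrable_normal_moment_abs[where \<mu> = 0 and \<sigma> = "1 / sqrt 2" and k = j]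
    by (simp add: nd)
  then have "integrable lborel (\<lambda>x::real. sqrt pi * (exp (- x\<^sup>2) / sqrt pi * \<bar>x\<bar> ^ j))"
    by (rule integrable_mult_right)
  then have *: "integrable lborel (\<lambda>x::real. \<bar>x\<bar> ^ j * exp (- x\<^sup>2))"
    by (simp add: mult.commute)
  have "integrable lborel (\<lambda>x::real. \<bar>0 + sqrt c * x\<bar> ^ j * exp (- (0 + sqrt c * x)\<^sup>2))"
    using assms by (intro lborel_integrable_real_affine[OF *]) simp
  then have "integrable lborel (\<lambda>x::real. (1 / sqrt c ^ j) * (\<bar>sqrt c * x\<bar> ^ j * exp (- (sqrt c * x)\<^sup>2)))"
    by (intro integrable_mult_right) simp
  moreover have "(1 / sqrt c ^ j) * (\<bar>sqrt c * x\<bar> ^ j * exp (- (sqrt c * x)\<^sup>2)) = \<bar>x\<bar> ^ j * exp (- (c * x\<^sup>2))" for x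
    using assms by (simp add: abs_mult power_mult_distrib)
  ultimately show ?thesis by simp
qed

lemma gauss_moment_scaled:
  assumes "0 < c"
  shows "(\<integral>\<xi>. \<bar>\<xi>\<bar> ^ j * exp (- (c * \<xi>\<^sup>2)) \<partial>lborel) = gauss_moment j / sqrt c ^ Suc j"
proof -
  have "gauss_moment j = sqrt c * (\<integral>x. \<bar>sqrt c * x\<bar> ^ j * exp (- (sqrt c * x)\<^sup>2) \<partial>lborel)"
    using assms lborel_integral_real_affine[of "sqrt c" "\<lambda>x. \<bar>x\<bar> ^ j * exp (- x\<^sup>2)" 0]
    by (simp add: gauss_moment_def)
  also have "(\<lambda>x. \<bar>sqrt c * x\<bar> ^ j * exp (- (sqrt c * x)\<^sup>2)) = (\<lambda>x. sqrt c ^ j * (\<bar>x\<bar> ^ j * exp (- (c * x\<^sup>2))))"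
    using assms by (auto simp: abs_mult power_mult_distrib)
  also have "(\<integral>x. sqrt c ^ j * (\<bar>x\<bar> ^ j * exp (- (c * x\<^sup>2))) \<partial>lborel) =
      sqrt c ^ j * (\<integral>x. \<bar>x\<bar> ^ j * exp (- (c * x\<^sup>2)) \<partial>lborel)"
    by (rule integral_mult_right_zero)
  finally have "gauss_moment j = sqrt c ^ Suc j * (\<integral>x. \<bar>x\<bar> ^ j * exp (- (c * x\<^sup>2)) \<partial>lborel)"
    by (simp only: power_Suc mult.assoc)
  then show ?thesis
    using assms by simp
qed

lemma gauss_moment_nonneg: "0 \<le> gauss_moment j"
  unfolding gauss_moment_def by (intro integral_nonneg_AE) auto

lemma gauss_cos_integral:
  assumes "0 < s"
  shows "(\<integral>\<xi>. exp (- (s * \<xi>\<^sup>2)) * cos (x * \<xi>) \<partial>lborel) = sqrt (pi / s) * exp (- (x\<^sup>2) / (4 * s))"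
proof -
  let ?t = "x / sqrt (2 * s)"
  interpret prob_space std_normal_distribution
    by (rule prob_space_normal_density) simp
  have "integrable std_normal_distribution (\<lambda>y. iexp (?t * y))"
    by (intro integrable_const_bound[of _ 1]) auto
  then have "Re (char std_normal_distribution ?t) = (\<integral>y. Re (iexp (?t * y)) \<partial>std_normal_distribution)"
    unfolding char_def by (subst integral_Re[symmetric]) auto
  also have "\<dots> = (\<integral>y. std_normal_density y * cos (?t * y) \<partial>lborel)"
    by (subst integral_density) (auto simp: normal_density_nonneg Re_exp)
  also have "\<dots> = sqrt (2 * s) * (\<integral>\<xi>. std_normal_density (sqrt (2 * s) * \<xi>) * cos (?t * (sqrt (2 * s) * \<xi>)) \<partial>lborel)"
    using assms lborel_integral_real_affine[of "sqrt (2 * s)" "\<lambda>y. std_normal_density y * cos (?t * y)" 0]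
    by simp
  also have "(\<lambda>\<xi>. std_normal_density (sqrt (2 * s) * \<xi>) * cos (?t * (sqrt (2 * s) * \<xi>))) =
     (\<lambda>\<xi>. 1 / sqrt (2 * pi) * (exp (- (s * \<xi>\<^sup>2)) * cos (x * \<xi>)))"
    using assms by (auto simp: normal_density_def power_mult_distrib)
  finally have "exp (- (?t\<^sup>2) / 2) = sqrt (2 * s) / sqrt (2 * pi) * (\<integral>\<xi>. exp (- (s * \<xi>\<^sup>2)) * cos (x * \<xi>) \<partial>lborel)"
    by (simp add: char_std_normal_distribution)
  moreover have "?t\<^sup>2 / 2 = x\<^sup>2 / (4 * s)"
    using assms by (simp add: power_divide)
  ultimately show ?thesis
    using assms by (simp add: real_sqrt_mult real_sqrt_divide field_simps)
qed

text \<open>Integrating the exact derivative of \<open>exp (- s \<xi>\<^sup>2) sin (x \<xi>)\<close> over the line trades the sine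
  integral for the cosine integral.\<close>

lemma gauss_sin_integral:
  assumes s: "0 < s"
  shows "(\<integral>\<xi>. \<xi> * exp (- (s * \<xi>\<^sup>2)) * sin (x * \<xi>) \<partial>lborel) =
    x / (2 * s) * (sqrt (pi / s) * exp (- (x\<^sup>2) / (4 * s)))"
proof -
  let ?c = "\<lambda>\<xi>::real. exp (- (s * \<xi>\<^sup>2)) * cos (x * \<xi>)"
  let ?s = "\<lambda>\<xi>::real. \<xi> * exp (- (s * \<xi>\<^sup>2)) * sin (x * \<xi>)"
  let ?f = "\<lambda>\<xi>::real. x * ?c \<xi> - 2 * s * ?s \<xi>"
  let ?F = "\<lambda>\<xi>::real. exp (- (s * \<xi>\<^sup>2)) * sin (x * \<xi>)"
  have c: "integrable lborel ?c"
    using gauss_moment_integrable[OF s, of 0]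
    by (rule Bochner_Integration.integrable_bound) (auto simp: abs_mult mult_le_one)
  have si: "integrable lborel ?s"
    using gauss_moment_integrable[OF s, of 1]
    by (rule Bochner_Integration.integrable_bound) (auto simp: abs_mult mult_le_one mult.assoc intro!: mult_left_mono)
  have lim: "(?F \<longlongrightarrow> 0) at_top" "(?F \<longlongrightarrow> 0) at_bot"
  proof -
    have *: "eventually (\<lambda>\<xi>. norm (?F \<xi>) \<le> exp (- (s * \<xi>\<^sup>2))) F" for F :: "real filter"
      by (intro always_eventually) (auto simp: abs_mult)
    have "((\<lambda>\<xi>. exp (- (s * \<xi>\<^sup>2))) \<longlongrightarrow> 0) at_top" "((\<lambda>\<xi>. exp (- (s * \<xi>\<^sup>2))) \<longlongrightarrow> 0) at_bot"
      using s by real_asymp+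
    then show "(?F \<longlongrightarrow> 0) at_top" "(?F \<longlongrightarrow> 0) at_bot"
      using Lim_null_comparison[OF *] by auto
  qed
  have "(LBINT \<xi>=-\<infinity>..\<infinity>. ?f \<xi>) = 0 - 0"
  proof (rule interval_integral_FTC_integrable)
    show "(?F has_vector_derivative ?f \<xi>) (at \<xi>)" for \<xi>
      unfolding has_real_derivative_iff_has_vector_derivative[symmetric]
      by (auto intro!: derivative_eq_intros simp: algebra_simps)
    show "set_integrable lborel (einterval (-\<infinity>) \<infinity>) ?f"
      using c si by (simp add: set_integrable_def)
    show "((?F \<circ> real_of_ereal) \<longlongrightarrow> 0) (at_right (- \<infinity>))"
      "((?F \<circ> real_of_ereal) \<longlongrightarrow> 0) (at_left \<infinity>)"
      unfolding ereal_tendsto_simps by (rule lim)+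
    show "isCont ?f \<xi>" for \<xi>
      by (intro continuous_intros)
  qed simp
  then have "(\<integral>\<xi>. ?f \<xi> \<partial>lborel) = 0"
    by (simp add: interval_lebesgue_integral_def set_lebesgue_integral_def)
  then have "x * (\<integral>\<xi>. ?c \<xi> \<partial>lborel) = 2 * s * (\<integral>\<xi>. ?s \<xi> \<partial>lborel)"
    using c si by simp
  then show ?thesis
    unfolding gauss_cos_integral[OF s] using s by (simp add: field_simps)
qed

lemma dipole_fourier:
  assumes t: "0 < t"
  shows "2 * pi * dipole x t = - (\<integral>\<xi>. \<xi> * exp (- (t * \<xi>\<^sup>2)) * sin (x * \<xi>) \<partial>lborel)"
proof -
  have "((\<lambda>y. heat_kernel y t) has_real_derivative
     ((4 * pi * t) powr (- 1 / 2) * (exp (- (x\<^sup>2) / (4 * t)) * (- (2 * x) / (4 * t))))) (at x)"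
    unfolding heat_kernel_def using t by (auto intro!: derivative_eq_intros)
  then have D: "dipole x t = (4 * pi * t) powr (- 1 / 2) * (exp (- (x\<^sup>2) / (4 * t)) * (- (2 * x) / (4 * t)))"
    unfolding dipole_def by (rule DERIV_imp_deriv)
  have "(4 * pi * t) powr (- 1 / 2) = 1 / sqrt (4 * pi * t)"
    using t by (simp add: powr_minus_divide powr_half_sqrt)
  moreover have "2 * pi / sqrt (4 * pi * t) = sqrt (pi / t)"
    using t by (simp add: real_sqrt_mult real_sqrt_divide field_simps)
  ultimately have "2 * pi * (4 * pi * t) powr (- 1 / 2) = sqrt (pi / t)"
    by simp
  then have "2 * pi * dipole x t = sqrt (pi / t) * (exp (- (x\<^sup>2) / (4 * t)) * (- (2 * x) / (4 * t)))"
    unfolding D by (simp only: mult.assoc[symmetric])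
  then show ?thesis
    using t by (simp add: gauss_sin_integral)
qed

lemma cos_quadratic_bounds:
  fixes x :: real
  shows "1 - cos x \<le> x\<^sup>2 / 2" and "\<bar>1 - cos x - x\<^sup>2 / 2\<bar> \<le> x ^ 4 / 24"
proof -
  obtain t where t: "cos x = (\<Sum>m<2. cos_coeff m * x ^ m) + (cos (t + 1/2 * real 2 * pi) / fact 2) * x ^ 2"
    using Maclaurin_cos_expansion[of x 2] by blast
  have "cos (t + 1/2 * real 2 * pi) * x ^ 2 \<ge> - 1 * x ^ 2"
    by (intro mult_right_mono) auto
  with t show "1 - cos x \<le> x\<^sup>2 / 2"
    by (simp add: numeral_2_eq_2 cos_coeff_def)
  obtain t where t: "cos x = (\<Sum>m<4. cos_coeff m * x ^ m) + (cos (t + 1/2 * real 4 * pi) / fact 4) * x ^ 4"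
    using Maclaurin_cos_expansion[of x 4] by blast
  have "(\<Sum>m<4. cos_coeff m * x ^ m) = 1 - x\<^sup>2 / 2"
    by (simp add: eval_nat_numeral cos_coeff_Suc sin_coeff_Suc)
  then have "1 - cos x - x\<^sup>2 / 2 = - (cos (t + 1/2 * real 4 * pi) * x ^ 4 / 24)"
    using t by (simp add: fact_numeral)
  moreover have "\<bar>cos (t + 1/2 * real 4 * pi) * x ^ 4\<bar> \<le> 1 * x ^ 4"
    unfolding abs_mult by (intro mult_mono) auto
  ultimately show "\<bar>1 - cos x - x\<^sup>2 / 2\<bar> \<le> x ^ 4 / 24"
    by (simp add: abs_mult)
qed

lemma exp_minus_quadratic_bound:
  fixes y :: real
  assumes "0 \<le> y"
  shows "exp (- y) \<le> 1 - y + y\<^sup>2 / 2"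
proof -
  have "(1 - y + y\<^sup>2 / 2) * (1 + y + y\<^sup>2 / 2) = 1 + (y\<^sup>2)\<^sup>2 / 4"
    by (simp add: field_simps power2_eq_square)
  then have "1 \<le> (1 - y + y\<^sup>2 / 2) * (1 + y + y\<^sup>2 / 2)"
    by simp
  also have "\<dots> \<le> (1 - y + y\<^sup>2 / 2) * exp y"
  proof (intro mult_left_mono exp_lower_Taylor_quadratic assms)
    have "0 \<le> (1 - y)\<^sup>2 + 1" by simp
    then show "0 \<le> 1 - y + y\<^sup>2 / 2"
      by (simp add: power2_eq_square algebra_simps)
  qed
  finally show ?thesis
    by (simp add: exp_minus field_simps)
qed

context dispersal_kernel
begin

definition symbol :: "real \<Rightarrow> real" where
  "symbol \<xi> = (\<integral>z. J z * cos (z * \<xi>) \<partial>lborel)"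

lemma symbol_measurable [measurable]: "symbol \<in> borel_measurable borel"
  unfolding symbol_def by measurable

lemma J_cos_integrable: "integrable lborel (\<lambda>z. J z * cos (z * \<xi>))"
  by (rule J_mult_integrable[of _ 1]) auto

lemma symbol_abs_le_1: "\<bar>symbol \<xi>\<bar> \<le> 1"
proof -
  have "\<bar>symbol \<xi>\<bar> \<le> (\<integral>z. \<bar>J z * cos (z * \<xi>)\<bar> \<partial>lborel)"
    unfolding symbol_def by (rule integral_abs_bound)
  also have "\<dots> \<le> (\<integral>z. J z \<partial>lborel)"
    using J_nonneg
    by (intro integral_mono integrable_abs J_cos_integrable J_integrable) (auto simp: abs_mult mult_left_le)
  finally show ?thesis by (simp add: J_integral)
qed

lemma symbol_diff_integral:
  shows "1 - symbol \<xi> = (\<integral>z. J z * (1 - cos (z * \<xi>)) \<partial>lborel)"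
    and "1 + symbol \<xi> = (\<integral>z. J z * (1 + cos (z * \<xi>)) \<partial>lborel)"
  using Bochner_Integration.integral_diff[OF J_integrable J_cos_integrable[of \<xi>]]
    Bochner_Integration.integral_add[OF J_integrable J_cos_integrable[of \<xi>]] J_integral
  by (simp_all add: symbol_def algebra_simps)

lemma J_one_minus_cos_integrable: "integrable lborel (\<lambda>z. J z * (1 - cos (z * \<xi>)))"
  and J_one_plus_cos_integrable: "integrable lborel (\<lambda>z. J z * (1 + cos (z * \<xi>)))"
  using Bochner_Integration.integrable_diff[OF J_integrable J_cos_integrable[of \<xi>]]
    Bochner_Integration.integrable_add[OF J_integrable J_cos_integrable[of \<xi>]]
  by (simp_all add: algebra_simps)

lemma diffusivity_symbol:
  shows "integrable lborel (\<lambda>z. J z * ((z * \<xi>)\<^sup>2 / 2))"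
    and "(\<integral>z. J z * ((z * \<xi>)\<^sup>2 / 2) \<partial>lborel) = diffusivity * \<xi>\<^sup>2"
proof -
  have *: "(\<lambda>z. J z * ((z * \<xi>)\<^sup>2 / 2)) = (\<lambda>z. (\<xi>\<^sup>2 / 2) * (J z * z\<^sup>2))"
    by (auto simp: power_mult_distrib)
  show "integrable lborel (\<lambda>z. J z * ((z * \<xi>)\<^sup>2 / 2))"
    unfolding * by (intro integrable_mult_right J_second_moment_integrable)
  show "(\<integral>z. J z * ((z * \<xi>)\<^sup>2 / 2) \<partial>lborel) = diffusivity * \<xi>\<^sup>2"
    unfolding * integral_mult_right_zero by (simp add: diffusivity_def)
qed

lemma symbol_quadratic_upper: "1 - symbol \<xi> \<le> diffusivity * \<xi>\<^sup>2"
  unfolding symbol_diff_integral diffusivity_symbol(2)[symmetric]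
  by (intro integral_mono mult_left_mono J_one_minus_cos_integrable diffusivity_symbol J_nonneg cos_quadratic_bounds)

lemma symbol_quartic: "\<bar>1 - symbol \<xi> - diffusivity * \<xi>\<^sup>2\<bar> \<le> d\<^sup>2 * diffusivity / 12 * \<xi> ^ 4"
proof -
  note i1 = J_one_minus_cos_integrable[of \<xi>] and i2 = diffusivity_symbol(1)[of \<xi>]
  have "1 - symbol \<xi> - diffusivity * \<xi>\<^sup>2 = (\<integral>z. J z * (1 - cos (z * \<xi>)) - J z * ((z * \<xi>)\<^sup>2 / 2) \<partial>lborel)"
    unfolding symbol_diff_integral(1) diffusivity_symbol(2)[symmetric]
    by (rule Bochner_Integration.integral_diff[OF i1 i2, symmetric])
  also have "\<bar>\<dots>\<bar> \<le> (\<integral>z. \<bar>J z * (1 - cos (z * \<xi>)) - J z * ((z * \<xi>)\<^sup>2 / 2)\<bar> \<partial>lborel)"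
    by (rule integral_abs_bound)
  also have "\<dots> \<le> (\<integral>z. d\<^sup>2 * \<xi> ^ 4 / 24 * (J z * z\<^sup>2) \<partial>lborel)"
  proof (intro integral_mono)
    show "integrable lborel (\<lambda>z. \<bar>J z * (1 - cos (z * \<xi>)) - J z * ((z * \<xi>)\<^sup>2 / 2)\<bar>)"
      using i1 i2 by auto
    show "integrable lborel (\<lambda>z. d\<^sup>2 * \<xi> ^ 4 / 24 * (J z * z\<^sup>2))"
      using J_second_moment_integrable by simp
    fix z
    have "J z * (1 - cos (z * \<xi>)) - J z * ((z * \<xi>)\<^sup>2 / 2) = J z * (1 - cos (z * \<xi>) - (z * \<xi>)\<^sup>2 / 2)"
      by (simp only: right_diff_distrib)
    then have "\<bar>J z * (1 - cos (z * \<xi>)) - J z * ((z * \<xi>)\<^sup>2 / 2)\<bar> = J z * \<bar>1 - cos (z * \<xi>) - (z * \<xi>)\<^sup>2 / 2\<bar>"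
      using J_nonneg[of z] by (simp only: abs_mult abs_of_nonneg)
    also have "\<dots> \<le> J z * ((z * \<xi>) ^ 4 / 24)"
      using J_nonneg cos_quadratic_bounds(2) by (intro mult_left_mono) auto
    also have "\<dots> = \<xi> ^ 4 / 24 * (J z * z\<^sup>2 * z\<^sup>2)"
      by (simp add: power_mult_distrib eval_nat_numeral)
    also have "\<dots> \<le> \<xi> ^ 4 / 24 * (J z * z\<^sup>2 * d\<^sup>2)"
    proof (cases "\<bar>z\<bar> \<le> d")
      case True
      then have "z\<^sup>2 \<le> d\<^sup>2" using d_pos by (simp add: abs_le_square_iff[symmetric])
      then show ?thesis using J_nonneg by (intro mult_left_mono) auto
    qed (simp add: J_supp)
    finally show "\<bar>J z * (1 - cos (z * \<xi>)) - J z * ((z * \<xi>)\<^sup>2 / 2)\<bar> \<le> d\<^sup>2 * \<xi> ^ 4 / 24 * (J z * z\<^sup>2)"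
      by (simp add: mult_ac)
  qed
  also have "\<dots> = d\<^sup>2 * diffusivity / 12 * \<xi> ^ 4"
    by (simp add: diffusivity_def)
  finally show ?thesis .
qed

text \<open>The identity \<open>1 - cos 2\<theta> = 2 (1 - cos \<theta>) (1 + cos \<theta>)\<close> passes a spectral gap from
  frequency \<open>2 \<xi>\<close> to frequency \<open>\<xi>\<close>, both at \<open>1\<close> and at \<open>- 1\<close>. The gap at \<open>- 1\<close> excludes
  oscillation of the walk in discrete time.\<close>

lemma symbol_double:
  shows "1 - symbol (2 * \<xi>) \<le> 4 * (1 - symbol \<xi>)" and "1 - symbol (2 * \<xi>) \<le> 4 * (1 + symbol \<xi>)"
proof -
  have d: "1 - cos (z * (2 * \<xi>)) = 2 * ((1 - cos (z * \<xi>)) * (1 + cos (z * \<xi>)))" for z :: real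
    using cos_double_cos[of "z * \<xi>"] by (simp add: algebra_simps power2_eq_square)
  note i = J_one_minus_cos_integrable J_one_plus_cos_integrable
  have c: "0 \<le> 1 - cos (z * \<xi>)" "0 \<le> 1 + cos (z * \<xi>)" for z
    using cos_ge_minus_one[of "z * \<xi>"] cos_le_one[of "z * \<xi>"] by linarith+
  have "J z * (1 - cos (z * (2 * \<xi>))) \<le> 4 * (J z * (1 - cos (z * \<xi>)))" for z
  proof -
    have "(1 - cos (z * \<xi>)) * (1 + cos (z * \<xi>)) \<le> (1 - cos (z * \<xi>)) * 2"
      using c[of z] by (intro mult_left_mono) linarith+
    from mult_left_mono[OF this J_nonneg[of z]] show ?thesis
      unfolding d by (simp add: algebra_simps)
  qed
  then have "(\<integral>z. J z * (1 - cos (z * (2 * \<xi>))) \<partial>lborel) \<le> (\<integral>z. 4 * (J z * (1 - cos (z * \<xi>))) \<partial>lborel)"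
    by (intro integral_mono i integrable_mult_right)
  then show "1 - symbol (2 * \<xi>) \<le> 4 * (1 - symbol \<xi>)"
    by (simp add: symbol_diff_integral)
  have "J z * (1 - cos (z * (2 * \<xi>))) \<le> 4 * (J z * (1 + cos (z * \<xi>)))" for z
  proof -
    have "(1 - cos (z * \<xi>)) * (1 + cos (z * \<xi>)) \<le> 2 * (1 + cos (z * \<xi>))"
      using c[of z] by (intro mult_right_mono) linarith+
    from mult_left_mono[OF this J_nonneg[of z]] show ?thesis
      unfolding d by (simp add: algebra_simps)
  qed
  then have "(\<integral>z. J z * (1 - cos (z * (2 * \<xi>))) \<partial>lborel) \<le> (\<integral>z. 4 * (J z * (1 + cos (z * \<xi>))) \<partial>lborel)"
    by (intro integral_mono i integrable_mult_right)
  then show "1 - symbol (2 * \<xi>) \<le> 4 * (1 + symbol \<xi>)"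
    by (simp add: symbol_diff_integral)
qed

text \<open>Two integrations by parts. The rate makes the symbol integrable, which is what Fourier
  inversion for \<open>J\<close> needs, and makes its square integrable even against \<open>\<bar>\<xi>\<bar>\<close>.\<close>

lemma symbol_decay: "\<exists>A>0. \<forall>\<xi>. \<bar>symbol \<xi>\<bar> \<le> A / (1 + \<xi>\<^sup>2)"
proof -
  let ?I = "{- (d + 1)..d + 1}"
  have "bounded (deriv (deriv J) ` ?I)"
    by (intro compact_imp_bounded compact_continuous_image J_deriv2_continuous) simp
  then obtain C where C: "\<And>z. z \<in> ?I \<Longrightarrow> \<bar>deriv (deriv J) z\<bar> \<le> C"
    unfolding bounded_iff real_norm_def by blast
  have "0 \<le> C" using C[of 0] d_pos by auto
  have *: "\<xi>\<^sup>2 * \<bar>symbol \<xi>\<bar> \<le> C * (2 * (d + 1))" for \<xi>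
  proof -
    let ?g = "\<lambda>z. deriv (deriv J) z * cos (z * \<xi>)"
    have ig: "integrable lborel (\<lambda>z. indicator ?I z *\<^sub>R ?g z)"
      by (rule borel_integrable_compact) (auto intro!: continuous_intros J_deriv2_continuous)
    \<comment> \<open>The primitive vanishes at both ends of an interval slightly larger than the support.\<close>
    have "(\<integral>z. indicator ?I z *\<^sub>R (?g z + \<xi>\<^sup>2 * (J z * cos (z * \<xi>))) \<partial>lborel) =
      (deriv J (d + 1) * cos ((d + 1) * \<xi>) + \<xi> * J (d + 1) * sin ((d + 1) * \<xi>)) -
      (deriv J (- (d + 1)) * cos (- (d + 1) * \<xi>) + \<xi> * J (- (d + 1)) * sin (- (d + 1) * \<xi>))"
    proof (rule integral_FTC_atLeastAtMost)
      fix z assume "- (d + 1) \<le> z" "z \<le> d + 1"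
      have "((\<lambda>z. deriv J z * cos (z * \<xi>) + \<xi> * J z * sin (z * \<xi>)) has_real_derivative
         (?g z + \<xi>\<^sup>2 * (J z * cos (z * \<xi>)))) (at z)"
        by (auto intro!: derivative_eq_intros J_deriv J_deriv2 simp: algebra_simps power2_eq_square)
      then show "((\<lambda>z. deriv J z * cos (z * \<xi>) + \<xi> * J z * sin (z * \<xi>)) has_vector_derivative
         (?g z + \<xi>\<^sup>2 * (J z * cos (z * \<xi>)))) (at z within ?I)"
        unfolding has_real_derivative_iff_has_vector_derivative
        by (rule has_vector_derivative_at_within)
    qed (use d_pos in \<open>auto intro!: continuous_intros J_deriv2_continuous J_continuous\<close>)
    also have "\<dots> = 0"
      using d_pos by (simp add: J_supp J_deriv_supp)
    also have "(\<lambda>z. indicator ?I z *\<^sub>R (?g z + \<xi>\<^sup>2 * (J z * cos (z * \<xi>)))) =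
        (\<lambda>z. indicator ?I z *\<^sub>R ?g z + \<xi>\<^sup>2 * (J z * cos (z * \<xi>)))"
    proof
      fix z show "indicator ?I z *\<^sub>R (?g z + \<xi>\<^sup>2 * (J z * cos (z * \<xi>))) = indicator ?I z *\<^sub>R ?g z + \<xi>\<^sup>2 * (J z * cos (z * \<xi>))"
        using J_supp[of z] by (cases "z \<in> ?I") auto
    qed
    finally have "(\<integral>z. indicator ?I z *\<^sub>R ?g z \<partial>lborel) + \<xi>\<^sup>2 * symbol \<xi> = 0"
      using ig J_cos_integrable by (simp add: symbol_def)
    then have "\<xi>\<^sup>2 * \<bar>symbol \<xi>\<bar> = \<bar>\<integral>z. indicator ?I z *\<^sub>R ?g z \<partial>lborel\<bar>"
      by (simp add: abs_mult eq_neg_iff_add_eq_0[symmetric])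
    also have "\<dots> \<le> (\<integral>z. \<bar>indicator ?I z *\<^sub>R ?g z\<bar> \<partial>lborel)"
      by (rule integral_abs_bound)
    also have "\<dots> \<le> (\<integral>z. indicator ?I z * C \<partial>lborel)"
    proof (intro integral_mono integrable_abs ig)
      show "integrable lborel (\<lambda>z. indicator ?I z * C)"
        by (intro integrable_mult_left) (simp add: integrable_indicator_iff emeasure_lborel_Icc_eq)
      show "\<bar>indicator ?I z *\<^sub>R ?g z\<bar> \<le> indicator ?I z * C" for z
        using C[of z] mult_mono[of "\<bar>deriv (deriv J) z\<bar>" C "\<bar>cos (z * \<xi>)\<bar>" 1] \<open>0 \<le> C\<close>
        by (auto simp: indicator_def abs_mult)
    qed
    also have "\<dots> = C * (2 * (d + 1))"
      using d_pos by simp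
    finally show ?thesis .
  qed
  have "\<bar>symbol \<xi>\<bar> \<le> (C * (2 * (d + 1)) + 1) / (1 + \<xi>\<^sup>2)" for \<xi>
  proof -
    have "(1 + \<xi>\<^sup>2) * \<bar>symbol \<xi>\<bar> \<le> C * (2 * (d + 1)) + 1"
      using * [of \<xi>] symbol_abs_le_1[of \<xi>] by (simp add: distrib_right)
    moreover have "0 < 1 + \<xi>\<^sup>2" by (simp add: add_pos_nonneg)
    ultimately show ?thesis by (simp add: pos_le_divide_eq mult.commute)
  qed
  moreover have "0 < C * (2 * (d + 1)) + 1"
    using \<open>0 \<le> C\<close> d_pos by (simp add: add_nonneg_pos)
  ultimately show ?thesis by blast
qed

text \<open>The sign matters as much as the upper bound: powers of the symbol and of the Gaussian are
  compared below through their common bound, which needs both bases nonnegative.\<close>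

lemma symbol_near_zero: "\<exists>r>0. \<forall>\<xi>. \<bar>\<xi>\<bar> < r \<longrightarrow> 0 \<le> symbol \<xi> \<and> symbol \<xi> \<le> exp (- (diffusivity * \<xi>\<^sup>2 / 2))"
proof -
  define r where "r = min (1 / d) (1 / sqrt diffusivity)"
  have "r > 0" using d_pos diffusivity_pos by (simp add: r_def)
  moreover have "0 \<le> symbol \<xi> \<and> symbol \<xi> \<le> exp (- (diffusivity * \<xi>\<^sup>2 / 2))" if "\<bar>\<xi>\<bar> < r" for \<xi>
  proof
    have "\<bar>\<xi>\<bar> \<le> 1 / d" "\<bar>\<xi>\<bar> \<le> 1 / sqrt diffusivity" using that by (simp_all add: r_def)
    then have "\<bar>\<xi>\<bar> * d \<le> 1" "\<bar>\<xi>\<bar> * sqrt diffusivity \<le> 1"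
      using d_pos diffusivity_pos by (simp_all add: pos_le_divide_eq)
    then have "(\<bar>\<xi>\<bar> * d)\<^sup>2 \<le> 1\<^sup>2" "(\<bar>\<xi>\<bar> * sqrt diffusivity)\<^sup>2 \<le> 1\<^sup>2"
      using d_pos diffusivity_pos by (intro power_mono; simp)+
    then have *: "\<xi>\<^sup>2 * d\<^sup>2 \<le> 1" "diffusivity * \<xi>\<^sup>2 \<le> 1"
      using diffusivity_pos by (simp_all add: power_mult_distrib mult.commute)
    show "0 \<le> symbol \<xi>"
      using symbol_quadratic_upper[of \<xi>] * by linarith
    have "d\<^sup>2 * diffusivity / 12 * \<xi> ^ 4 = (\<xi>\<^sup>2 * d\<^sup>2) * (diffusivity * \<xi>\<^sup>2 / 12)"
      by (simp add: eval_nat_numeral)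
    also have "\<dots> \<le> 1 * (diffusivity * \<xi>\<^sup>2 / 12)"
      using * diffusivity_pos by (intro mult_right_mono) auto
    finally have "1 - symbol \<xi> \<ge> diffusivity * \<xi>\<^sup>2 - diffusivity * \<xi>\<^sup>2 / 12"
      using symbol_quartic[of \<xi>] by linarith
    moreover have "0 \<le> diffusivity * \<xi>\<^sup>2" using diffusivity_pos by simp
    ultimately have "symbol \<xi> \<le> 1 + (- (diffusivity * \<xi>\<^sup>2 / 2))" by linarith
    then show "symbol \<xi> \<le> exp (- (diffusivity * \<xi>\<^sup>2 / 2))"
      using exp_ge_add_one_self[of "- (diffusivity * \<xi>\<^sup>2 / 2)"] by linarith
  qed
  ultimately show ?thesis by blast
qed

text \<open>Decay bounds the symbol by \<open>1/2\<close> beyond frequency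
  \<open>2 ^ k * r\<close>, and \<open>k\<close> halvings carry the gap down to \<open>r\<close>, each at the price of a factor \<open>4\<close>;
  one more halving treats the gap at \<open>- 1\<close>.\<close>

lemma symbol_away_from_zero:
  assumes "0 < r"
  shows "\<exists>\<rho>. 0 < \<rho> \<and> \<rho> < 1 \<and> (\<forall>\<xi>. r \<le> \<bar>\<xi>\<bar> \<longrightarrow> \<bar>symbol \<xi>\<bar> \<le> \<rho>)"
proof -
  obtain A where A: "A > 0" "\<And>\<xi>. \<bar>symbol \<xi>\<bar> \<le> A / (1 + \<xi>\<^sup>2)"
    using symbol_decay by blast
  obtain k :: nat where k: "sqrt (2 * A) / r < 2 ^ k"
    using real_arch_pow[of 2] by auto
  have far: "1 / 2 \<le> 1 - symbol \<xi>" if "2 ^ k * r \<le> \<bar>\<xi>\<bar>" for \<xi>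
  proof -
    have "sqrt (2 * A) \<le> \<bar>\<xi>\<bar>"
      using k that assms by (simp add: pos_divide_less_eq)
    then have "2 * A \<le> \<xi>\<^sup>2"
      using A(1) abs_le_square_iff[of "sqrt (2 * A)" \<xi>] by simp
    then have "A / (1 + \<xi>\<^sup>2) \<le> 1 / 2"
      using A(1) by (simp add: divide_le_eq add_pos_nonneg)
    then show ?thesis using A(2)[of \<xi>] by linarith
  qed
  have gap: "(1 / 2) / 4 ^ j \<le> 1 - symbol \<xi>" if "2 ^ k * r \<le> 2 ^ j * \<bar>\<xi>\<bar>" for j \<xi>
    using that
  proof (induction j arbitrary: \<xi>)
    case 0
    then show ?case using far by simp
  next
    case (Suc j)
    then have "(1 / 2) / 4 ^ j \<le> 1 - symbol (2 * \<xi>)"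
      by (intro Suc.IH) (simp add: abs_mult mult_ac)
    then show ?case
      using symbol_double(1)[of \<xi>] by simp
  qed
  define \<delta> :: real where "\<delta> = (1 / 2) / 4 ^ Suc k"
  have "\<delta> \<le> 1 - symbol \<xi> \<and> \<delta> \<le> 1 + symbol \<xi>" if "r \<le> \<bar>\<xi>\<bar>" for \<xi>
  proof -
    have "(1 / 2) / 4 ^ k \<le> 1 - symbol (2 * \<xi>)"
      using that by (intro gap) (simp add: abs_mult)
    then show ?thesis using symbol_double[of \<xi>] by (simp add: \<delta>_def)
  qed
  then have "\<bar>symbol \<xi>\<bar> \<le> 1 - \<delta>" if "r \<le> \<bar>\<xi>\<bar>" for \<xi>
    using that by fastforce
  moreover have "0 < \<delta>" "\<delta> < 1"
  proof -
    have "(1::real) \<le> 4 ^ Suc k" by (rule one_le_power) simp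
    then show "0 < \<delta>" "\<delta> < 1" by (auto simp: \<delta>_def divide_less_eq)
  qed
  ultimately show ?thesis by (intro exI[of _ "1 - \<delta>"]) auto
qed

lemma symbol_vs_gaussian: "\<exists>A>0. \<forall>\<xi>. \<bar>symbol \<xi> - exp (- (diffusivity * \<xi>\<^sup>2))\<bar> \<le> A * \<xi> ^ 4"
proof -
  define A where "A = d\<^sup>2 * diffusivity / 12 + diffusivity\<^sup>2 / 2"
  have "\<bar>symbol \<xi> - exp (- (diffusivity * \<xi>\<^sup>2))\<bar> \<le> A * \<xi> ^ 4" for \<xi>
  proof -
    let ?y = "diffusivity * \<xi>\<^sup>2"
    have "0 \<le> ?y" using diffusivity_pos by simp
    then have "1 - ?y \<le> exp (- ?y)" "exp (- ?y) \<le> 1 - ?y + ?y\<^sup>2 / 2"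
      using exp_ge_add_one_self[of "- ?y"] exp_minus_quadratic_bound by auto
    moreover have "?y\<^sup>2 / 2 = diffusivity\<^sup>2 / 2 * \<xi> ^ 4"
      by (simp add: power_mult_distrib)
    moreover have "A * \<xi> ^ 4 = d\<^sup>2 * diffusivity / 12 * \<xi> ^ 4 + diffusivity\<^sup>2 / 2 * \<xi> ^ 4"
      by (simp add: A_def algebra_simps)
    ultimately show ?thesis
      using symbol_quartic[of \<xi>] by linarith
  qed
  moreover have "0 < A"
    using diffusivity_pos by (simp add: A_def add_nonneg_pos)
  ultimately show ?thesis by blast
qed

end

section \<open>Convolution powers of the kernel\<close>

lemma integrable_inverse_square: "integrable lborel (\<lambda>\<xi>::real. 1 / (1 + \<xi>\<^sup>2))"
  using integrable_inverse_1_plus_square by (simp add: set_integrable_def inverse_eq_divide)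

text \<open>Fubini's theorem in the form suited to Fourier integrals, where the two variables are
  coupled only through a bounded oscillating factor.\<close>

lemma fubini_modulated:
  fixes g h :: "real \<Rightarrow> real" and k :: "real \<Rightarrow> real \<Rightarrow> real"
  assumes g: "integrable lborel g" and h: "integrable lborel h"
    and k [measurable]: "case_prod k \<in> borel_measurable (lborel \<Otimes>\<^sub>M lborel)"
    and k1: "\<And>x y. \<bar>k x y\<bar> \<le> 1"
  shows "(\<integral>x. g x * (\<integral>y. h y * k x y \<partial>lborel) \<partial>lborel) = (\<integral>y. h y * (\<integral>x. g x * k x y \<partial>lborel) \<partial>lborel)"
proof -
  note [measurable] = borel_measurable_integrable[OF g] borel_measurable_integrable[OF h]
  have k2 [measurable]: "k x \<in> borel_measurable lborel" for x
    using measurable_Pair2[OF k, of x] by simp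
  have hk: "integrable lborel (\<lambda>y. h y * k x y)" for x
    by (rule Bochner_Integration.integrable_bound[OF h]) (auto simp: abs_mult k1 mult_left_le)
  have le: "(\<integral>y. \<bar>h y * k x y\<bar> \<partial>lborel) \<le> (\<integral>y. \<bar>h y\<bar> \<partial>lborel)" for x
    by (intro integral_mono integrable_abs hk h) (auto simp: abs_mult k1 mult_left_le)
  have "integrable (lborel \<Otimes>\<^sub>M lborel) (case_prod (\<lambda>x y. g x * (h y * k x y)))"
  proof (rule lborel_pair.Fubini_integrable)
    show "case_prod (\<lambda>x y. g x * (h y * k x y)) \<in> borel_measurable (lborel \<Otimes>\<^sub>M lborel)"
      by measurable
    have "integrable lborel (\<lambda>x. \<bar>g x\<bar> * (\<integral>y. \<bar>h y * k x y\<bar> \<partial>lborel))"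
    proof (rule Bochner_Integration.integrable_bound)
      show "integrable lborel (\<lambda>x. \<bar>g x\<bar> * (\<integral>y. \<bar>h y\<bar> \<partial>lborel))"
        using g by simp
      show "AE x in lborel. norm (\<bar>g x\<bar> * (\<integral>y. \<bar>h y * k x y\<bar> \<partial>lborel)) \<le> norm (\<bar>g x\<bar> * (\<integral>y. \<bar>h y\<bar> \<partial>lborel))"
        using le by (auto simp: abs_mult intro!: mult_left_mono)
      show "(\<lambda>x. \<bar>g x\<bar> * (\<integral>y. \<bar>h y * k x y\<bar> \<partial>lborel)) \<in> borel_measurable lborel"
        by measurable
    qed
    then show "integrable lborel (\<lambda>x. \<integral>y. norm (case (x, y) of (x, y) \<Rightarrow> g x * (h y * k x y)) \<partial>lborel)"
      by (simp add: abs_mult)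
    show "AE x in lborel. integrable lborel (\<lambda>y. case (x, y) of (x, y) \<Rightarrow> g x * (h y * k x y))"
      using hk by auto
  qed
  from lborel_pair.Fubini_integral[OF this]
  have "(\<integral>x. \<integral>y. g x * (h y * k x y) \<partial>lborel \<partial>lborel) = (\<integral>y. \<integral>x. g x * (h y * k x y) \<partial>lborel \<partial>lborel)"
    by simp
  also have "\<dots> = (\<integral>y. \<integral>x. h y * (g x * k x y) \<partial>lborel \<partial>lborel)"
    by (simp only: mult.left_commute)
  finally show ?thesis
    by (simp only: integral_mult_right_zero)
qed

lemma power_diff_le:
  fixes a b M :: real
  assumes "0 \<le> a" "a \<le> M" "0 \<le> b" "b \<le> M"
  shows "\<bar>a ^ Suc n - b ^ Suc n\<bar> \<le> real (Suc n) * \<bar>a - b\<bar> * M ^ n"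
proof -
  have "\<bar>a ^ Suc n - b ^ Suc n\<bar> = \<bar>a - b\<bar> * \<bar>\<Sum>p<Suc n. a ^ p * b ^ (n - p)\<bar>"
    by (simp only: diff_power_eq_sum abs_mult)
  moreover have "\<bar>\<Sum>p<Suc n. a ^ p * b ^ (n - p)\<bar> \<le> (\<Sum>p<Suc n. M ^ n)"
  proof (rule order_trans[OF sum_abs sum_mono])
    fix p assume "p \<in> {..<Suc n}"
    then have "M ^ n = M ^ p * M ^ (n - p)" by (simp flip: power_add)
    then show "\<bar>a ^ p * b ^ (n - p)\<bar> \<le> M ^ n"
      using assms by (auto simp: abs_mult intro!: mult_mono power_mono)
  qed
  then have "\<bar>\<Sum>p<Suc n. a ^ p * b ^ (n - p)\<bar> \<le> real (Suc n) * M ^ n"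
    by (simp del: sum.lessThan_Suc)
  then have "\<bar>a - b\<bar> * \<bar>\<Sum>p<Suc n. a ^ p * b ^ (n - p)\<bar> \<le> \<bar>a - b\<bar> * (real (Suc n) * M ^ n)"
    by (intro mult_left_mono) auto
  ultimately show ?thesis by (simp only: mult.assoc mult.left_commute)
qed

lemma sin_quadratic_bound: "\<bar>sin x - x\<bar> \<le> x\<^sup>2" for x :: real
proof -
  obtain t where t: "sin x = (\<Sum>m<2. sin_coeff m * x ^ m) + (sin (t + 1/2 * real 2 * pi) / fact 2) * x ^ 2"
    using Maclaurin_sin_expansion[of x 2] by blast
  then have "sin x - x = sin (t + 1/2 * real 2 * pi) * x\<^sup>2 / 2"
    by (simp add: numeral_2_eq_2 sin_coeff_def)
  moreover have "\<bar>sin (t + 1/2 * real 2 * pi) * x\<^sup>2\<bar> \<le> 1 * x\<^sup>2"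
    unfolding abs_mult by (intro mult_mono) auto
  ultimately have "\<bar>sin x - x\<bar> \<le> x\<^sup>2 / 2"
    by (simp add: abs_mult)
  then show ?thesis using zero_le_power2[of x] by linarith
qed

lemma dipole_bound: "0 < s \<Longrightarrow> \<bar>dipole x s\<bar> \<le> gauss_moment 1 / s"
proof -
  assume s: "0 < s"
  have i: "integrable lborel (\<lambda>\<xi>. \<xi> * exp (- (s * \<xi>\<^sup>2)) * sin (x * \<xi>))"
    using gauss_moment_integrable[OF s, of 1]
    by (rule Bochner_Integration.integrable_bound) (auto simp: abs_mult mult_left_le)
  have "2 * pi * \<bar>dipole x s\<bar> = \<bar>\<integral>\<xi>. \<xi> * exp (- (s * \<xi>\<^sup>2)) * sin (x * \<xi>) \<partial>lborel\<bar>"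
    using arg_cong[OF dipole_fourier[OF s, of x], of abs] by (simp add: abs_mult)
  also have "\<dots> \<le> (\<integral>\<xi>. \<bar>\<xi> * exp (- (s * \<xi>\<^sup>2)) * sin (x * \<xi>)\<bar> \<partial>lborel)"
    by (rule integral_abs_bound)
  also have "\<dots> \<le> (\<integral>\<xi>. \<bar>\<xi>\<bar> ^ 1 * exp (- (s * \<xi>\<^sup>2)) \<partial>lborel)"
    by (intro integral_mono integrable_abs gauss_moment_integrable s i) (auto simp: abs_mult mult_left_le)
  also have "\<dots> = gauss_moment 1 / s"
    using s by (simp only: gauss_moment_scaled) simp
  finally have "2 * pi * \<bar>dipole x s\<bar> \<le> gauss_moment 1 / s" .
  moreover have "1 * \<bar>dipole x s\<bar> \<le> 2 * pi * \<bar>dipole x s\<bar>"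
    using pi_ge_two by (intro mult_right_mono) auto
  ultimately show ?thesis by simp
qed

lemma exp_minus_diff_le:
  fixes a b c :: real
  assumes "c \<le> a" "c \<le> b"
  shows "\<bar>exp (- a) - exp (- b)\<bar> \<le> \<bar>a - b\<bar> * exp (- c)"
proof -
  have *: "\<bar>exp (- a) - exp (- b)\<bar> \<le> \<bar>a - b\<bar> * exp (- c)" if "c \<le> a" "a \<le> b" for a b
  proof -
    have "1 - exp (a - b) \<le> b - a"
      using exp_ge_add_one_self[of "a - b"] by linarith
    then have "exp (- a) * (1 - exp (a - b)) \<le> exp (- c) * (b - a)"
      using that by (intro mult_mono) auto
    then show ?thesis
      using that by (simp add: right_diff_distrib flip: exp_add) (simp add: left_diff_distrib mult.commute)
  qed
  show ?thesis
    using *[of a b] *[of b a] assms by (cases "a \<le> b") (auto simp: abs_minus_commute)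
qed

text \<open>In Fourier variables a time derivative costs \<open>\<xi>\<^sup>2\<close>, so the third absolute moment of a Gaussian
  appears, which scales like the inverse square of the time.\<close>

lemma dipole_time_lipschitz:
  assumes c: "0 < c" "c \<le> s" "c \<le> t"
  shows "\<bar>dipole x s - dipole x t\<bar> \<le> gauss_moment 3 * \<bar>s - t\<bar> / c\<^sup>2"
proof -
  have st: "0 < s" "0 < t" using c by auto
  have i: "integrable lborel (\<lambda>\<xi>. \<xi> * exp (- (s * \<xi>\<^sup>2)) * sin (x * \<xi>))" if "0 < s" for s
    using gauss_moment_integrable[OF that, of 1]
    by (rule Bochner_Integration.integrable_bound) (auto simp: abs_mult mult_left_le)
  have "2 * pi * (dipole x s - dipole x t) =
      (\<integral>\<xi>. \<xi> * exp (- (t * \<xi>\<^sup>2)) * sin (x * \<xi>) \<partial>lborel) - (\<integral>\<xi>. \<xi> * exp (- (s * \<xi>\<^sup>2)) * sin (x * \<xi>) \<partial>lborel)"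
    using dipole_fourier[OF st(1), of x] dipole_fourier[OF st(2), of x] by (simp add: right_diff_distrib)
  also have "\<dots> = (\<integral>\<xi>. \<xi> * exp (- (t * \<xi>\<^sup>2)) * sin (x * \<xi>) - \<xi> * exp (- (s * \<xi>\<^sup>2)) * sin (x * \<xi>) \<partial>lborel)"
    by (rule Bochner_Integration.integral_diff[OF i[OF st(2)] i[OF st(1)], symmetric])
  finally have "2 * pi * \<bar>dipole x s - dipole x t\<bar> =
      \<bar>\<integral>\<xi>. \<xi> * exp (- (t * \<xi>\<^sup>2)) * sin (x * \<xi>) - \<xi> * exp (- (s * \<xi>\<^sup>2)) * sin (x * \<xi>) \<partial>lborel\<bar>"
    by (metis abs_mult abs_of_pos pi_gt_zero mult_pos_pos zero_less_numeral)
  also have "\<dots> \<le> (\<integral>\<xi>. \<bar>\<xi> * exp (- (t * \<xi>\<^sup>2)) * sin (x * \<xi>) - \<xi> * exp (- (s * \<xi>\<^sup>2)) * sin (x * \<xi>)\<bar> \<partial>lborel)"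
    by (rule integral_abs_bound)
  also have "\<dots> \<le> (\<integral>\<xi>. \<bar>s - t\<bar> * (\<bar>\<xi>\<bar> ^ 3 * exp (- (c * \<xi>\<^sup>2))) \<partial>lborel)"
  proof (intro integral_mono integrable_abs Bochner_Integration.integrable_diff i st
      integrable_mult_right gauss_moment_integrable c)
    fix \<xi>
    have "c * \<xi>\<^sup>2 \<le> t * \<xi>\<^sup>2" "c * \<xi>\<^sup>2 \<le> s * \<xi>\<^sup>2" using c by (auto intro: mult_right_mono)
    then have e: "\<bar>exp (- (t * \<xi>\<^sup>2)) - exp (- (s * \<xi>\<^sup>2))\<bar> \<le> \<bar>t * \<xi>\<^sup>2 - s * \<xi>\<^sup>2\<bar> * exp (- (c * \<xi>\<^sup>2))"
      by (rule exp_minus_diff_le)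
    have "\<xi> * exp (- (t * \<xi>\<^sup>2)) * sin (x * \<xi>) - \<xi> * exp (- (s * \<xi>\<^sup>2)) * sin (x * \<xi>)
       = sin (x * \<xi>) * (\<xi> * (exp (- (t * \<xi>\<^sup>2)) - exp (- (s * \<xi>\<^sup>2))))"
      by (simp add: algebra_simps)
    also have "\<bar>\<dots>\<bar> \<le> 1 * (\<bar>\<xi>\<bar> * (\<bar>t * \<xi>\<^sup>2 - s * \<xi>\<^sup>2\<bar> * exp (- (c * \<xi>\<^sup>2))))"
      unfolding abs_mult using e by (intro mult_mono order_refl) (auto simp: abs_mult)
    also have "\<bar>t * \<xi>\<^sup>2 - s * \<xi>\<^sup>2\<bar> = \<bar>s - t\<bar> * \<bar>\<xi>\<bar>\<^sup>2"
      unfolding left_diff_distrib[symmetric] abs_mult by (simp add: abs_minus_commute)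
    finally show "\<bar>\<xi> * exp (- (t * \<xi>\<^sup>2)) * sin (x * \<xi>) - \<xi> * exp (- (s * \<xi>\<^sup>2)) * sin (x * \<xi>)\<bar>
        \<le> \<bar>s - t\<bar> * (\<bar>\<xi>\<bar> ^ 3 * exp (- (c * \<xi>\<^sup>2)))"
      by (simp add: power2_eq_square power3_eq_cube mult_ac)
  qed
  also have "\<dots> = \<bar>s - t\<bar> * (gauss_moment 3 / sqrt c ^ Suc 3)"
    unfolding integral_mult_right_zero gauss_moment_scaled[OF c(1)] ..
  also have "sqrt c ^ Suc 3 = c\<^sup>2"
    using c(1) by (simp add: eval_nat_numeral)
  finally have "2 * pi * \<bar>dipole x s - dipole x t\<bar> \<le> gauss_moment 3 * \<bar>s - t\<bar> / c\<^sup>2"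
    by (simp add: mult.commute)
  moreover have "1 * \<bar>dipole x s - dipole x t\<bar> \<le> 2 * pi * \<bar>dipole x s - dipole x t\<bar>"
    using pi_ge_two by (intro mult_right_mono) auto
  ultimately show ?thesis by simp
qed

context dispersal_kernel
begin

text \<open>The density of a sum of \<open>n + 1\<close> independent displacements, that is the \<open>(n + 1)\<close>-fold
  convolution power of \<open>J\<close>; the shift keeps every member of the family a genuine function.\<close>

primrec kernel_power :: "nat \<Rightarrow> real \<Rightarrow> real" where
  "kernel_power 0 = J"
| "kernel_power (Suc n) = (\<lambda>x. \<integral>y. J (x - y) * kernel_power n y \<partial>lborel)"

lemma kernel_power_measurable [measurable]: "kernel_power n \<in> borel_measurable borel"
proof (induction n)
  case (Suc n)
  note [measurable] = Suc.IH
  show ?case by simp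
qed simp

lemma symbol_power_integrable: "integrable lborel (\<lambda>\<xi>. symbol \<xi> ^ Suc n)"
proof -
  obtain A where A: "A > 0" "\<And>\<xi>. \<bar>symbol \<xi>\<bar> \<le> A / (1 + \<xi>\<^sup>2)"
    using symbol_decay by blast
  have "integrable lborel (\<lambda>\<xi>. A * (1 / (1 + \<xi>\<^sup>2)))"
    by (intro integrable_mult_right integrable_inverse_square)
  then show ?thesis
  proof (rule Bochner_Integration.integrable_bound)
    have "\<bar>symbol \<xi>\<bar> * \<bar>symbol \<xi>\<bar> ^ n \<le> \<bar>symbol \<xi>\<bar> * 1" for \<xi>
      using symbol_abs_le_1 by (intro mult_left_mono power_le_one) auto
    then have "\<bar>symbol \<xi> ^ Suc n\<bar> \<le> \<bar>A * (1 / (1 + \<xi>\<^sup>2))\<bar>" for \<xi>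
      using order_trans[OF _ A(2)[of \<xi>]] A(1) by (simp add: abs_mult power_abs)
    then show "AE \<xi> in lborel. norm (symbol \<xi> ^ Suc n) \<le> norm (A * (1 / (1 + \<xi>\<^sup>2)))"
      by simp
  qed measurable
qed

lemma J_sin_integral_zero: "(\<integral>z. J z * sin (z * \<xi>) \<partial>lborel) = 0"
  using lborel_integral_real_affine[of "-1" "\<lambda>z. J z * sin (z * \<xi>)" 0] by (simp add: J_even)

lemma J_translate_cos: "(\<integral>y. J (x - y) * cos (y * \<xi>) \<partial>lborel) = symbol \<xi> * cos (x * \<xi>)"
proof -
  have s: "integrable lborel (\<lambda>z. J z * sin (z * \<xi>))"
    by (rule J_mult_integrable[of _ 1]) auto
  have "(\<integral>y. J (x - y) * cos (y * \<xi>) \<partial>lborel) = (\<integral>z. J z * cos ((x - z) * \<xi>) \<partial>lborel)"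
    using lborel_integral_real_affine[of "-1" "\<lambda>y. J (x - y) * cos (y * \<xi>)" x] by simp
  also have "\<dots> = (\<integral>z. cos (x * \<xi>) * (J z * cos (z * \<xi>)) + sin (x * \<xi>) * (J z * sin (z * \<xi>)) \<partial>lborel)"
    by (intro Bochner_Integration.integral_cong) (auto simp: left_diff_distrib cos_diff algebra_simps)
  also have "\<dots> = cos (x * \<xi>) * symbol \<xi> + sin (x * \<xi>) * 0"
    using s J_cos_integrable
    by (subst Bochner_Integration.integral_add) (auto simp: symbol_def J_sin_integral_zero)
  finally show ?thesis by simp
qed

text \<open>Fourier inversion for \<open>J\<close>, by Gaussian summation: against the factor \<open>exp (- s \<xi>\<^sup>2)\<close> the
  double integral may be interchanged, and the inner integral is a heat kernel of width
  \<open>2 sqrt s\<close>, which concentrates at \<open>x\<close> as \<open>s\<close> tends to \<open>0\<close>.\<close>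

lemma J_gauss_sum:
  assumes s: "0 < s"
  shows "(\<integral>\<xi>. exp (- (s * \<xi>\<^sup>2)) * (symbol \<xi> * cos (x * \<xi>)) \<partial>lborel) =
    2 * sqrt pi * (\<integral>w. J (x + 2 * sqrt s * w) * exp (- w\<^sup>2) \<partial>lborel)"
proof -
  have g: "integrable lborel (\<lambda>\<xi>. exp (- (s * \<xi>\<^sup>2)))"
    using gauss_moment_integrable[OF s, of 0] by simp
  have gc: "integrable lborel (\<lambda>\<xi>. exp (- (s * \<xi>\<^sup>2)) * cos (y * \<xi>))" for y
    by (rule Bochner_Integration.integrable_bound[OF g]) (auto simp: abs_mult)
  let ?G = "\<lambda>y. sqrt (pi / s) * exp (- (y\<^sup>2) / (4 * s))"
  have "(\<integral>\<xi>. exp (- (s * \<xi>\<^sup>2)) * (symbol \<xi> * cos (x * \<xi>)) \<partial>lborel) =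
     (\<integral>\<xi>. exp (- (s * \<xi>\<^sup>2)) * (\<integral>y. J (x - y) * cos (y * \<xi>) \<partial>lborel) \<partial>lborel)"
    by (simp add: J_translate_cos)
  also have "\<dots> = (\<integral>y. J (x - y) * (\<integral>\<xi>. exp (- (s * \<xi>\<^sup>2)) * cos (y * \<xi>) \<partial>lborel) \<partial>lborel)"
  proof (rule fubini_modulated)
    show "integrable lborel (\<lambda>y. J (x - y))"
      using lborel_integrable_real_affine[OF J_integrable, of "-1" x] by simp
  qed (use g in auto)
  also have "\<dots> = (\<integral>y. J (x - y) * ?G y \<partial>lborel)"
    by (simp add: gauss_cos_integral[OF s])
  also have "\<dots> = 2 * sqrt s * (\<integral>w. J (x - (2 * sqrt s * w)) * ?G (2 * sqrt s * w) \<partial>lborel)"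
    using s lborel_integral_real_affine[of "2 * sqrt s" "\<lambda>y. J (x - y) * ?G y" 0] by simp
  also have "\<dots> = 2 * sqrt s * (\<integral>w. J (x + 2 * sqrt s * w) * ?G (2 * sqrt s * w) \<partial>lborel)"
    using lborel_integral_real_affine[of "-1" "\<lambda>w. J (x - (2 * sqrt s * w)) * ?G (2 * sqrt s * w)" 0] by simp
  also have "(\<lambda>w. J (x + 2 * sqrt s * w) * ?G (2 * sqrt s * w)) =
      (\<lambda>w. sqrt (pi / s) * (J (x + 2 * sqrt s * w) * exp (- w\<^sup>2)))"
    using s by (auto simp: power_mult_distrib)
  also have "2 * sqrt s * (\<integral>w. sqrt (pi / s) * (J (x + 2 * sqrt s * w) * exp (- w\<^sup>2)) \<partial>lborel) =
     2 * sqrt pi * (\<integral>w. J (x + 2 * sqrt s * w) * exp (- w\<^sup>2) \<partial>lborel)"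
    unfolding integral_mult_right_zero using s by (simp add: real_sqrt_divide)
  finally show ?thesis .
qed

lemma J_fourier_inversion: "2 * pi * J x = (\<integral>\<xi>. symbol \<xi> * cos (x * \<xi>) \<partial>lborel)"
proof -
  define s :: "nat \<Rightarrow> real" where "s n = 1 / real (Suc n)" for n
  have s: "0 < s n" for n by (simp add: s_def)
  have s0: "s \<longlonglongrightarrow> 0"
    unfolding s_def by real_asymp
  obtain B where B: "B > 0" "\<And>z. J z \<le> B" using J_bounded by blast
  have a: "integrable lborel symbol" using symbol_power_integrable[of 0] by simp
  have 1: "(\<lambda>n. \<integral>\<xi>. exp (- (s n * \<xi>\<^sup>2)) * (symbol \<xi> * cos (x * \<xi>)) \<partial>lborel) \<longlonglongrightarrow>
      (\<integral>\<xi>. symbol \<xi> * cos (x * \<xi>) \<partial>lborel)"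
  proof (rule integral_dominated_convergence)
    show "integrable lborel (\<lambda>\<xi>. \<bar>symbol \<xi>\<bar>)" using a by simp
    have "(\<lambda>n. exp (- (s n * \<xi>\<^sup>2)) * (symbol \<xi> * cos (x * \<xi>))) \<longlonglongrightarrow>
       exp (- (0 * \<xi>\<^sup>2)) * (symbol \<xi> * cos (x * \<xi>))" for \<xi>
      by (intro tendsto_intros s0)
    then show "AE \<xi> in lborel. (\<lambda>n. exp (- (s n * \<xi>\<^sup>2)) * (symbol \<xi> * cos (x * \<xi>))) \<longlonglongrightarrow> symbol \<xi> * cos (x * \<xi>)"
      by simp
    have "\<bar>exp (- (s n * \<xi>\<^sup>2)) * (symbol \<xi> * cos (x * \<xi>))\<bar> \<le> 1 * (\<bar>symbol \<xi>\<bar> * 1)" for n \<xi>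
      unfolding abs_mult using s[of n] by (intro mult_mono) auto
    then show "AE \<xi> in lborel. norm (exp (- (s n * \<xi>\<^sup>2)) * (symbol \<xi> * cos (x * \<xi>))) \<le> \<bar>symbol \<xi>\<bar>" for n
      by simp
  qed measurable
  have 2: "(\<lambda>n. \<integral>w. J (x + 2 * sqrt (s n) * w) * exp (- w\<^sup>2) \<partial>lborel) \<longlonglongrightarrow>
      (\<integral>w. J x * exp (- w\<^sup>2) \<partial>lborel)"
  proof (rule integral_dominated_convergence)
    show "integrable lborel (\<lambda>w. B * exp (- w\<^sup>2))"
      using gauss_moment_integrable[of 1 0] by simp
    have "(\<lambda>n. J (x + 2 * sqrt (s n) * w) * exp (- w\<^sup>2)) \<longlonglongrightarrow> J (x + 2 * sqrt 0 * w) * exp (- w\<^sup>2)" for w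
      by (intro tendsto_intros isCont_tendsto_compose[of _ J] s0 DERIV_isCont[OF J_deriv])
    then show "AE w in lborel. (\<lambda>n. J (x + 2 * sqrt (s n) * w) * exp (- w\<^sup>2)) \<longlonglongrightarrow> J x * exp (- w\<^sup>2)"
      by simp
    show "AE w in lborel. norm (J (x + 2 * sqrt (s n) * w) * exp (- w\<^sup>2)) \<le> B * exp (- w\<^sup>2)" for n
      using B J_nonneg by (auto simp: abs_mult)
  qed measurable
  have "(\<integral>w. exp (- w\<^sup>2) \<partial>lborel) = sqrt pi"
    using gauss_cos_integral[of 1 0] by simp
  then have "2 * sqrt pi * (\<integral>w. J x * exp (- w\<^sup>2) \<partial>lborel) = 2 * pi * J x"
    by simp
  note * = this
  have "(\<lambda>n. 2 * sqrt pi * (\<integral>w. J (x + 2 * sqrt (s n) * w) * exp (- w\<^sup>2) \<partial>lborel)) \<longlonglongrightarrow> 2 * pi * J x"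
    using tendsto_mult_left[OF 2, of "2 * sqrt pi"] unfolding * .
  then show ?thesis
    using 1 LIMSEQ_unique unfolding J_gauss_sum[OF s] by blast
qed

lemma kernel_power_fourier: "2 * pi * kernel_power n x = (\<integral>\<xi>. symbol \<xi> ^ Suc n * cos (x * \<xi>) \<partial>lborel)"
proof (induction n arbitrary: x)
  case 0
  then show ?case using J_fourier_inversion by simp
next
  case (Suc n)
  have "2 * pi * kernel_power (Suc n) x = (\<integral>y. J (x - y) * (2 * pi * kernel_power n y) \<partial>lborel)"
    by (simp add: mult.left_commute[of "J _"] mult.assoc flip: integral_mult_right_zero)
  also have "\<dots> = (\<integral>y. J (x - y) * (\<integral>\<xi>. symbol \<xi> ^ Suc n * cos (y * \<xi>) \<partial>lborel) \<partial>lborel)"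
    by (simp only: Suc.IH)
  also have "\<dots> = (\<integral>\<xi>. symbol \<xi> ^ Suc n * (\<integral>y. J (x - y) * cos (y * \<xi>) \<partial>lborel) \<partial>lborel)"
  proof (rule fubini_modulated)
    show "integrable lborel (\<lambda>y. J (x - y))"
      using lborel_integrable_real_affine[OF J_integrable, of "-1" x] by simp
  qed (use symbol_power_integrable in auto)
  also have "\<dots> = (\<integral>\<xi>. symbol \<xi> ^ Suc (Suc n) * cos (x * \<xi>) \<partial>lborel)"
    unfolding J_translate_cos by (simp add: mult_ac)
  finally show ?case .
qed

text \<open>Near the origin the powers of the symbol are dominated by a Gaussian that narrows with \<open>n\<close>.
  Elsewhere the gap yields a geometric factor, while two of the factors are kept in reserve for
  integrability.\<close>

lemma symbol_power_majorant:
  "\<exists>\<rho> C. 0 < \<rho> \<and> \<rho> < 1 \<and> 0 < C \<and>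
    (\<forall>n \<xi>. \<bar>symbol \<xi>\<bar> ^ Suc (Suc n) \<le>
       exp (- (diffusivity * real (n + 2) / 2 * \<xi>\<^sup>2)) + C * \<rho> ^ n * (1 / (1 + \<xi>\<^sup>2)\<^sup>2))"
proof -
  obtain r where r: "r > 0" "\<And>\<xi>. \<bar>\<xi>\<bar> < r \<Longrightarrow> 0 \<le> symbol \<xi>"
      "\<And>\<xi>. \<bar>\<xi>\<bar> < r \<Longrightarrow> symbol \<xi> \<le> exp (- (diffusivity * \<xi>\<^sup>2 / 2))"
    using symbol_near_zero by blast
  obtain \<rho> where \<rho>: "0 < \<rho>" "\<rho> < 1" "\<And>\<xi>. r \<le> \<bar>\<xi>\<bar> \<Longrightarrow> \<bar>symbol \<xi>\<bar> \<le> \<rho>"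
    using symbol_away_from_zero[OF r(1)] by blast
  obtain A where A: "A > 0" "\<And>\<xi>. \<bar>symbol \<xi>\<bar> \<le> A / (1 + \<xi>\<^sup>2)"
    using symbol_decay by blast
  have "\<bar>symbol \<xi>\<bar> ^ Suc (Suc n) \<le>
       exp (- (diffusivity * real (n + 2) / 2 * \<xi>\<^sup>2)) + A\<^sup>2 * \<rho> ^ n * (1 / (1 + \<xi>\<^sup>2)\<^sup>2)" for n \<xi>
  proof (cases "\<bar>\<xi>\<bar> < r")
    case True
    have "\<bar>symbol \<xi>\<bar> ^ Suc (Suc n) \<le> exp (- (diffusivity * \<xi>\<^sup>2 / 2)) ^ Suc (Suc n)"
      using r(2,3)[OF True] by (intro power_mono) auto
    also have "\<dots> = exp (- (diffusivity * real (n + 2) / 2 * \<xi>\<^sup>2))"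
      by (subst exp_of_nat_mult[symmetric]) (simp add: field_simps)
    also have "\<dots> \<le> \<dots> + A\<^sup>2 * \<rho> ^ n * (1 / (1 + \<xi>\<^sup>2)\<^sup>2)"
      using \<rho>(1) by simp
    finally show ?thesis .
  next
    case False
    have "\<bar>symbol \<xi>\<bar> ^ Suc (Suc n) = \<bar>symbol \<xi>\<bar> ^ n * \<bar>symbol \<xi>\<bar>\<^sup>2"
      by (simp add: power2_eq_square)
    also have "\<dots> \<le> \<rho> ^ n * (A / (1 + \<xi>\<^sup>2))\<^sup>2"
      using False \<rho> A by (intro mult_mono power_mono) auto
    also have "\<dots> = A\<^sup>2 * \<rho> ^ n * (1 / (1 + \<xi>\<^sup>2)\<^sup>2)"
      by (simp add: power_divide)
    also have "\<dots> \<le> exp (- (diffusivity * real (n + 2) / 2 * \<xi>\<^sup>2)) + \<dots>"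
      by simp
    finally show ?thesis .
  qed
  then show ?thesis
    using \<rho>(1,2) A(1) by (intro exI[of _ \<rho>] exI[of _ "A\<^sup>2"]) auto
qed

lemma symbol_power_moment:
  "\<exists>\<rho> C. 0 < \<rho> \<and> \<rho> < 1 \<and> 0 < C \<and> (\<forall>n. \<forall>j\<le>1.
     integrable lborel (\<lambda>\<xi>. \<bar>\<xi>\<bar> ^ j * \<bar>symbol \<xi>\<bar> ^ Suc (Suc n)) \<and>
     (\<integral>\<xi>. \<bar>\<xi>\<bar> ^ j * \<bar>symbol \<xi>\<bar> ^ Suc (Suc n) \<partial>lborel) \<le>
       gauss_moment j / sqrt (diffusivity * real (n + 2) / 2) ^ Suc j + C * \<rho> ^ n)"
proof -
  obtain \<rho> C where \<rho>: "0 < \<rho>" "\<rho> < 1" and C: "0 < C" and le: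
    "\<And>n \<xi>. \<bar>symbol \<xi>\<bar> ^ Suc (Suc n) \<le>
       exp (- (diffusivity * real (n + 2) / 2 * \<xi>\<^sup>2)) + C * \<rho> ^ n * (1 / (1 + \<xi>\<^sup>2)\<^sup>2)"
    using symbol_power_majorant by blast
  define I :: real where "I = (\<integral>\<xi>. 1 / (1 + \<xi>\<^sup>2) \<partial>lborel)"
  have "0 \<le> I" unfolding I_def by (intro integral_nonneg_AE) auto
  have "integrable lborel (\<lambda>\<xi>. \<bar>\<xi>\<bar> ^ j * \<bar>symbol \<xi>\<bar> ^ Suc (Suc n)) \<and>
     (\<integral>\<xi>. \<bar>\<xi>\<bar> ^ j * \<bar>symbol \<xi>\<bar> ^ Suc (Suc n) \<partial>lborel) \<le>
       gauss_moment j / sqrt (diffusivity * real (n + 2) / 2) ^ Suc j + (C * (I + 1)) * \<rho> ^ n"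
    if "j \<le> 1" for n j
  proof -
    let ?c = "diffusivity * real (n + 2) / 2"
    have c: "0 < ?c" using diffusivity_pos by simp
    let ?M = "\<lambda>\<xi>. \<bar>\<xi>\<bar> ^ j * exp (- (?c * \<xi>\<^sup>2)) + C * \<rho> ^ n * (1 / (1 + \<xi>\<^sup>2))"
    have i1: "integrable lborel (\<lambda>\<xi>. \<bar>\<xi>\<bar> ^ j * exp (- (?c * \<xi>\<^sup>2)))"
      by (rule gauss_moment_integrable[OF c])
    have i2: "integrable lborel (\<lambda>\<xi>::real. C * \<rho> ^ n * (1 / (1 + \<xi>\<^sup>2)))"
      by (intro integrable_mult_right integrable_inverse_square)
    have M: "\<bar>\<xi>\<bar> ^ j * \<bar>symbol \<xi>\<bar> ^ Suc (Suc n) \<le> ?M \<xi>" for \<xi>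
    proof -
      have "\<bar>\<xi>\<bar> ^ j \<le> 1 + \<xi>\<^sup>2"
      proof -
        have "0 \<le> (\<bar>\<xi>\<bar> - 1)\<^sup>2" by simp
        then have "2 * \<bar>\<xi>\<bar> \<le> 1 + \<xi>\<^sup>2" by (simp add: power2_diff)
        then have "\<bar>\<xi>\<bar> \<le> 1 + \<xi>\<^sup>2" by simp
        moreover have "j = 0 \<or> j = 1" using that by auto
        ultimately show ?thesis by auto
      qed
      then have "\<bar>\<xi>\<bar> ^ j * (1 / (1 + \<xi>\<^sup>2)\<^sup>2) \<le> (1 + \<xi>\<^sup>2) * (1 / (1 + \<xi>\<^sup>2)\<^sup>2)"
        by (intro mult_right_mono) auto
      also have "\<dots> = 1 / (1 + \<xi>\<^sup>2)"
        using add_pos_nonneg[of 1 "\<xi>\<^sup>2"] by (simp add: power2_eq_square)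
      finally have "C * \<rho> ^ n * (\<bar>\<xi>\<bar> ^ j * (1 / (1 + \<xi>\<^sup>2)\<^sup>2)) \<le> C * \<rho> ^ n * (1 / (1 + \<xi>\<^sup>2))"
        using C \<rho> by (intro mult_left_mono) auto
      moreover have "\<bar>\<xi>\<bar> ^ j * \<bar>symbol \<xi>\<bar> ^ Suc (Suc n) \<le>
          \<bar>\<xi>\<bar> ^ j * (exp (- (?c * \<xi>\<^sup>2)) + C * \<rho> ^ n * (1 / (1 + \<xi>\<^sup>2)\<^sup>2))"
        using le by (intro mult_left_mono) auto
      ultimately show ?thesis
        by (simp only: distrib_left mult.left_commute[of "\<bar>\<xi>\<bar> ^ j" "C * \<rho> ^ n"])
    qed
    have i: "integrable lborel (\<lambda>\<xi>. \<bar>\<xi>\<bar> ^ j * \<bar>symbol \<xi>\<bar> ^ Suc (Suc n))"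
    proof (rule Bochner_Integration.integrable_bound[OF Bochner_Integration.integrable_add[OF i1 i2]])
      show "AE \<xi> in lborel. norm (\<bar>\<xi>\<bar> ^ j * \<bar>symbol \<xi>\<bar> ^ Suc (Suc n)) \<le> norm (?M \<xi>)"
        using order_trans[OF M abs_ge_self] by simp
    qed measurable
    have "(\<integral>\<xi>. \<bar>\<xi>\<bar> ^ j * \<bar>symbol \<xi>\<bar> ^ Suc (Suc n) \<partial>lborel) \<le> (\<integral>\<xi>. ?M \<xi> \<partial>lborel)"
      by (intro integral_mono i Bochner_Integration.integrable_add i1 i2 M)
    also have "\<dots> = gauss_moment j / sqrt ?c ^ Suc j + C * \<rho> ^ n * I"
      unfolding Bochner_Integration.integral_add[OF i1 i2] gauss_moment_scaled[OF c]
        integral_mult_right_zero I_def ..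
    also have "\<dots> \<le> gauss_moment j / sqrt ?c ^ Suc j + (C * (I + 1)) * \<rho> ^ n"
      using C \<rho> by (simp add: algebra_simps)
    finally show ?thesis using i by blast
  qed
  moreover have "0 < C * (I + 1)" using C \<open>0 \<le> I\<close> by simp
  ultimately show ?thesis
    using \<rho> by (intro exI[of _ \<rho>] exI[of _ "C * (I + 1)"]) auto
qed

text \<open>The kernel with which the free walk acts on odd functions, as an integral over the positive
  half-line.\<close>

definition odd_kernel :: "nat \<Rightarrow> real \<Rightarrow> real \<Rightarrow> real" where
  "odd_kernel n x y = kernel_power n (x - y) - kernel_power n (x + y)"

lemma odd_kernel_fourier:
  shows "integrable lborel (\<lambda>\<xi>. symbol \<xi> ^ Suc n * (sin (x * \<xi>) * sin (y * \<xi>)))"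
    and "pi * odd_kernel n x y = (\<integral>\<xi>. symbol \<xi> ^ Suc n * (sin (x * \<xi>) * sin (y * \<xi>)) \<partial>lborel)"
proof -
  have i: "integrable lborel (\<lambda>\<xi>. symbol \<xi> ^ Suc n * cos (z * \<xi>))" for z
    by (rule Bochner_Integration.integrable_bound[OF symbol_power_integrable[of n]])
       (auto simp: abs_mult mult_left_le simp del: power_Suc)
  have "cos ((x - y) * \<xi>) - cos ((x + y) * \<xi>) = 2 * (sin (x * \<xi>) * sin (y * \<xi>))" for \<xi>
    by (simp add: left_diff_distrib distrib_right cos_diff cos_add)
  then have *: "symbol \<xi> ^ Suc n * (sin (x * \<xi>) * sin (y * \<xi>)) =
    (1 / 2) * (symbol \<xi> ^ Suc n * cos ((x - y) * \<xi>) - symbol \<xi> ^ Suc n * cos ((x + y) * \<xi>))" for \<xi>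
    by (simp del: power_Suc flip: right_diff_distrib)
  show "integrable lborel (\<lambda>\<xi>. symbol \<xi> ^ Suc n * (sin (x * \<xi>) * sin (y * \<xi>)))"
    unfolding * by (intro integrable_mult_right Bochner_Integration.integrable_diff i)
  have "2 * pi * odd_kernel n x y =
      (\<integral>\<xi>. symbol \<xi> ^ Suc n * cos ((x - y) * \<xi>) - symbol \<xi> ^ Suc n * cos ((x + y) * \<xi>) \<partial>lborel)"
    unfolding Bochner_Integration.integral_diff[OF i i] odd_kernel_def right_diff_distrib
      kernel_power_fourier ..
  then show "pi * odd_kernel n x y = (\<integral>\<xi>. symbol \<xi> ^ Suc n * (sin (x * \<xi>) * sin (y * \<xi>)) \<partial>lborel)"
    unfolding * integral_mult_right_zero by simp
qed

lemma geometric_linear_bounded: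
  fixes \<rho> :: real
  assumes "0 < \<rho>" "\<rho> < 1"
  shows "\<exists>K>0. \<forall>n. \<rho> ^ n * real (n + 2) \<le> K"
proof -
  have "(\<lambda>n. \<rho> ^ n * real (n + 2)) \<longlonglongrightarrow> 0"
    using assms by real_asymp
  then have "Bseq (\<lambda>n. \<rho> ^ n * real (n + 2))"
    using convergent_imp_Bseq convergentI by blast
  then obtain K where "K > 0" "\<And>n. norm (\<rho> ^ n * real (n + 2)) \<le> K"
    unfolding Bseq_def by blast
  then show ?thesis
    by (intro exI[of _ K]) (auto simp: abs_le_iff)
qed

text \<open>For \<open>j \<le> 1\<close> the Gaussian part is at least of order \<open>1 / n\<close> and absorbs the geometric
  error.\<close>

lemma symbol_power_moment_decay:
  "\<exists>C>0. \<forall>n. \<forall>j\<le>1.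
     integrable lborel (\<lambda>\<xi>. \<bar>\<xi>\<bar> ^ j * \<bar>symbol \<xi>\<bar> ^ Suc (Suc n)) \<and>
     (\<integral>\<xi>. \<bar>\<xi>\<bar> ^ j * \<bar>symbol \<xi>\<bar> ^ Suc (Suc n) \<partial>lborel) \<le> C / sqrt (real (n + 2)) ^ Suc j"
proof -
  obtain \<rho> C where \<rho>: "0 < \<rho>" "\<rho> < 1" and C: "0 < C" and le: "\<And>n j. j \<le> 1 \<Longrightarrow>
     integrable lborel (\<lambda>\<xi>. \<bar>\<xi>\<bar> ^ j * \<bar>symbol \<xi>\<bar> ^ Suc (Suc n)) \<and>
     (\<integral>\<xi>. \<bar>\<xi>\<bar> ^ j * \<bar>symbol \<xi>\<bar> ^ Suc (Suc n) \<partial>lborel) \<le>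
       gauss_moment j / sqrt (diffusivity * real (n + 2) / 2) ^ Suc j + C * \<rho> ^ n"
    using symbol_power_moment by blast
  obtain K where K: "K > 0" "\<And>n. \<rho> ^ n * real (n + 2) \<le> K"
    using geometric_linear_bounded[OF \<rho>] by blast
  define G where "G j = gauss_moment j / sqrt (diffusivity / 2) ^ Suc j" for j
  have G0: "0 \<le> G j" for j
    using gauss_moment_nonneg diffusivity_pos by (simp add: G_def)
  have "(\<integral>\<xi>. \<bar>\<xi>\<bar> ^ j * \<bar>symbol \<xi>\<bar> ^ Suc (Suc n) \<partial>lborel) \<le> (G 0 + G 1 + C * K) / sqrt (real (n + 2)) ^ Suc j"
    if j: "j \<le> 1" for n j
  proof -
    let ?s = "sqrt (real (n + 2)) ^ Suc j"
    have s0: "0 < ?s" by simp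
    have s1: "?s \<le> real (n + 2)"
    proof -
      have "?s \<le> sqrt (real (n + 2)) ^ 2"
        using j by (intro power_increasing) auto
      then show ?thesis by simp
    qed
    have "sqrt (diffusivity * real (n + 2) / 2) ^ Suc j = sqrt (diffusivity / 2) ^ Suc j * ?s"
      by (simp only: power_mult_distrib[symmetric] real_sqrt_mult[symmetric]) simp
    then have "gauss_moment j / sqrt (diffusivity * real (n + 2) / 2) ^ Suc j = G j / ?s"
      by (simp only: G_def divide_divide_eq_left)
    moreover have "C * \<rho> ^ n \<le> (C * K) / ?s"
    proof -
      have "C * \<rho> ^ n * ?s \<le> C * \<rho> ^ n * real (n + 2)"
        using C \<rho> s1 by (intro mult_left_mono) auto
      also have "\<dots> \<le> C * K"
        using K(2)[of n] C by (simp add: mult.assoc)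
      finally show ?thesis
        using s0 by (simp only: pos_le_divide_eq)
    qed
    moreover have "G j / ?s \<le> (G 0 + G 1) / ?s"
    proof (rule divide_right_mono)
      have "j = 0 \<or> j = 1" using j by auto
      then show "G j \<le> G 0 + G 1" using G0[of 0] G0[of 1] by auto
    qed (use s0 in simp)
    ultimately have "(\<integral>\<xi>. \<bar>\<xi>\<bar> ^ j * \<bar>symbol \<xi>\<bar> ^ Suc (Suc n) \<partial>lborel) \<le> (G 0 + G 1) / ?s + (C * K) / ?s"
      using le[OF j, of n] by linarith
    then show ?thesis
      by (simp only: add_divide_distrib)
  qed
  moreover have "0 < G 0 + G 1 + C * K"
    using G0[of 0] G0[of 1] C K(1) by (simp add: add_nonneg_pos)
  ultimately show ?thesis
    using le by (intro exI[of _ "G 0 + G 1 + C * K"]) blast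
qed

lemma kernel_power_bound: "\<exists>C>0. \<forall>n x. \<bar>kernel_power n x\<bar> \<le> C / sqrt (real (n + 1))"
proof -
  obtain B where B: "B > 0" "\<And>z. J z \<le> B" using J_bounded by blast
  obtain C where C: "C > 0" and mom: "\<And>n j. j \<le> 1 \<Longrightarrow>
     integrable lborel (\<lambda>\<xi>. \<bar>\<xi>\<bar> ^ j * \<bar>symbol \<xi>\<bar> ^ Suc (Suc n)) \<and>
     (\<integral>\<xi>. \<bar>\<xi>\<bar> ^ j * \<bar>symbol \<xi>\<bar> ^ Suc (Suc n) \<partial>lborel) \<le> C / sqrt (real (n + 2)) ^ Suc j"
    using symbol_power_moment_decay by blast
  have "\<bar>kernel_power n x\<bar> \<le> (B + C) / sqrt (real (n + 1))" for n x
  proof (cases n)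
    case 0
    then show ?thesis using B(2)[of x] J_nonneg[of x] C by simp
  next
    case (Suc m)
    have i: "integrable lborel (\<lambda>\<xi>. symbol \<xi> ^ Suc n * cos (x * \<xi>))"
      by (rule Bochner_Integration.integrable_bound[OF symbol_power_integrable[of n]])
         (auto simp: abs_mult mult_left_le simp del: power_Suc)
    have "2 * pi * \<bar>kernel_power n x\<bar> = \<bar>\<integral>\<xi>. symbol \<xi> ^ Suc n * cos (x * \<xi>) \<partial>lborel\<bar>"
      unfolding kernel_power_fourier[symmetric] by (simp add: abs_mult)
    also have "\<dots> \<le> (\<integral>\<xi>. \<bar>symbol \<xi> ^ Suc n * cos (x * \<xi>)\<bar> \<partial>lborel)"
      by (rule integral_abs_bound)
    also have "\<dots> \<le> (\<integral>\<xi>. \<bar>\<xi>\<bar> ^ 0 * \<bar>symbol \<xi>\<bar> ^ Suc (Suc m) \<partial>lborel)"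
      using mom[of 0 m] by (intro integral_mono integrable_abs i)
        (auto simp: abs_mult power_abs mult_left_le Suc simp del: power_Suc)
    also have "\<dots> \<le> C / sqrt (real (m + 2)) ^ Suc 0"
      using mom[of 0 m] by blast
    finally have "2 * pi * \<bar>kernel_power n x\<bar> \<le> C / sqrt (real (n + 1))"
      using Suc by (simp add: add.commute)
    moreover have "1 * \<bar>kernel_power n x\<bar> \<le> 2 * pi * \<bar>kernel_power n x\<bar>"
      using pi_ge_two by (intro mult_right_mono) auto
    moreover have "C / sqrt (real (n + 1)) \<le> (B + C) / sqrt (real (n + 1))"
      using B by (intro divide_right_mono) auto
    ultimately show ?thesis by linarith
  qed
  then show ?thesis using B C by (intro exI[of _ "B + C"]) auto
qed

text \<open>The factor \<open>\<bar>sin (y \<xi>)\<bar>\<close>, which oddness produces, is traded for \<open>y \<bar>\<xi>\<bar>\<close>. For a single jump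
  the rate in \<open>symbol_decay\<close> does not give integrability against \<open>\<bar>\<xi>\<bar>\<close>, and the Lipschitz bound for
  \<open>J\<close> takes over.\<close>

lemma odd_kernel_bound: "\<exists>C>0. \<forall>n x. \<forall>y\<ge>0. \<bar>odd_kernel n x y\<bar> \<le> C * y / real (n + 1)"
proof -
  obtain L where L: "L > 0" "\<And>x y. \<bar>J x - J y\<bar> \<le> L * \<bar>x - y\<bar>" using J_lipschitz by blast
  obtain C where C: "C > 0" and mom: "\<And>n j. j \<le> 1 \<Longrightarrow>
     integrable lborel (\<lambda>\<xi>. \<bar>\<xi>\<bar> ^ j * \<bar>symbol \<xi>\<bar> ^ Suc (Suc n)) \<and>
     (\<integral>\<xi>. \<bar>\<xi>\<bar> ^ j * \<bar>symbol \<xi>\<bar> ^ Suc (Suc n) \<partial>lborel) \<le> C / sqrt (real (n + 2)) ^ Suc j"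
    using symbol_power_moment_decay by blast
  have "\<bar>odd_kernel n x y\<bar> \<le> (2 * L + C) * y / real (n + 1)" if y: "0 \<le> y" for n x y
  proof (cases n)
    case 0
    have "\<bar>odd_kernel n x y\<bar> \<le> L * \<bar>(x - y) - (x + y)\<bar>"
      unfolding 0 odd_kernel_def by (simp only: kernel_power.simps L(2))
    also have "\<dots> = 2 * L * y" using y by simp
    also have "\<dots> \<le> (2 * L + C) * y" using C y by (intro mult_right_mono) auto
    finally show ?thesis using 0 by simp
  next
    case (Suc m)
    have "pi * \<bar>odd_kernel n x y\<bar> = \<bar>\<integral>\<xi>. symbol \<xi> ^ Suc n * (sin (x * \<xi>) * sin (y * \<xi>)) \<partial>lborel\<bar>"
      unfolding odd_kernel_fourier(2)[symmetric] by (simp add: abs_mult)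
    also have "\<dots> \<le> (\<integral>\<xi>. \<bar>symbol \<xi> ^ Suc n * (sin (x * \<xi>) * sin (y * \<xi>))\<bar> \<partial>lborel)"
      by (rule integral_abs_bound)
    also have "\<dots> \<le> (\<integral>\<xi>. y * (\<bar>\<xi>\<bar> ^ 1 * \<bar>symbol \<xi>\<bar> ^ Suc (Suc m)) \<partial>lborel)"
    proof (intro integral_mono integrable_abs odd_kernel_fourier integrable_mult_right)
      show "integrable lborel (\<lambda>\<xi>. \<bar>\<xi>\<bar> ^ 1 * \<bar>symbol \<xi>\<bar> ^ Suc (Suc m))"
        using mom[of 1 m] by blast
      fix \<xi>
      have "\<bar>sin (x * \<xi>)\<bar> * \<bar>sin (y * \<xi>)\<bar> \<le> 1 * (y * \<bar>\<xi>\<bar>)"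
        using abs_sin_x_le_abs_x[of "y * \<xi>"] y by (intro mult_mono) (auto simp: abs_mult)
      then have "\<bar>symbol \<xi>\<bar> ^ Suc n * (\<bar>sin (x * \<xi>)\<bar> * \<bar>sin (y * \<xi>)\<bar>) \<le> \<bar>symbol \<xi>\<bar> ^ Suc n * (y * \<bar>\<xi>\<bar>)"
        by (intro mult_left_mono) auto
      then show "\<bar>symbol \<xi> ^ Suc n * (sin (x * \<xi>) * sin (y * \<xi>))\<bar> \<le> y * (\<bar>\<xi>\<bar> ^ 1 * \<bar>symbol \<xi>\<bar> ^ Suc (Suc m))"
        unfolding Suc by (simp add: abs_mult power_abs mult_ac)
    qed
    also have "\<dots> \<le> y * (C / sqrt (real (m + 2)) ^ Suc 1)"
      unfolding integral_mult_right_zero using mom[of 1 m] y by (intro mult_left_mono) auto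
    also have "\<dots> = C * y / real (n + 1)"
      using Suc by (simp add: add.commute)
    finally have "pi * \<bar>odd_kernel n x y\<bar> \<le> C * y / real (n + 1)" .
    moreover have "1 * \<bar>odd_kernel n x y\<bar> \<le> pi * \<bar>odd_kernel n x y\<bar>"
      using pi_ge_two by (intro mult_right_mono) auto
    moreover have "C * y / real (n + 1) \<le> (2 * L + C) * y / real (n + 1)"
      using L y by (intro divide_right_mono mult_right_mono) auto
    ultimately show ?thesis by linarith
  qed
  then show ?thesis using L C by (intro exI[of _ "2 * L + C"]) (auto intro: add_pos_pos)
qed

end

section \<open>The local limit of the antisymmetrised kernel\<close>

context dispersal_kernel
begin

text \<open>The weight \<open>\<bar>\<xi>\<bar>\<close> corresponds to one space derivative, and the error must be of smaller order
  than \<open>1 / n\<close>, the size of the dipole. Near the origin the difference of the powers is at most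
  a multiple of \<open>n \<xi>\<^sup>4\<close> times a Gaussian of width \<open>1 / sqrt n\<close>, so its weighted integral is of order
  \<open>1 / n\<^sup>2\<close>; elsewhere both powers are exponentially small.\<close>

lemma symbol_power_gaussian_L1:
  "\<exists>E. (\<lambda>n. real (n + 1) * E n) \<longlonglongrightarrow> 0 \<and> (\<forall>n\<ge>1.
     integrable lborel (\<lambda>\<xi>. \<bar>\<xi>\<bar> * \<bar>symbol \<xi> ^ Suc n - exp (- (diffusivity * real (n + 1) * \<xi>\<^sup>2))\<bar>) \<and>
     (\<integral>\<xi>. \<bar>\<xi>\<bar> * \<bar>symbol \<xi> ^ Suc n - exp (- (diffusivity * real (n + 1) * \<xi>\<^sup>2))\<bar> \<partial>lborel) \<le> E n)"
proof -
  let ?q = diffusivity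
  have q: "0 < ?q" by (rule diffusivity_pos)
  obtain r where r: "r > 0" "\<And>\<xi>. \<bar>\<xi>\<bar> < r \<Longrightarrow> 0 \<le> symbol \<xi>"
      "\<And>\<xi>. \<bar>\<xi>\<bar> < r \<Longrightarrow> symbol \<xi> \<le> exp (- (?q * \<xi>\<^sup>2 / 2))"
    using symbol_near_zero by blast
  obtain \<rho> where \<rho>: "0 < \<rho>" "\<rho> < 1" "\<And>\<xi>. r \<le> \<bar>\<xi>\<bar> \<Longrightarrow> \<bar>symbol \<xi>\<bar> \<le> \<rho>"
    using symbol_away_from_zero[OF r(1)] by blast
  obtain A where A: "A > 0" "\<And>\<xi>. \<bar>symbol \<xi>\<bar> \<le> A / (1 + \<xi>\<^sup>2)"
    using symbol_decay by blast
  obtain B where B: "B > 0" "\<And>\<xi>. \<bar>symbol \<xi> - exp (- (?q * \<xi>\<^sup>2))\<bar> \<le> B * \<xi> ^ 4"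
    using symbol_vs_gaussian by blast
  define I :: real where "I = (\<integral>\<xi>. 1 / (1 + \<xi>\<^sup>2) \<partial>lborel)"
  define \<sigma> where "\<sigma> = exp (- (?q * r\<^sup>2))"
  have \<sigma>: "0 < \<sigma>" "\<sigma> < 1" using q r(1) by (auto simp: \<sigma>_def)
  define E where "E n = real (n + 1) * B * (gauss_moment 5 / sqrt (?q * real (n + 1) / 4) ^ Suc 5)
      + A\<^sup>2 * \<rho> ^ (n - 1) * I + \<sigma> ^ n * (gauss_moment 1 / sqrt ?q ^ Suc 1)" for n
  have "(\<lambda>n. real (n + 1) * E n) \<longlonglongrightarrow> 0"
  proof -
    have eq: "real (n + 1) * E n = B * gauss_moment 5 / (?q / 4) ^ 3 / real (n + 1)
       + A\<^sup>2 * I * (\<rho> ^ (n - 1) * real (n + 1)) + gauss_moment 1 / ?q * (\<sigma> ^ n * real (n + 1))" for n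
    proof -
      have p: "sqrt x ^ Suc 5 = x ^ 3" if "0 \<le> x" for x :: real
      proof -
        have "sqrt x ^ Suc 5 = (sqrt x ^ 2) ^ 3" by (simp flip: power_mult)
        then show ?thesis using that by simp
      qed
      have "?q * real (n + 1) / 4 = ?q / 4 * real (n + 1)" by simp
      then have "sqrt (?q * real (n + 1) / 4) ^ Suc 5 = (?q / 4) ^ 3 * real (n + 1) ^ 3"
        using q by (subst p) (simp_all only: power_mult_distrib, simp_all)
      moreover have "sqrt ?q ^ Suc 1 = ?q" using q by simp
      moreover have "real (n + 1) * (real (n + 1) * B * (gauss_moment 5 / ((?q / 4) ^ 3 * real (n + 1) ^ 3)))
          = B * gauss_moment 5 / (?q / 4) ^ 3 / real (n + 1)"
        using q by (simp add: field_simps power3_eq_cube del: of_nat_add of_nat_Suc)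
      ultimately show ?thesis
        unfolding E_def by (simp only: distrib_left) (simp add: mult_ac del: of_nat_add)
    qed
    have "(\<lambda>n. \<rho> ^ (n - 1) * real (n + 1)) \<longlonglongrightarrow> 0"
    proof (rule LIMSEQ_imp_Suc)
      show "(\<lambda>n. \<rho> ^ (Suc n - 1) * real (Suc n + 1)) \<longlonglongrightarrow> 0"
        using \<rho>(1,2) by simp real_asymp
    qed
    moreover have "(\<lambda>n. \<sigma> ^ n * real (n + 1)) \<longlonglongrightarrow> 0"
      using \<sigma> by real_asymp
    moreover have "(\<lambda>n. B * gauss_moment 5 / (?q / 4) ^ 3 / real (n + 1)) \<longlonglongrightarrow> 0"
    proof -
      have "(\<lambda>n. 1 / real (n + 1)) \<longlonglongrightarrow> 0" by real_asymp
      from tendsto_mult_right_zero[OF this, of "B * gauss_moment 5 / (?q / 4) ^ 3"] show ?thesis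
        by simp
    qed
    ultimately have "(\<lambda>n. B * gauss_moment 5 / (?q / 4) ^ 3 / real (n + 1)
       + A\<^sup>2 * I * (\<rho> ^ (n - 1) * real (n + 1)) + gauss_moment 1 / ?q * (\<sigma> ^ n * real (n + 1)))
       \<longlonglongrightarrow> 0 + A\<^sup>2 * I * 0 + gauss_moment 1 / ?q * 0"
      by (intro tendsto_intros)
    then show ?thesis unfolding eq by simp
  qed
  moreover have "integrable lborel (\<lambda>\<xi>. \<bar>\<xi>\<bar> * \<bar>symbol \<xi> ^ Suc n - exp (- (?q * real (n + 1) * \<xi>\<^sup>2))\<bar>) \<and>
     (\<integral>\<xi>. \<bar>\<xi>\<bar> * \<bar>symbol \<xi> ^ Suc n - exp (- (?q * real (n + 1) * \<xi>\<^sup>2))\<bar> \<partial>lborel) \<le> E n" if n: "1 \<le> n" for n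
  proof -
    let ?N = "real (n + 1)"
    let ?f = "\<lambda>\<xi>. \<bar>\<xi>\<bar> * \<bar>symbol \<xi> ^ Suc n - exp (- (?q * ?N * \<xi>\<^sup>2))\<bar>"
    let ?M1 = "\<lambda>\<xi>. ?N * B * (\<bar>\<xi>\<bar> ^ 5 * exp (- (?q * ?N / 4 * \<xi>\<^sup>2)))"
    let ?M2 = "\<lambda>\<xi>::real. A\<^sup>2 * \<rho> ^ (n - 1) * (1 / (1 + \<xi>\<^sup>2))"
    let ?M3 = "\<lambda>\<xi>. \<sigma> ^ n * (\<bar>\<xi>\<bar> ^ 1 * exp (- (?q * \<xi>\<^sup>2)))"
    have qN: "0 < ?q * ?N / 4" using q by simp
    have nonneg: "0 \<le> ?M1 \<xi>" "0 \<le> ?M2 \<xi>" "0 \<le> ?M3 \<xi>" for \<xi>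
      using B(1) \<rho>(1) \<sigma>(1) by auto
    have g: "exp (- (?q * ?N * \<xi>\<^sup>2)) = exp (- (?q * \<xi>\<^sup>2)) ^ Suc n" for \<xi>
      by (subst exp_of_nat_mult[symmetric]) (simp add: algebra_simps)
    have M: "?f \<xi> \<le> ?M1 \<xi> + ?M2 \<xi> + ?M3 \<xi>" for \<xi>
    proof (cases "\<bar>\<xi>\<bar> < r")
      case True
      have "\<bar>symbol \<xi> ^ Suc n - exp (- (?q * \<xi>\<^sup>2)) ^ Suc n\<bar> \<le>
         real (Suc n) * \<bar>symbol \<xi> - exp (- (?q * \<xi>\<^sup>2))\<bar> * exp (- (?q * \<xi>\<^sup>2 / 2)) ^ n"
        using r(2,3)[OF True] q by (intro power_diff_le) auto
      also have "\<dots> \<le> real (Suc n) * (B * \<xi> ^ 4) * exp (- (?q * ?N / 4 * \<xi>\<^sup>2))"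
      proof (intro mult_mono B(2) order_refl)
        have "exp (- (?q * \<xi>\<^sup>2 / 2)) ^ n = exp (- (?q * \<xi>\<^sup>2 * (real n / 2)))"
          by (subst exp_of_nat_mult[symmetric]) (simp add: algebra_simps)
        also have "\<dots> \<le> exp (- (?q * \<xi>\<^sup>2 * (?N / 4)))"
        proof -
          have "?q * \<xi>\<^sup>2 * (?N / 4) \<le> ?q * \<xi>\<^sup>2 * (real n / 2)"
            using n q by (intro mult_left_mono) auto
          then show ?thesis by (simp only: exp_le_cancel_iff neg_le_iff_le)
        qed
        finally show "exp (- (?q * \<xi>\<^sup>2 / 2)) ^ n \<le> exp (- (?q * ?N / 4 * \<xi>\<^sup>2))"
          by (simp add: mult_ac)
      qed (use B(1) in auto)
      finally have "?f \<xi> \<le> \<bar>\<xi>\<bar> * (?N * (B * \<xi> ^ 4) * exp (- (?q * ?N / 4 * \<xi>\<^sup>2)))"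
        unfolding g by (intro mult_left_mono) auto
      also have "\<dots> = ?M1 \<xi>"
      proof -
        have "\<bar>\<xi>\<bar> ^ 5 = \<bar>\<xi>\<bar> * \<xi> ^ 4" by (simp add: eval_nat_numeral)
        then show ?thesis by (simp only: mult_ac)
      qed
      finally show ?thesis using nonneg[of \<xi>] by linarith
    next
      case False
      have "Suc n = (n - 1) + 2" using n by simp
      then have "\<bar>symbol \<xi>\<bar> ^ Suc n = \<bar>symbol \<xi>\<bar> ^ (n - 1) * \<bar>symbol \<xi>\<bar>\<^sup>2"
        by (simp only: power_add)
      also have "\<dots> \<le> \<rho> ^ (n - 1) * (A / (1 + \<xi>\<^sup>2))\<^sup>2"
        using False \<rho> A by (intro mult_mono power_mono) auto
      finally have 1: "\<bar>symbol \<xi> ^ Suc n\<bar> \<le> \<rho> ^ (n - 1) * (A / (1 + \<xi>\<^sup>2))\<^sup>2"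
        by (simp only: power_abs)
      have 2: "exp (- (?q * ?N * \<xi>\<^sup>2)) \<le> \<sigma> ^ n * exp (- (?q * \<xi>\<^sup>2))"
      proof -
        have "r\<^sup>2 \<le> \<xi>\<^sup>2" using False r(1) by (simp add: abs_le_square_iff[symmetric])
        then have "exp (- (?q * \<xi>\<^sup>2)) \<le> \<sigma>" using q by (simp add: \<sigma>_def)
        then have "exp (- (?q * \<xi>\<^sup>2)) ^ n * exp (- (?q * \<xi>\<^sup>2)) \<le> \<sigma> ^ n * exp (- (?q * \<xi>\<^sup>2))"
          by (intro mult_right_mono power_mono) auto
        then show ?thesis unfolding g by (simp add: mult.commute)
      qed
      have 3: "\<bar>\<xi>\<bar> * (A / (1 + \<xi>\<^sup>2))\<^sup>2 \<le> A\<^sup>2 * (1 / (1 + \<xi>\<^sup>2))"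
      proof -
        have "0 \<le> (\<bar>\<xi>\<bar> - 1)\<^sup>2" by simp
        then have "2 * \<bar>\<xi>\<bar> \<le> 1 + \<xi>\<^sup>2" by (simp add: power2_diff)
        then have "\<bar>\<xi>\<bar> * (A / (1 + \<xi>\<^sup>2))\<^sup>2 \<le> (1 + \<xi>\<^sup>2) * (A / (1 + \<xi>\<^sup>2))\<^sup>2"
          by (intro mult_right_mono) auto
        also have "\<dots> = A\<^sup>2 * (1 / (1 + \<xi>\<^sup>2))"
          using add_pos_nonneg[of 1 "\<xi>\<^sup>2"] by (simp add: power2_eq_square)
        finally show ?thesis .
      qed
      have "?f \<xi> \<le> \<bar>\<xi>\<bar> * (\<rho> ^ (n - 1) * (A / (1 + \<xi>\<^sup>2))\<^sup>2 + \<sigma> ^ n * exp (- (?q * \<xi>\<^sup>2)))"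
      proof (rule mult_left_mono)
        have "\<bar>symbol \<xi> ^ Suc n - exp (- (?q * ?N * \<xi>\<^sup>2))\<bar> \<le> \<bar>symbol \<xi> ^ Suc n\<bar> + \<bar>exp (- (?q * ?N * \<xi>\<^sup>2))\<bar>"
          by (rule abs_triangle_ineq4)
        then show "\<bar>symbol \<xi> ^ Suc n - exp (- (?q * ?N * \<xi>\<^sup>2))\<bar> \<le> \<rho> ^ (n - 1) * (A / (1 + \<xi>\<^sup>2))\<^sup>2 + \<sigma> ^ n * exp (- (?q * \<xi>\<^sup>2))"
          using 1 2 by (simp only: abs_exp_cancel)
      qed simp
      also have "\<dots> = \<rho> ^ (n - 1) * (\<bar>\<xi>\<bar> * (A / (1 + \<xi>\<^sup>2))\<^sup>2) + ?M3 \<xi>"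
        by (simp only: distrib_left mult_ac power_one_right)
      also have "\<dots> \<le> \<rho> ^ (n - 1) * (A\<^sup>2 * (1 / (1 + \<xi>\<^sup>2))) + ?M3 \<xi>"
        using 3 \<rho>(1) by (intro add_right_mono mult_left_mono) auto
      also have "\<dots> = ?M2 \<xi> + ?M3 \<xi>"
        by (simp only: mult_ac)
      finally show ?thesis using nonneg[of \<xi>] by linarith
    qed
    have i1: "integrable lborel ?M1" by (intro integrable_mult_right gauss_moment_integrable qN)
    have i2: "integrable lborel ?M2" by (intro integrable_mult_right integrable_inverse_square)
    have i3: "integrable lborel ?M3" by (intro integrable_mult_right gauss_moment_integrable q)
    have iM: "integrable lborel (\<lambda>\<xi>. ?M1 \<xi> + ?M2 \<xi> + ?M3 \<xi>)"
      by (intro Bochner_Integration.integrable_add i1 i2 i3)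
    have i: "integrable lborel ?f"
    proof (rule Bochner_Integration.integrable_bound[OF iM])
      show "AE \<xi> in lborel. norm (?f \<xi>) \<le> norm (?M1 \<xi> + ?M2 \<xi> + ?M3 \<xi>)"
      proof (intro AE_I2)
        fix \<xi> show "norm (?f \<xi>) \<le> norm (?M1 \<xi> + ?M2 \<xi> + ?M3 \<xi>)"
          using M[of \<xi>] abs_ge_self[of "?M1 \<xi> + ?M2 \<xi> + ?M3 \<xi>"]
          by (simp only: real_norm_def abs_mult abs_abs)
      qed
    qed measurable
    have "(\<integral>\<xi>. ?f \<xi> \<partial>lborel) \<le> (\<integral>\<xi>. ?M1 \<xi> + ?M2 \<xi> + ?M3 \<xi> \<partial>lborel)"
      by (intro integral_mono i iM M)
    also have "\<dots> = E n"
      unfolding Bochner_Integration.integral_add[OF Bochner_Integration.integrable_add[OF i1 i2] i3]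
        Bochner_Integration.integral_add[OF i1 i2] integral_mult_right_zero
        gauss_moment_scaled[OF qN] gauss_moment_scaled[OF q] E_def I_def ..
    finally show ?thesis using i by blast
  qed
  ultimately show ?thesis by blast
qed

text \<open>In the Fourier representation the power of the symbol is replaced by the Gaussian, with an
  error linear in \<open>y\<close>, and \<open>sin (y \<xi>)\<close> by \<open>y \<xi>\<close>, with an error quadratic in \<open>y\<close> and of higher order
  in \<open>1 / sqrt n\<close>. The second error is why a second moment of the initial datum is assumed.\<close>

lemma odd_kernel_local_limit:
  "\<exists>\<epsilon> C. \<epsilon> \<longlonglongrightarrow> 0 \<and> 0 < C \<and> (\<forall>n. 0 \<le> \<epsilon> n) \<and> (\<forall>n\<ge>1. \<forall>x. \<forall>y\<ge>0.
     \<bar>odd_kernel n x y + 2 * y * dipole x (diffusivity * real (n + 1))\<bar> \<le>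
       y * \<epsilon> n / real (n + 1) + C * y\<^sup>2 / sqrt (real (n + 1)) ^ 3)"
proof -
  let ?q = diffusivity
  have q: "0 < ?q" by (rule diffusivity_pos)
  obtain E where E0: "(\<lambda>n. real (n + 1) * E n) \<longlonglongrightarrow> 0" and E: "\<And>n. n \<ge> 1 \<Longrightarrow>
     integrable lborel (\<lambda>\<xi>. \<bar>\<xi>\<bar> * \<bar>symbol \<xi> ^ Suc n - exp (- (?q * real (n + 1) * \<xi>\<^sup>2))\<bar>) \<and>
     (\<integral>\<xi>. \<bar>\<xi>\<bar> * \<bar>symbol \<xi> ^ Suc n - exp (- (?q * real (n + 1) * \<xi>\<^sup>2))\<bar> \<partial>lborel) \<le> E n"
    using symbol_power_gaussian_L1 by blast
  define \<epsilon> where "\<epsilon> n = \<bar>real (n + 1) * E n\<bar>" for n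
  define C where "C = gauss_moment 2 / sqrt ?q ^ 3 + 1"
  have C: "0 < C" using gauss_moment_nonneg[of 2] q by (simp add: C_def add_nonneg_pos)
  have "\<epsilon> \<longlonglongrightarrow> 0" unfolding \<epsilon>_def using tendsto_rabs[OF E0] by simp
  moreover have "\<bar>odd_kernel n x y + 2 * y * dipole x (?q * real (n + 1))\<bar> \<le>
       y * \<epsilon> n / real (n + 1) + C * y\<^sup>2 / sqrt (real (n + 1)) ^ 3" if n: "1 \<le> n" and y: "0 \<le> y" for n x y
  proof -
    let ?s = "?q * real (n + 1)"
    let ?g = "\<lambda>\<xi>. exp (- (?s * \<xi>\<^sup>2))"
    let ?S = "\<lambda>\<xi>. symbol \<xi> ^ Suc n * (sin (x * \<xi>) * sin (y * \<xi>))"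
    let ?D = "\<lambda>\<xi>. y * (\<xi> * ?g \<xi> * sin (x * \<xi>))"
    let ?e = "\<lambda>\<xi>. \<bar>\<xi>\<bar> * \<bar>symbol \<xi> ^ Suc n - ?g \<xi>\<bar>"
    have s: "0 < ?s" using q by simp
    have iD: "integrable lborel ?D"
    proof (rule integrable_mult_right)
      show "integrable lborel (\<lambda>\<xi>. \<xi> * ?g \<xi> * sin (x * \<xi>))"
        using gauss_moment_integrable[OF s, of 1]
        by (rule Bochner_Integration.integrable_bound) (auto simp: abs_mult mult_left_le)
    qed
    have iS: "integrable lborel ?S" by (rule odd_kernel_fourier)
    have i1: "integrable lborel (\<lambda>\<xi>. y * ?e \<xi>)"
      using E[OF n] by (intro integrable_mult_right) blast
    have i2: "integrable lborel (\<lambda>\<xi>. y\<^sup>2 * (\<bar>\<xi>\<bar> ^ 2 * ?g \<xi>))"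
      by (intro integrable_mult_right gauss_moment_integrable s)
    have "pi * (odd_kernel n x y + 2 * y * dipole x ?s) = pi * odd_kernel n x y + y * (2 * pi * dipole x ?s)"
      by (simp only: distrib_left mult_ac)
    also have "\<dots> = (\<integral>\<xi>. ?S \<xi> \<partial>lborel) - (\<integral>\<xi>. ?D \<xi> \<partial>lborel)"
      unfolding odd_kernel_fourier(2) dipole_fourier[OF s] integral_mult_right_zero by simp
    also have "\<dots> = (\<integral>\<xi>. ?S \<xi> - ?D \<xi> \<partial>lborel)"
      by (rule Bochner_Integration.integral_diff[OF iS iD, symmetric])
    finally have "pi * \<bar>odd_kernel n x y + 2 * y * dipole x ?s\<bar> = \<bar>\<integral>\<xi>. ?S \<xi> - ?D \<xi> \<partial>lborel\<bar>"
      by (metis abs_mult abs_of_pos pi_gt_zero)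
    also have "\<dots> \<le> (\<integral>\<xi>. \<bar>?S \<xi> - ?D \<xi>\<bar> \<partial>lborel)"
      by (rule integral_abs_bound)
    also have "\<dots> \<le> (\<integral>\<xi>. y * ?e \<xi> + y\<^sup>2 * (\<bar>\<xi>\<bar> ^ 2 * ?g \<xi>) \<partial>lborel)"
    proof (intro integral_mono integrable_abs Bochner_Integration.integrable_diff iS iD
        Bochner_Integration.integrable_add i1 i2)
      fix \<xi>
      have "?S \<xi> - ?D \<xi> = (symbol \<xi> ^ Suc n - ?g \<xi>) * (sin (x * \<xi>) * sin (y * \<xi>))
          + ?g \<xi> * (sin (x * \<xi>) * (sin (y * \<xi>) - y * \<xi>))"
        by (simp add: algebra_simps del: power_Suc)
      also have "\<bar>\<dots>\<bar> \<le> \<bar>symbol \<xi> ^ Suc n - ?g \<xi>\<bar> * (\<bar>sin (x * \<xi>)\<bar> * \<bar>sin (y * \<xi>)\<bar>)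
          + ?g \<xi> * (\<bar>sin (x * \<xi>)\<bar> * \<bar>sin (y * \<xi>) - y * \<xi>\<bar>)"
        by (rule order_trans[OF abs_triangle_ineq]) (simp only: abs_mult abs_exp_cancel order_refl)
      also have "\<dots> \<le> \<bar>symbol \<xi> ^ Suc n - ?g \<xi>\<bar> * (1 * (y * \<bar>\<xi>\<bar>)) + ?g \<xi> * (1 * (y * \<xi>)\<^sup>2)"
        using abs_sin_x_le_abs_x[of "y * \<xi>"] sin_quadratic_bound[of "y * \<xi>"] y
        by (intro add_mono mult_left_mono mult_mono) (auto simp: abs_mult)
      also have "\<dots> = y * ?e \<xi> + y\<^sup>2 * (\<bar>\<xi>\<bar> ^ 2 * ?g \<xi>)"
        by (simp only: power_mult_distrib power2_abs mult_1_left mult_ac)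
      finally show "\<bar>?S \<xi> - ?D \<xi>\<bar> \<le> y * ?e \<xi> + y\<^sup>2 * (\<bar>\<xi>\<bar> ^ 2 * ?g \<xi>)" .
    qed
    also have "\<dots> = y * (\<integral>\<xi>. ?e \<xi> \<partial>lborel) + y\<^sup>2 * (gauss_moment 2 / sqrt ?s ^ Suc 2)"
      unfolding Bochner_Integration.integral_add[OF i1 i2] integral_mult_right_zero gauss_moment_scaled[OF s] ..
    also have "\<dots> \<le> y * (\<epsilon> n / real (n + 1)) + C * y\<^sup>2 / sqrt (real (n + 1)) ^ 3"
    proof (rule add_mono)
      have "(\<integral>\<xi>. ?e \<xi> \<partial>lborel) \<le> \<epsilon> n / real (n + 1)"
      proof -
        have "\<epsilon> n / real (n + 1) = \<bar>E n\<bar>" by (simp add: \<epsilon>_def abs_mult)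
        then show ?thesis using E[OF n] abs_ge_self[of "E n"] by linarith
      qed
      then show "y * (\<integral>\<xi>. ?e \<xi> \<partial>lborel) \<le> y * (\<epsilon> n / real (n + 1))"
        using y by (intro mult_left_mono)
      have "sqrt ?s ^ Suc 2 = sqrt ?q ^ 3 * sqrt (real (n + 1)) ^ 3"
        by (simp only: real_sqrt_mult power_mult_distrib eval_nat_numeral)
      then have "gauss_moment 2 / sqrt ?s ^ Suc 2 = gauss_moment 2 / sqrt ?q ^ 3 / sqrt (real (n + 1)) ^ 3"
        by (simp only: divide_divide_eq_left)
      also have "\<dots> \<le> C / sqrt (real (n + 1)) ^ 3"
        by (intro divide_right_mono) (auto simp: C_def)
      finally have "y\<^sup>2 * (gauss_moment 2 / sqrt ?s ^ Suc 2) \<le> y\<^sup>2 * (C / sqrt (real (n + 1)) ^ 3)"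
        by (intro mult_left_mono) auto
      then show "y\<^sup>2 * (gauss_moment 2 / sqrt ?s ^ Suc 2) \<le> C * y\<^sup>2 / sqrt (real (n + 1)) ^ 3"
        by (simp add: mult.commute)
    qed
    finally have 1: "pi * \<bar>odd_kernel n x y + 2 * y * dipole x ?s\<bar> \<le>
      y * \<epsilon> n / real (n + 1) + C * y\<^sup>2 / sqrt (real (n + 1)) ^ 3" by simp
    have "1 * \<bar>odd_kernel n x y + 2 * y * dipole x ?s\<bar> \<le> pi * \<bar>odd_kernel n x y + 2 * y * dipole x ?s\<bar>"
      using pi_ge_two by (intro mult_right_mono) auto
    then show ?thesis
      unfolding mult_1_left by (rule order_trans[OF _ 1])
  qed
  ultimately show ?thesis
    using C by (intro exI[of _ \<epsilon>] exI[of _ C]) (auto simp: \<epsilon>_def)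
qed

end

section \<open>The walk killed on leaving the half-line\<close>

context dispersal_kernel
begin

definition jump :: "(real \<Rightarrow> real) \<Rightarrow> real \<Rightarrow> real" where
  "jump f x = (\<integral>y. J (x - y) * f y \<partial>lborel)"

lemma jump_measurable [measurable]:
  assumes [measurable]: "f \<in> borel_measurable borel"
  shows "jump f \<in> borel_measurable borel"
  unfolding jump_def by measurable

lemma jump_shift: "jump g x = (\<integral>z. J z * g (x - z) \<partial>lborel)"
  unfolding jump_def using lborel_integral_real_affine[of "-1" "\<lambda>y. J (x - y) * g y" x] by simp

lemma jump_local_integrable:
  assumes [measurable]: "g \<in> borel_measurable borel"
    and g: "\<And>z. \<bar>z\<bar> \<le> d \<Longrightarrow> \<bar>g (x - z)\<bar> \<le> C"
  shows "integrable lborel (\<lambda>z. J z * g (x - z))" and "integrable lborel (\<lambda>y. J (x - y) * g y)"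
proof -
  show i: "integrable lborel (\<lambda>z. J z * g (x - z))"
    using g by (intro J_mult_integrable) auto
  show "integrable lborel (\<lambda>y. J (x - y) * g y)"
    using lborel_integrable_real_affine[OF i, of "-1" x] by simp
qed

lemma jump_le:
  assumes [measurable]: "g \<in> borel_measurable borel"
    and g: "\<And>z. \<bar>z\<bar> \<le> d \<Longrightarrow> \<bar>g (x - z)\<bar> \<le> C"
  shows "\<bar>jump g x\<bar> \<le> C"
proof -
  have "\<bar>jump g x\<bar> \<le> (\<integral>z. \<bar>J z * g (x - z)\<bar> \<partial>lborel)"
    unfolding jump_shift by (rule integral_abs_bound)
  also have "\<dots> \<le> (\<integral>z. J z * C \<partial>lborel)"
  proof (rule integral_mono)
    show "integrable lborel (\<lambda>z. \<bar>J z * g (x - z)\<bar>)"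
      by (intro integrable_abs jump_local_integrable(1)[OF assms])
    show "integrable lborel (\<lambda>z. J z * C)"
      by (intro integrable_mult_left J_integrable)
    fix z show "\<bar>J z * g (x - z)\<bar> \<le> J z * C"
      using g[of z] J_supp[of z] J_nonneg[of z] by (cases "\<bar>z\<bar> \<le> d") (auto simp: abs_mult intro!: mult_left_mono)
  qed
  also have "\<dots> = C" by (simp add: J_integral)
  finally show ?thesis .
qed

text \<open>Convolution with an even kernel is symmetric. This one instance of Fubini's theorem, with
  one factor of finite first moment and the other of linear growth, yields the conservation
  laws and the duality used below by the choice of the second factor.\<close>

lemma jump_pairing:
  assumes [measurable]: "f \<in> borel_measurable borel" "g \<in> borel_measurable borel"
    and f: "integrable lborel (\<lambda>y. (1 + \<bar>y\<bar>) * f y)"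
    and g: "\<And>x. \<bar>g x\<bar> \<le> C * (1 + \<bar>x\<bar>)"
  shows "integrable lborel (\<lambda>x. jump f x * g x)"
    and "integrable lborel (\<lambda>y. f y * jump g y)"
    and "(\<integral>x. jump f x * g x \<partial>lborel) = (\<integral>y. f y * jump g y \<partial>lborel)"
proof -
  have "0 \<le> C" using g[of 0] by simp
  have gb: "\<bar>g (y - z)\<bar> \<le> C * (1 + d) * (1 + \<bar>y\<bar>)" if "\<bar>z\<bar> \<le> d" for y z
  proof -
    have "\<bar>g (y - z)\<bar> \<le> C * (1 + \<bar>y - z\<bar>)" by (rule g)
    also have "\<dots> \<le> C * ((1 + d) * (1 + \<bar>y\<bar>))"
    proof (rule mult_left_mono[OF _ \<open>0 \<le> C\<close>])
      have "0 \<le> d * \<bar>y\<bar>" using d_pos by simp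
      moreover have "1 + \<bar>y - z\<bar> \<le> 1 + \<bar>y\<bar> + d"
        using that abs_triangle_ineq4[of y z] by linarith
      ultimately show "1 + \<bar>y - z\<bar> \<le> (1 + d) * (1 + \<bar>y\<bar>)"
        by (simp add: distrib_left distrib_right)
    qed
    finally show ?thesis by (simp add: mult.assoc)
  qed
  have inner: "integrable lborel (\<lambda>x. J (y - x) * g x)" for y
    by (rule jump_local_integrable(2)[OF assms(2) gb])
  let ?F = "\<lambda>y x. f y * (J (y - x) * g x)"
  have I: "integrable (lborel \<Otimes>\<^sub>M lborel) (case_prod ?F)"
  proof (rule lborel_pair.Fubini_integrable)
    show "case_prod ?F \<in> borel_measurable (lborel \<Otimes>\<^sub>M lborel)" by measurable
    have "\<bar>\<integral>x. \<bar>J (y - x) * g x\<bar> \<partial>lborel\<bar> \<le> C * (1 + d) * (1 + \<bar>y\<bar>)" for y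
    proof -
      have "(\<integral>x. \<bar>J (y - x) * g x\<bar> \<partial>lborel) = jump (\<lambda>x. \<bar>g x\<bar>) y"
        using J_nonneg by (simp add: jump_def abs_mult)
      then show ?thesis
        using jump_le[of "\<lambda>x. \<bar>g x\<bar>" y "C * (1 + d) * (1 + \<bar>y\<bar>)"] gb by simp
    qed
    then have le: "\<bar>f y\<bar> * \<bar>\<integral>x. \<bar>J (y - x) * g x\<bar> \<partial>lborel\<bar> \<le> \<bar>f y\<bar> * (C * (1 + d) * (1 + \<bar>y\<bar>))" for y
      by (intro mult_left_mono) auto
    have "integrable lborel (\<lambda>y. \<bar>f y\<bar> * (\<integral>x. \<bar>J (y - x) * g x\<bar> \<partial>lborel))"
    proof (rule Bochner_Integration.integrable_bound)
      show "integrable lborel (\<lambda>y. C * (1 + d) * ((1 + \<bar>y\<bar>) * f y))"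
        by (intro integrable_mult_right f)
      show "AE y in lborel. norm (\<bar>f y\<bar> * (\<integral>x. \<bar>J (y - x) * g x\<bar> \<partial>lborel)) \<le> norm (C * (1 + d) * ((1 + \<bar>y\<bar>) * f y))"
        using le \<open>0 \<le> C\<close> d_pos by (simp add: abs_mult mult_ac)
    qed measurable
    then show "integrable lborel (\<lambda>y. \<integral>x. norm (case (y, x) of (y, x) \<Rightarrow> ?F y x) \<partial>lborel)"
      by (simp add: abs_mult)
    show "AE y in lborel. integrable lborel (\<lambda>x. case (y, x) of (y, x) \<Rightarrow> ?F y x)"
      using inner by simp
  qed
  have 1: "(\<integral>x. ?F y x \<partial>lborel) = f y * jump g y" for y
    by (simp add: jump_def)
  have 2: "(\<integral>y. ?F y x \<partial>lborel) = jump f x * g x" for x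
    unfolding jump_def using J_commute[of x] by (simp flip: integral_mult_left_zero) (simp add: mult_ac)
  show "integrable lborel (\<lambda>x. jump f x * g x)"
    using lborel_pair.integrable_snd[OF I] by (simp only: 2)
  show "integrable lborel (\<lambda>y. f y * jump g y)"
    using lborel_pair.integrable_fst'[OF I] by (simp only: 1 split)
  show "(\<integral>x. jump f x * g x \<partial>lborel) = (\<integral>y. f y * jump g y \<partial>lborel)"
    using lborel_pair.Fubini_integral[OF I] by (simp only: 1 2)
qed

definition killed :: "(real \<Rightarrow> real) \<Rightarrow> real \<Rightarrow> real" where
  "killed f x = (if 0 \<le> x then jump f x else 0)"

text \<open>The conditions are imposed at every point, not almost everywhere, so that no exceptional sets
  accumulate when the walk is iterated.\<close>

definition walk_density :: "(real \<Rightarrow> real) \<Rightarrow> bool" where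
  "walk_density f \<longleftrightarrow> f \<in> borel_measurable borel \<and> (\<forall>x. 0 \<le> f x) \<and> (\<forall>x<0. f x = 0) \<and>
     (\<exists>C. \<forall>x. f x \<le> C) \<and> integrable lborel (\<lambda>x. (1 + \<bar>x\<bar>) * f x)"

definition mass :: "(real \<Rightarrow> real) \<Rightarrow> real" where
  "mass f = (\<integral>x. f x \<partial>lborel)"

definition shifted_moment :: "(real \<Rightarrow> real) \<Rightarrow> real" where
  "shifted_moment f = (\<integral>x. (x + d) * f x \<partial>lborel)"

lemma walk_densityD:
  assumes "walk_density f"
  shows "f \<in> borel_measurable borel" and "\<And>x. 0 \<le> f x" and "\<And>x. x < 0 \<Longrightarrow> f x = 0"
    and "\<exists>C>0. \<forall>x. f x \<le> C" and "integrable lborel (\<lambda>x. (1 + \<bar>x\<bar>) * f x)"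
proof -
  obtain C where "\<And>x. f x \<le> C" using assms by (auto simp: walk_density_def)
  then have "\<forall>x. f x \<le> \<bar>C\<bar> + 1" by (meson abs_ge_self add_increasing2 order_trans zero_le_one)
  moreover have "0 < \<bar>C\<bar> + 1" by simp
  ultimately show "\<exists>C>0. \<forall>x. f x \<le> C" by blast
qed (use assms in \<open>auto simp: walk_density_def\<close>)

lemma walk_density_integrable_mult:
  assumes f: "walk_density f" and [measurable]: "g \<in> borel_measurable borel"
    and g: "\<And>x. 0 \<le> x \<Longrightarrow> \<bar>g x\<bar> \<le> C * (1 + x)"
  shows "integrable lborel (\<lambda>x. f x * g x)"
proof (rule Bochner_Integration.integrable_bound)
  note D = walk_densityD[OF f]
  note [measurable] = D(1)
  show "integrable lborel (\<lambda>x. C * ((1 + \<bar>x\<bar>) * f x))"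
    by (intro integrable_mult_right D)
  have "\<bar>f x * g x\<bar> \<le> \<bar>C * ((1 + \<bar>x\<bar>) * f x)\<bar>" for x
  proof (cases "0 \<le> x")
    case True
    have "f x * \<bar>g x\<bar> \<le> f x * (C * (1 + x))"
      using g[OF True] D(2) by (intro mult_left_mono)
    also have "\<dots> = C * ((1 + \<bar>x\<bar>) * f x)" using True by simp
    finally have "\<bar>f x * g x\<bar> \<le> C * ((1 + \<bar>x\<bar>) * f x)" using D(2)[of x] by (simp add: abs_mult)
    then show ?thesis by (rule order_trans[OF _ abs_ge_self])
  qed (use D(3) in simp)
  then show "AE x in lborel. norm (f x * g x) \<le> norm (C * ((1 + \<bar>x\<bar>) * f x))" by simp
qed (use walk_densityD(1)[OF f] in measurable)

lemma walk_density_integrable: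
  assumes f: "walk_density f"
  shows "integrable lborel f" and "integrable lborel (\<lambda>x. x * f x)" and "integrable lborel (\<lambda>x. (x + d) * f x)"
proof -
  show "integrable lborel f"
    using walk_density_integrable_mult[OF f, of "\<lambda>_. 1" 1] by simp
  show "integrable lborel (\<lambda>x. x * f x)"
    using walk_density_integrable_mult[OF f, of "\<lambda>x. x" 1] by (simp add: mult.commute)
  have "\<bar>x + d\<bar> \<le> (1 + d) * (1 + x)" if "0 \<le> x" for x
  proof -
    have "0 \<le> d * x" using that d_pos by simp
    then show ?thesis using that d_pos by (simp add: algebra_simps)
  qed
  then show "integrable lborel (\<lambda>x. (x + d) * f x)"
    using walk_density_integrable_mult[OF f, of "\<lambda>x. x + d" "1 + d"] by (simp add: mult.commute)
qed

lemma jump_density_bounds: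
  assumes f: "walk_density f" and C: "\<And>x. f x \<le> C"
  shows "0 \<le> jump f x" and "jump f x \<le> C"
proof -
  show "0 \<le> jump f x"
    unfolding jump_def using J_nonneg walk_densityD(2)[OF f] by (intro integral_nonneg_AE) auto
  show "jump f x \<le> C"
    using jump_le[of f x C] walk_densityD(1,2)[OF f] C by (simp add: abs_le_iff)
qed

lemma killed_density:
  assumes f: "walk_density f"
  shows "walk_density (killed f)"
proof -
  note D = walk_densityD[OF f]
  note [measurable] = D(1)
  obtain C where C: "\<And>x. f x \<le> C" using D(4) by blast
  have "0 \<le> C" using D(2)[of 0] C[of 0] by linarith
  let ?g = "\<lambda>x::real. if 0 \<le> x then 1 + x else 0"
  have "(1 + \<bar>x\<bar>) * killed f x = jump f x * ?g x" for x
    by (simp add: killed_def)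
  moreover have "integrable lborel (\<lambda>x. jump f x * ?g x)"
    by (rule jump_pairing(1)[OF D(1) _ D(5), of ?g 1]) auto
  ultimately have "integrable lborel (\<lambda>x. (1 + \<bar>x\<bar>) * killed f x)"
    by simp
  moreover have "killed f \<in> borel_measurable borel"
    unfolding killed_def by measurable
  moreover have "0 \<le> killed f x" "killed f x \<le> C" for x
    using jump_density_bounds[OF f C] \<open>0 \<le> C\<close> by (auto simp: killed_def)
  moreover have "killed f x = 0" if "x < 0" for x using that by (simp add: killed_def)
  ultimately show ?thesis
    unfolding walk_density_def by blast
qed

lemma killed_le: "walk_density f \<Longrightarrow> (\<And>x. f x \<le> C) \<Longrightarrow> killed f x \<le> C"
  using jump_density_bounds[of f C x] walk_densityD(2)[of f 0] by (auto simp: killed_def intro: order_trans)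

lemma killed_power_density: "walk_density f \<Longrightarrow> walk_density ((killed ^^ n) f)"
  by (induction n) (auto simp: killed_density)

lemma killed_power_le: "walk_density f \<Longrightarrow> (\<And>x. f x \<le> C) \<Longrightarrow> (killed ^^ n) f x \<le> C"
  by (induction n arbitrary: x) (auto intro!: killed_le killed_power_density)

lemma killed_pairing:
  assumes f: "walk_density f" and [measurable]: "g \<in> borel_measurable borel"
    and g: "\<And>x. \<bar>g x\<bar> \<le> C * (1 + \<bar>x\<bar>)" and g0: "\<And>x. x < 0 \<Longrightarrow> g x = 0"
  shows "(\<integral>x. killed f x * g x \<partial>lborel) = (\<integral>x. f x * jump g x \<partial>lborel)"
proof -
  have "(\<lambda>x. killed f x * g x) = (\<lambda>x. jump f x * g x)"
    using g0 by (auto simp: killed_def fun_eq_iff)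
  then show ?thesis
    using jump_pairing(3)[OF walk_densityD(1)[OF f] _ walk_densityD(5)[OF f] g] by simp
qed

lemma killed_symmetric:
  assumes f: "walk_density f" and g: "walk_density g"
  shows "(\<integral>x. killed f x * g x \<partial>lborel) = (\<integral>x. f x * killed g x \<partial>lborel)"
proof -
  note D = walk_densityD[OF g]
  obtain C where C: "C > 0" "\<And>x. g x \<le> C" using D(4) by blast
  have "\<bar>g x\<bar> \<le> C * (1 + \<bar>x\<bar>)" for x
  proof -
    have "C * 1 \<le> C * (1 + \<bar>x\<bar>)" using C(1) by (intro mult_left_mono) auto
    then show ?thesis using C(2)[of x] D(2)[of x] by simp
  qed
  then have "(\<integral>x. killed f x * g x \<partial>lborel) = (\<integral>x. f x * jump g x \<partial>lborel)"
    by (intro killed_pairing[OF f D(1)] D(3))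
  also have "\<dots> = (\<integral>x. f x * killed g x \<partial>lborel)"
    using walk_densityD(3)[OF f] by (intro Bochner_Integration.integral_cong) (auto simp: killed_def)
  finally show ?thesis .
qed

lemma killed_power_symmetric:
  assumes "walk_density f" and "walk_density g"
  shows "(\<integral>x. (killed ^^ n) f x * g x \<partial>lborel) = (\<integral>x. f x * (killed ^^ n) g x \<partial>lborel)"
  using assms
proof (induction n arbitrary: g)
  case (Suc n)
  have "(\<integral>x. (killed ^^ Suc n) f x * g x \<partial>lborel) = (\<integral>x. (killed ^^ n) f x * killed g x \<partial>lborel)"
    using Suc.prems by (simp add: killed_symmetric killed_power_density)
  also have "\<dots> = (\<integral>x. f x * (killed ^^ Suc n) g x \<partial>lborel)"
    using Suc by (simp add: killed_density funpow_swap1)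
  finally show ?case .
qed simp

lemma mass_killed_le:
  assumes f: "walk_density f"
  shows "mass (killed f) \<le> mass f"
proof -
  let ?g = "\<lambda>x::real. if 0 \<le> x then 1 else 0 :: real"
  have "killed f x = killed f x * ?g x" for x
    by (simp add: killed_def)
  then have "mass (killed f) = (\<integral>x. killed f x * ?g x \<partial>lborel)"
    unfolding mass_def by (intro Bochner_Integration.integral_cong) auto
  also have "\<dots> = (\<integral>x. f x * jump ?g x \<partial>lborel)"
    by (rule killed_pairing[OF f, of _ 1]) auto
  also have "\<dots> \<le> (\<integral>x. f x \<partial>lborel)"
  proof (rule integral_mono)
    have *: "\<bar>jump ?g x\<bar> \<le> 1" for x by (rule jump_le) auto
    show "integrable lborel (\<lambda>x. f x * jump ?g x)"
      by (rule walk_density_integrable_mult[OF f, of _ 1]) (use order_trans[OF *] in auto)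
    show "f x * jump ?g x \<le> f x" for x
      using *[of x] walk_densityD(2)[OF f, of x] by (intro mult_left_le) auto
  qed (rule walk_density_integrable[OF f])
  finally show ?thesis by (simp add: mass_def)
qed

lemma mass_killed_power_antimono:
  assumes f: "walk_density f" and "m \<le> n"
  shows "mass ((killed ^^ n) f) \<le> mass ((killed ^^ m) f)"
proof -
  have "decseq (\<lambda>n. mass ((killed ^^ n) f))"
    by (rule decseq_SucI) (simp add: mass_killed_le killed_power_density f)
  then show ?thesis using assms(2) by (simp add: decseq_def)
qed

text \<open>The function \<open>x + d\<close> is harmonic for the free walk, and nonnegative wherever a jump from
  the half-line can land; hence it is superharmonic for the killed walk.\<close>

lemma shifted_moment_killed_le:
  assumes f: "walk_density f"
  shows "shifted_moment (killed f) \<le> shifted_moment f"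
proof -
  let ?g = "\<lambda>x::real. if 0 \<le> x then x + d else 0"
  have g: "\<bar>?g x\<bar> \<le> (1 + d) * (1 + \<bar>x\<bar>)" for x
  proof -
    have "0 \<le> d * \<bar>x\<bar>" using d_pos by simp
    then have "\<bar>x\<bar> + d \<le> (1 + d) * (1 + \<bar>x\<bar>)"
      by (simp add: distrib_left distrib_right)
    moreover have "\<bar>?g x\<bar> \<le> \<bar>x\<bar> + d" using d_pos by auto
    ultimately show ?thesis by linarith
  qed
  have "(x + d) * killed f x = killed f x * ?g x" for x
    by (simp add: killed_def)
  then have "shifted_moment (killed f) = (\<integral>x. killed f x * ?g x \<partial>lborel)"
    unfolding shifted_moment_def by (intro Bochner_Integration.integral_cong) auto
  also have "\<dots> = (\<integral>x. f x * jump ?g x \<partial>lborel)"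
    by (rule killed_pairing[OF f _ g]) auto
  also have "\<dots> \<le> (\<integral>x. (x + d) * f x \<partial>lborel)"
  proof (rule integral_mono)
    show "integrable lborel (\<lambda>x. f x * jump ?g x)"
      by (rule jump_pairing(2)[OF walk_densityD(1)[OF f] _ walk_densityD(5)[OF f] g]) auto
    show "f x * jump ?g x \<le> (x + d) * f x" for x
    proof (cases "0 \<le> x")
      case True
      have "jump ?g x = (\<integral>z. J z * ?g (x - z) \<partial>lborel)" by (rule jump_shift)
      also have "\<dots> \<le> (\<integral>z. (x + d) * J z - J z * z \<partial>lborel)"
      proof (rule integral_mono)
        have "\<bar>?g (x - z)\<bar> \<le> \<bar>x\<bar> + d + d" if "\<bar>z\<bar> \<le> d" for z using that by auto
        then show "integrable lborel (\<lambda>z. J z * ?g (x - z))"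
          by (intro jump_local_integrable(1)[of ?g x "\<bar>x\<bar> + d + d"]) auto
        show "integrable lborel (\<lambda>z. (x + d) * J z - J z * z)"
          by (intro Bochner_Integration.integrable_diff integrable_mult_right J_integrable J_first_moment_integrable)
        fix z
        have "J z * ?g (x - z) \<le> J z * (x + d - z)"
        proof (cases "\<bar>z\<bar> < d")
          case True
          with \<open>0 \<le> x\<close> show ?thesis by (intro mult_left_mono J_nonneg) auto
        qed (simp add: J_supp)
        then show "J z * ?g (x - z) \<le> (x + d) * J z - J z * z"
          by (simp add: algebra_simps)
      qed
      also have "\<dots> = x + d"
        by (subst Bochner_Integration.integral_diff)
           (simp_all add: J_integrable J_first_moment_integrable J_integral J_first_moment)
      finally have "f x * jump ?g x \<le> f x * (x + d)"
        by (rule mult_left_mono[OF _ walk_densityD(2)[OF f]])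
      then show ?thesis by (simp only: mult.commute)
    qed (simp add: walk_densityD(3)[OF f])
  qed (rule walk_density_integrable[OF f])
  finally show ?thesis by (simp add: shifted_moment_def)
qed

lemma shifted_moment_killed_power_le:
  "walk_density f \<Longrightarrow> shifted_moment ((killed ^^ n) f) \<le> shifted_moment f"
proof (induction n)
  case (Suc n)
  then show ?case
    using shifted_moment_killed_le[OF killed_power_density[OF Suc.prems], of n] by simp
qed simp

end

section \<open>Survival and exit flux\<close>

context dispersal_kernel
begin

lemma kernel_power_nonneg: "0 \<le> kernel_power n x"
proof (induction n arbitrary: x)
  case (Suc n)
  then show ?case using J_nonneg by (auto intro!: integral_nonneg_AE)
qed (simp add: J_nonneg)

lemma kernel_power_even: "kernel_power n (- x) = kernel_power n x"
proof -
  have "2 * pi * kernel_power n (- x) = 2 * pi * kernel_power n x"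
    unfolding kernel_power_fourier by simp
  then show ?thesis by simp
qed

lemma jump_kernel_power:
  shows "jump (\<lambda>y. kernel_power n (x - y)) z = kernel_power (Suc n) (x - z)"
    and "jump (\<lambda>y. kernel_power n (x + y)) z = kernel_power (Suc n) (x + z)"
proof -
  show 1: "jump (\<lambda>y. kernel_power n (x - y)) z = kernel_power (Suc n) (x - z)" for x
  proof -
    have "J (z - (x - y)) = J (x - z - y)" for y
      using J_even[of "x - z - y"] by (simp add: algebra_simps)
    then show ?thesis
      using lborel_integral_real_affine[of "-1" "\<lambda>y. J (z - y) * kernel_power n (x - y)" x]
      by (simp add: jump_def)
  qed
  have "(\<lambda>y. kernel_power n (x + y)) = (\<lambda>y. kernel_power n (- x - y))"
    using kernel_power_even[of n "x + _"] by (simp add: fun_eq_iff)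
  then show "jump (\<lambda>y. kernel_power n (x + y)) z = kernel_power (Suc n) (x + z)"
    using 1[of "- x"] kernel_power_even[of "Suc n" "x + z"] by (simp del: kernel_power.simps)
qed

lemma kernel_power_linear_bound: "\<exists>C. \<forall>x. \<bar>kernel_power n x\<bar> \<le> C \<and> (\<forall>y. \<bar>kernel_power n x\<bar> \<le> C * (1 + \<bar>y\<bar>))"
proof -
  obtain C where C: "C > 0" "\<And>n x. \<bar>kernel_power n x\<bar> \<le> C / sqrt (real (n + 1))"
    using kernel_power_bound by blast
  have "\<bar>kernel_power n x\<bar> \<le> C / sqrt (real (n + 1)) * (1 + \<bar>y\<bar>)" for x y
  proof -
    have "C / sqrt (real (n + 1)) * 1 \<le> C / sqrt (real (n + 1)) * (1 + \<bar>y\<bar>)"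
      using C(1) by (intro mult_left_mono) auto
    then show ?thesis using C(2)[of n x] by linarith
  qed
  then show ?thesis using C(2) by blast
qed

text \<open>Killing only removes mass, so the free walk dominates the killed one.\<close>

lemma killed_power_le_kernel:
  assumes f: "walk_density f"
  shows "(killed ^^ Suc n) f x \<le> (\<integral>y. kernel_power n (x - y) * f y \<partial>lborel)"
  using f
proof (induction n arbitrary: f)
  case 0
  have "0 \<le> jump f x"
    using jump_density_bounds(1)[OF 0] walk_densityD(4)[OF 0] by blast
  then show ?case by (simp add: killed_def jump_def)
next
  case (Suc n)
  note D = walk_densityD[OF Suc.prems]
  note [measurable] = D(1)
  obtain B where B: "\<And>x. f x \<le> B" using D(4) by blast
  obtain C where C: "\<And>x y. \<bar>kernel_power n x\<bar> \<le> C * (1 + \<bar>y\<bar>)"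
    using kernel_power_linear_bound by blast
  have "(killed ^^ Suc (Suc n)) f x = (killed ^^ Suc n) (killed f) x"
    by (simp add: funpow_swap1)
  also have "\<dots> \<le> (\<integral>y. kernel_power n (x - y) * killed f y \<partial>lborel)"
    by (rule Suc.IH) (rule killed_density[OF Suc.prems])
  also have "\<dots> \<le> (\<integral>y. jump f y * kernel_power n (x - y) \<partial>lborel)"
  proof (rule integral_mono)
    show "integrable lborel (\<lambda>y. jump f y * kernel_power n (x - y))"
      by (rule jump_pairing(1)[OF D(1) _ D(5), of _ C]) (auto intro: C)
    have "\<bar>kernel_power n (x - y)\<bar> \<le> C * (1 + y)" if "0 \<le> y" for y
      using C[of "x - y" y] that by simp
    then have "integrable lborel (\<lambda>y. killed f y * kernel_power n (x - y))"
      by (intro walk_density_integrable_mult[OF killed_density[OF Suc.prems], of _ C]) auto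
    then show "integrable lborel (\<lambda>y. kernel_power n (x - y) * killed f y)"
      by (simp add: mult.commute)
    show "kernel_power n (x - y) * killed f y \<le> jump f y * kernel_power n (x - y)" for y
      using jump_density_bounds(1)[OF Suc.prems B, of y] kernel_power_nonneg[of n "x - y"] by (simp add: killed_def)
  qed
  also have "\<dots> = (\<integral>y. f y * jump (\<lambda>y. kernel_power n (x - y)) y \<partial>lborel)"
    by (rule jump_pairing(3)[OF D(1) _ D(5), of _ C]) (auto intro: C)
  also have "\<dots> = (\<integral>y. kernel_power (Suc n) (x - y) * f y \<partial>lborel)"
    by (simp only: jump_kernel_power mult.commute)
  finally show ?case .
qed

lemma killed_power_sup_bound:
  "\<exists>C>0. \<forall>f n x. walk_density f \<longrightarrow> 1 \<le> n \<longrightarrow> (killed ^^ n) f x \<le> C / sqrt (real n) * mass f"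
proof -
  obtain C where C: "C > 0" "\<And>n x. \<bar>kernel_power n x\<bar> \<le> C / sqrt (real (n + 1))"
    using kernel_power_bound by blast
  have "(killed ^^ n) f x \<le> C / sqrt (real n) * mass f" if f: "walk_density f" and n: "1 \<le> n" for f n x
  proof -
    note D = walk_densityD[OF f]
    note [measurable] = D(1)
    obtain m where m: "n = Suc m" using n by (cases n) auto
    have b: "kernel_power m (x - y) * f y \<le> C / sqrt (real n) * f y" for y
      using C(2)[of m "x - y"] D(2)[of y] m by (intro mult_right_mono) auto
    have "(killed ^^ n) f x \<le> (\<integral>y. kernel_power m (x - y) * f y \<partial>lborel)"
      unfolding m by (rule killed_power_le_kernel[OF f])
    also have "\<dots> \<le> (\<integral>y. C / sqrt (real n) * f y \<partial>lborel)"
    proof (rule integral_mono[OF _ _ b])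
      show i: "integrable lborel (\<lambda>y. C / sqrt (real n) * f y)"
        by (intro integrable_mult_right walk_density_integrable[OF f])
      show "integrable lborel (\<lambda>y. kernel_power m (x - y) * f y)"
      proof (rule Bochner_Integration.integrable_bound[OF i])
        show "AE y in lborel. norm (kernel_power m (x - y) * f y) \<le> norm (C / sqrt (real n) * f y)"
          using b kernel_power_nonneg D(2) C(1) by (simp add: abs_mult)
      qed measurable
    qed
    finally show ?thesis by (simp add: mass_def)
  qed
  then show ?thesis using C(1) by blast
qed

lemma mass_interpolation:
  assumes f: "walk_density f" and s: "\<And>x. f x \<le> s" and R: "0 < R"
  shows "mass f \<le> R * s + shifted_moment f / R"
proof -
  note D = walk_densityD[OF f]
  have "mass f \<le> (\<integral>x. indicator {0..R} x * s + (x + d) * f x / R \<partial>lborel)"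
    unfolding mass_def
  proof (rule integral_mono)
    show "integrable lborel (\<lambda>x. indicator {0..R} x * s + (x + d) * f x / R)"
      using walk_density_integrable(3)[OF f] R
      by (intro Bochner_Integration.integrable_add integrable_mult_left integrable_divide)
         (auto simp: integrable_indicator_iff emeasure_lborel_Icc_eq)
    fix x
    consider "x < 0" | "0 \<le> x" "x \<le> R" | "R < x" by linarith
    then show "f x \<le> indicator {0..R} x * s + (x + d) * f x / R"
    proof cases
      case 2
      then have "0 \<le> (x + d) * f x / R" using D(2)[of x] d_pos R by simp
      then show ?thesis using 2 s[of x] by simp
    next
      case 3
      then have "R * f x \<le> (x + d) * f x" using d_pos D(2)[of x] by (intro mult_right_mono) auto
      then show ?thesis using 3 R by (simp add: pos_le_divide_eq mult.commute)
    qed (use D(3) in simp)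
  qed (rule walk_density_integrable[OF f])
  also have "\<dots> = R * s + shifted_moment f / R"
    using walk_density_integrable(3)[OF f] R
    by (subst Bochner_Integration.integral_add)
       (auto simp: integrable_indicator_iff emeasure_lborel_Icc_eq shifted_moment_def)
  finally show ?thesis .
qed

lemma shifted_moment_nonneg: "walk_density f \<Longrightarrow> 0 \<le> shifted_moment f"
  unfolding shifted_moment_def
proof (intro integral_nonneg_AE AE_I2)
  fix x assume f: "walk_density f"
  show "0 \<le> (x + d) * f x"
    using walk_densityD(2,3)[OF f, of x] d_pos by (cases "x < 0") auto
qed

lemma mass_le_shifted_moment:
  assumes f: "walk_density f"
  shows "mass f \<le> shifted_moment f / d"
proof -
  have "mass f * d = (\<integral>x. d * f x \<partial>lborel)" by (simp add: mass_def)
  also have "\<dots> \<le> shifted_moment f"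
    unfolding shifted_moment_def
  proof (rule integral_mono)
    show "d * f x \<le> (x + d) * f x" for x
      using walk_densityD(2,3)[OF f, of x] by (cases "x < 0") (auto intro: mult_right_mono)
  qed (auto intro: walk_density_integrable[OF f])
  finally show ?thesis using d_pos by (simp add: pos_le_divide_eq)
qed

text \<open>Survival to time \<open>n\<close> costs a factor \<open>1 / sqrt n\<close>. Interpolating the mass at time \<open>2 m\<close>
  between the sup bound (which carries the mass at time \<open>m\<close>) and the first moment at radius
  proportional to \<open>sqrt m\<close> gives a recursion with factor \<open>1/4\<close>, which beats the loss
  \<open>sqrt 3\<close> from passing from \<open>n\<close> to \<open>n div 2\<close>.\<close>

lemma survival_bound:
  "\<exists>A>0. \<forall>f n. walk_density f \<longrightarrow> 1 \<le> n \<longrightarrow> mass ((killed ^^ n) f) \<le> A * shifted_moment f / sqrt (real n)"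
proof -
  obtain C where C: "C > 0" and sup: "\<And>f n x. walk_density f \<Longrightarrow> 1 \<le> n \<Longrightarrow> (killed ^^ n) f x \<le> C / sqrt (real n) * mass f"
    using killed_power_sup_bound by blast
  \<comment> \<open>\<open>16 C\<close> absorbs the recursion, \<open>1 / d\<close> the first step.\<close>
  define A where "A = 16 * C + 1 / d"
  have A: "0 < A" using C d_pos by (simp add: A_def add_pos_pos)
  have "mass ((killed ^^ n) f) \<le> A * shifted_moment f / sqrt (real n)" if f: "walk_density f" and "1 \<le> n" for f n
    using \<open>1 \<le> n\<close>
  proof (induction n rule: less_induct)
    case (less n)
    let ?h = "shifted_moment f"
    have h: "0 \<le> ?h" by (rule shifted_moment_nonneg[OF f])
    show ?case
    proof (cases "n = 1")
      case True
      have "mass ((killed ^^ n) f) \<le> ?h / d"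
        using mass_killed_le[OF f] mass_le_shifted_moment[OF f] True by simp
      also have "\<dots> \<le> A * ?h"
        using C h by (simp add: A_def distrib_right)
      finally show ?thesis using True by simp
    next
      case False
      define m where "m = n div 2"
      have m: "1 \<le> m" "m < n" "m + m \<le> n" "n \<le> 3 * m"
        using less.prems False by (auto simp: m_def)
      define g where "g = (killed ^^ m) f"
      have g: "walk_density g" unfolding g_def by (rule killed_power_density[OF f])
      have sm: "0 < sqrt (real m)" using m by simp
      have "mass ((killed ^^ n) f) \<le> mass ((killed ^^ (m + m)) f)"
        by (rule mass_killed_power_antimono[OF f m(3)])
      also have "\<dots> = mass ((killed ^^ m) g)"
        by (simp add: g_def funpow_add)
      \<comment> \<open>The radius is chosen so that the sup term becomes exactly a quarter of the mass of \<open>g\<close>.\<close>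
      also have "\<dots> \<le> sqrt (real m) / (4 * C) * (C / sqrt (real m) * mass g)
          + shifted_moment ((killed ^^ m) g) / (sqrt (real m) / (4 * C))"
        using m C by (intro mass_interpolation killed_power_density g sup) auto
      also have "sqrt (real m) / (4 * C) * (C / sqrt (real m) * mass g) = mass g / 4"
        using C sm by (simp add: field_simps)
      also have "mass g / 4 + shifted_moment ((killed ^^ m) g) / (sqrt (real m) / (4 * C))
          \<le> A * ?h / sqrt (real m) / 4 + ?h / (sqrt (real m) / (4 * C))"
      proof (intro add_mono divide_right_mono)
        show "mass g \<le> A * ?h / sqrt (real m)"
          unfolding g_def by (rule less.IH[OF m(2,1)])
        show "shifted_moment ((killed ^^ m) g) \<le> ?h"
          using shifted_moment_killed_power_le[OF g, of m] shifted_moment_killed_power_le[OF f, of m]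
          by (simp add: g_def)
      qed (use C sm in auto)
      also have "\<dots> = (A / 4 + 4 * C) * ?h * (1 / sqrt (real m))"
        using C sm by (simp add: field_simps)
      \<comment> \<open>\<open>n \<le> 3 m\<close>, and \<open>7/4\<close> is a rational upper bound for \<open>sqrt 3\<close>.\<close>
      also have "\<dots> \<le> (A / 4 + 4 * C) * ?h * (7 / 4 / sqrt (real n))"
      proof (rule mult_left_mono)
        have "sqrt (real n) \<le> sqrt ((7 / 4)\<^sup>2 * real m)"
          using m(4) by (intro real_sqrt_le_mono) (simp add: power2_eq_square)
        also have "\<dots> = 7 / 4 * sqrt (real m)"
          by (simp add: real_sqrt_mult)
        finally show "1 / sqrt (real m) \<le> 7 / 4 / sqrt (real n)"
          using sm less.prems by (simp add: field_simps)
      qed (use A C h in auto)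
      also have "\<dots> = (7 / 4 * (A / 4 + 4 * C)) * ?h / sqrt (real n)"
        by simp
      also have "\<dots> \<le> A * ?h / sqrt (real n)"
      proof (intro divide_right_mono mult_right_mono h)
        define e where "e = 1 / d"
        have "0 < e" "A = 16 * C + e" using d_pos by (simp_all add: e_def A_def)
        then show "7 / 4 * (A / 4 + 4 * C) \<le> A" using C by (simp add: field_simps)
      qed simp
      finally show ?thesis .
    qed
  qed
  then show ?thesis using A by blast
qed

text \<open>The density at \<open>- y\<close> of the mass that one jump carries out of the half-line, seen on the
  positive side: what the odd reflection must add back near the boundary.\<close>

definition exit_flux :: "(real \<Rightarrow> real) \<Rightarrow> real \<Rightarrow> real" where
  "exit_flux f y = (if 0 < y then jump f (- y) else 0)"

lemma exit_flux_measurable [measurable]: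
  assumes [measurable]: "f \<in> borel_measurable borel"
  shows "exit_flux f \<in> borel_measurable borel"
  unfolding exit_flux_def by measurable

lemma exit_flux_nonneg: "walk_density f \<Longrightarrow> 0 \<le> exit_flux f y"
  using jump_density_bounds(1) walk_densityD(4) unfolding exit_flux_def by fastforce

lemma exit_flux_le: "walk_density f \<Longrightarrow> (\<And>x. f x \<le> C) \<Longrightarrow> exit_flux f y \<le> C"
  using jump_density_bounds(2)[of f C] walk_densityD(2)[of f 0] by (auto simp: exit_flux_def intro: order_trans)

lemma exit_flux_supp:
  assumes f: "walk_density f" and y: "d \<le> y"
  shows "exit_flux f y = 0"
proof -
  have "(\<lambda>z. J (- y - z) * f z) = (\<lambda>_. 0)"
  proof
    fix z show "J (- y - z) * f z = 0"
      using J_supp[of "- y - z"] walk_densityD(3)[OF f, of z] y by (cases "z < 0") auto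
  qed
  then show ?thesis by (simp add: exit_flux_def jump_def)
qed

text \<open>Three time intervals of equal length: survival away from the starting density, free
  spreading, and, reversing time, survival of the walk started at the exit point. Each costs
  \<open>1 / sqrt n\<close>.\<close>

lemma exit_flux_decay:
  assumes f: "walk_density f"
  shows "\<exists>C>0. \<forall>n y. exit_flux ((killed ^^ n) f) y \<le> C / sqrt (real (n + 1)) ^ 3"
proof -
  obtain B where B: "B > 0" "\<And>x. f x \<le> B" using walk_densityD(4)[OF f] by blast
  obtain C where C: "C > 0" and sup: "\<And>f n x. walk_density f \<Longrightarrow> 1 \<le> n \<Longrightarrow> (killed ^^ n) f x \<le> C / sqrt (real n) * mass f"
    using killed_power_sup_bound by blast
  obtain A where A: "A > 0" and surv: "\<And>f n. walk_density f \<Longrightarrow> 1 \<le> n \<Longrightarrow> mass ((killed ^^ n) f) \<le> A * shifted_moment f / sqrt (real n)"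
    using survival_bound by blast
  let ?h = "shifted_moment f"
  have h: "0 \<le> ?h" by (rule shifted_moment_nonneg[OF f])
  \<comment> \<open>The second summand covers \<open>n < 3\<close>, where \<open>n div 3\<close> is zero.\<close>
  define K where "K = sqrt 6 ^ 3 * (C * (A * (2 * d)) * (A * ?h)) + 3 ^ 3 * B"
  have s6: "1 / sqrt (real l) ^ 3 \<le> sqrt 6 ^ 3 / sqrt (real (n + 1)) ^ 3" if "n + 1 \<le> 6 * l" "1 \<le> l" for n l :: nat
  proof -
    have "sqrt (real (n + 1)) \<le> sqrt (6 * real l)"
      using that by (intro real_sqrt_le_mono) linarith
    then have "sqrt (real (n + 1)) ^ 3 \<le> (sqrt 6 * sqrt (real l)) ^ 3"
      by (intro power_mono) (auto simp: real_sqrt_mult)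
    then show ?thesis
      using that by (simp add: power_mult_distrib field_simps)
  qed
  have "exit_flux ((killed ^^ n) f) y \<le> K / sqrt (real (n + 1)) ^ 3" for n y
  proof (cases "3 \<le> n \<and> 0 < y")
    case True
    define l where "l = n div 3"
    have l: "1 \<le> l" "l \<le> n - 2 * l" "n = l + (l + (n - 2 * l))" "n + 1 \<le> 6 * l" "l + (n - 2 * l) = n - l"
    proof -
      show "1 \<le> l" "l \<le> n - 2 * l" "n = l + (l + (n - 2 * l))" "l + (n - 2 * l) = n - l"
        using True by (auto simp: l_def)
      show "n + 1 \<le> 6 * l"
      proof -
        have "3 \<le> n" using True by simp
        then show ?thesis unfolding l_def by presburger
      qed
    qed
    \<comment> \<open>The flux at \<open>y\<close> is a pairing with \<open>g\<close>, the density of a reversed walk that has just entered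
      from \<open>- y\<close>. Symmetry moves the last two thirds of the time onto \<open>g\<close>.\<close>
    define g where "g z = (if 0 \<le> z then J (- y - z) else 0)" for z
    have g: "walk_density g"
    proof -
      obtain Jm where Jm: "Jm > 0" "\<And>z. J z \<le> Jm" using J_bounded by blast
      have "integrable lborel (\<lambda>z. J (- y - z) * ((1 + \<bar>z\<bar>) * (if 0 \<le> z then 1 else 0)))"
        by (rule jump_local_integrable(2)[of _ "- y" "1 + (\<bar>y\<bar> + d)"]) (auto simp: abs_mult)
      moreover have "(\<lambda>z. J (- y - z) * ((1 + \<bar>z\<bar>) * (if 0 \<le> z then 1 else 0))) = (\<lambda>z. (1 + \<bar>z\<bar>) * g z)"
        by (auto simp: g_def)
      moreover have "g \<in> borel_measurable borel" unfolding g_def by measurable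
      moreover have "0 \<le> g z" "g z \<le> Jm" for z using J_nonneg Jm by (auto simp: g_def less_imp_le)
      moreover have "g z = 0" if "z < 0" for z using that by (simp add: g_def)
      ultimately show ?thesis unfolding walk_density_def by auto
    qed
    have hg: "shifted_moment g \<le> 2 * d"
    proof -
      have "shifted_moment g \<le> (\<integral>z. 2 * d * J (- y - z) \<partial>lborel)"
        unfolding shifted_moment_def
      proof (rule integral_mono[OF walk_density_integrable(3)[OF g]])
        show "integrable lborel (\<lambda>z. 2 * d * J (- y - z))"
          using lborel_integrable_real_affine[OF J_integrable, of "-1" "- y"] by simp
        show "(z + d) * g z \<le> 2 * d * J (- y - z)" for z
        proof (cases "0 \<le> z \<and> z < d")
          case True
          then show ?thesis unfolding g_def using J_nonneg by (auto intro: mult_right_mono)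
        next
          case False
          then have "g z = 0" using True J_supp[of "- y - z"] by (auto simp: g_def)
          then show ?thesis using J_nonneg d_pos by simp
        qed
      qed
      also have "\<dots> = 2 * d"
        using lborel_integral_real_affine[of "-1" J "- y"] by (simp add: J_integral)
      finally show ?thesis .
    qed
    have "exit_flux ((killed ^^ n) f) y = (\<integral>z. (killed ^^ n) f z * g z \<partial>lborel)"
      using True walk_densityD(3)[OF killed_power_density[OF f]]
      unfolding exit_flux_def jump_def by (auto intro!: Bochner_Integration.integral_cong simp: g_def)
    also have "\<dots> = (\<integral>z. (killed ^^ (n - l)) ((killed ^^ l) f) z * g z \<partial>lborel)"
    proof -
      have "(killed ^^ ((n - l) + l)) f = (killed ^^ (n - l)) ((killed ^^ l) f)"
        by (simp only: funpow_add o_apply)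
      then show ?thesis using l by simp
    qed
    also have "\<dots> = (\<integral>z. (killed ^^ l) f z * (killed ^^ (n - l)) g z \<partial>lborel)"
      by (rule killed_power_symmetric[OF killed_power_density[OF f] g])
    also have "\<dots> \<le> (\<integral>z. (C * (A * (2 * d)) / (sqrt (real l) * sqrt (real l))) * (killed ^^ l) f z \<partial>lborel)"
    proof (rule integral_mono)
      let ?b = "C * (A * (2 * d)) / (sqrt (real l) * sqrt (real l))"
      have b: "(killed ^^ (n - l)) g z \<le> ?b" for z
      proof -
        have "(killed ^^ (n - l)) g z = (killed ^^ l) ((killed ^^ (n - 2 * l)) g) z"
          unfolding l(5)[symmetric] by (simp add: funpow_add)
        also have "\<dots> \<le> C / sqrt (real l) * mass ((killed ^^ (n - 2 * l)) g)"
          by (rule sup[OF killed_power_density[OF g] l(1)])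
        also have "\<dots> \<le> C / sqrt (real l) * (A * (2 * d) / sqrt (real l))"
        proof (rule mult_left_mono)
          have "mass ((killed ^^ (n - 2 * l)) g) \<le> mass ((killed ^^ l) g)"
            by (rule mass_killed_power_antimono[OF g l(2)])
          also have "\<dots> \<le> A * shifted_moment g / sqrt (real l)"
            by (rule surv[OF g l(1)])
          also have "\<dots> \<le> A * (2 * d) / sqrt (real l)"
            using hg A by (intro divide_right_mono mult_left_mono) auto
          finally show "mass ((killed ^^ (n - 2 * l)) g) \<le> A * (2 * d) / sqrt (real l)" .
        qed (use C in simp)
        finally show ?thesis by simp
      qed
      have nn: "0 \<le> (killed ^^ (n - l)) g z" for z
        by (rule walk_densityD(2)[OF killed_power_density[OF g]])
      show "(killed ^^ l) f z * (killed ^^ (n - l)) g z \<le> ?b * (killed ^^ l) f z" for z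
        using mult_left_mono[OF b walk_densityD(2)[OF killed_power_density[OF f]]] by (simp only: mult.commute)
      have "\<bar>(killed ^^ (n - l)) g z\<bar> \<le> ?b * (1 + z)" if "0 \<le> z" for z
      proof -
        have "0 \<le> ?b" using order_trans[OF nn b] .
        then have "?b * 1 \<le> ?b * (1 + z)" using that by (intro mult_left_mono) auto
        then show ?thesis using b[of z] nn[of z] by linarith
      qed
      then show "integrable lborel (\<lambda>z. (killed ^^ l) f z * (killed ^^ (n - l)) g z)"
        by (intro walk_density_integrable_mult[OF killed_power_density[OF f]]
            walk_densityD(1)[OF killed_power_density[OF g]])
      show "integrable lborel (\<lambda>z. ?b * (killed ^^ l) f z)"
        by (intro integrable_mult_right walk_density_integrable[OF killed_power_density[OF f]])
    qed
    also have "\<dots> = (C * (A * (2 * d)) / (sqrt (real l) * sqrt (real l))) * mass ((killed ^^ l) f)"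
      by (simp add: mass_def)
    also have "\<dots> \<le> (C * (A * (2 * d)) / (sqrt (real l) * sqrt (real l))) * (A * ?h / sqrt (real l))"
      using C A d_pos by (intro mult_left_mono surv[OF f l(1)]) auto
    also have "\<dots> = (C * (A * (2 * d)) * (A * ?h)) * (1 / sqrt (real l) ^ 3)"
      by (simp add: power3_eq_cube)
    also have "\<dots> \<le> (C * (A * (2 * d)) * (A * ?h)) * (sqrt 6 ^ 3 / sqrt (real (n + 1)) ^ 3)"
      using C A d_pos h s6[OF l(4,1)] by (intro mult_left_mono) auto
    also have "\<dots> = (sqrt 6 ^ 3 * (C * (A * (2 * d)) * (A * ?h))) / sqrt (real (n + 1)) ^ 3"
      by simp
    also have "\<dots> \<le> K / sqrt (real (n + 1)) ^ 3"
      using B by (intro divide_right_mono) (auto simp: K_def)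
    finally show ?thesis .
  next
    case False
    have K: "3 ^ 3 * B \<le> K" "0 \<le> K" using A C d_pos h B by (auto simp: K_def)
    show ?thesis
    proof (cases "0 < y")
      case True
      with False have n: "n < 3" by simp
      have "exit_flux ((killed ^^ n) f) y \<le> B"
        by (intro exit_flux_le killed_power_density f killed_power_le B)
      also have "\<dots> \<le> K / 3 ^ 3" using K by simp
      also have "\<dots> \<le> K / sqrt (real (n + 1)) ^ 3"
      proof (intro divide_left_mono power_mono K)
        have "sqrt (real (n + 1)) \<le> sqrt (3\<^sup>2)" using n by (intro real_sqrt_le_mono) auto
        then show "sqrt (real (n + 1)) \<le> 3" by simp
      qed auto
      finally show ?thesis .
    qed (use K in \<open>simp add: exit_flux_def\<close>)
  qed
  moreover have "0 < K" using A C d_pos h B by (simp add: K_def add_nonneg_pos)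
  ultimately show ?thesis by blast
qed

end

section \<open>Odd reflection\<close>

context dispersal_kernel
begin

text \<open>Pairing a density with an odd function: the free step splits into the surviving part and
  the part that leaves, and the latter is reflected with a sign.\<close>

lemma odd_pairing:
  assumes f: "walk_density f" and [measurable]: "g \<in> borel_measurable borel"
    and g: "\<And>x. \<bar>g x\<bar> \<le> C * (1 + \<bar>x\<bar>)" and odd: "\<And>x. g (- x) = - g x"
  shows "integrable lborel (\<lambda>y. exit_flux f y * g y)"
    and "(\<integral>x. killed f x * g x \<partial>lborel) =
      (\<integral>x. f x * jump g x \<partial>lborel) + (\<integral>y. exit_flux f y * g y \<partial>lborel)"
proof -
  note D = walk_densityD[OF f]
  note [measurable] = D(1)
  have i1: "integrable lborel (\<lambda>x. jump f x * g x)"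
    by (rule jump_pairing(1)[OF D(1) _ D(5) g]) simp
  have i2: "integrable lborel (\<lambda>x. killed f x * g x)"
  proof (rule Bochner_Integration.integrable_bound[OF i1])
    show "(\<lambda>x. killed f x * g x) \<in> borel_measurable lborel"
      unfolding killed_def by measurable
  qed (auto simp: killed_def)
  have eq: "jump f x * g x - killed f x * g x = - (exit_flux f (- x) * g (- x))" for x
    using odd[of 0] by (cases "x = 0") (auto simp: killed_def exit_flux_def odd)
  have "integrable lborel (\<lambda>x. jump f x * g x - killed f x * g x)"
    by (intro Bochner_Integration.integrable_diff i1 i2)
  then have "integrable lborel (\<lambda>x. - (exit_flux f (- x) * g (- x)))"
    unfolding eq .
  then have i3: "integrable lborel (\<lambda>x. exit_flux f (0 + - 1 * x) * g (0 + - 1 * x))"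
    using integrable_minus by fastforce
  then show "integrable lborel (\<lambda>y. exit_flux f y * g y)"
    by (subst (asm) lborel_integrable_real_affine_iff) auto
  have "(\<integral>x. jump f x * g x \<partial>lborel) - (\<integral>x. killed f x * g x \<partial>lborel) =
      (\<integral>x. - (exit_flux f (- x) * g (- x)) \<partial>lborel)"
    unfolding eq[symmetric] by (rule Bochner_Integration.integral_diff[OF i1 i2, symmetric])
  also have "\<dots> = - (\<integral>y. exit_flux f y * g y \<partial>lborel)"
    using lborel_integral_real_affine[of "-1" "\<lambda>y. exit_flux f y * g y" 0] by simp
  finally show "(\<integral>x. killed f x * g x \<partial>lborel) =
      (\<integral>x. f x * jump g x \<partial>lborel) + (\<integral>y. exit_flux f y * g y \<partial>lborel)"
    using jump_pairing(3)[OF D(1) _ D(5) g] by simp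
qed

definition first_moment :: "(real \<Rightarrow> real) \<Rightarrow> real" where
  "first_moment f = (\<integral>x. x * f x \<partial>lborel)"

text \<open>The free walk preserves the first moment, the kernel being even, and the mass that leaves
  carries away a negative first moment.\<close>

lemma first_moment_killed:
  assumes f: "walk_density f"
  shows "first_moment (killed f) = first_moment f + first_moment (exit_flux f)"
proof -
  have "jump (\<lambda>x. x) y = y" for y
  proof -
    have "jump (\<lambda>x. x) y = (\<integral>z. y * J z - J z * z \<partial>lborel)"
      unfolding jump_shift by (simp add: algebra_simps)
    also have "\<dots> = y"
      by (subst Bochner_Integration.integral_diff)
         (simp_all add: J_integrable J_first_moment_integrable J_integral J_first_moment)
    finally show ?thesis .
  qed
  then show ?thesis
    using odd_pairing(2)[OF f, of "\<lambda>x. x" 1] by (simp add: first_moment_def mult.commute)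
qed

lemma odd_kernel_measurable [measurable]: "odd_kernel n x \<in> borel_measurable borel"
  unfolding odd_kernel_def by measurable

lemma odd_kernel_linear_bound: "\<exists>C. \<forall>y. \<bar>odd_kernel n x y\<bar> \<le> C * (1 + \<bar>y\<bar>)"
proof -
  obtain C where C: "\<And>x y. \<bar>kernel_power n x\<bar> \<le> C * (1 + \<bar>y\<bar>)"
    using kernel_power_linear_bound by blast
  have "\<bar>odd_kernel n x y\<bar> \<le> (2 * C) * (1 + \<bar>y\<bar>)" for y
  proof -
    have "\<bar>odd_kernel n x y\<bar> \<le> \<bar>kernel_power n (x - y)\<bar> + \<bar>kernel_power n (x + y)\<bar>"
      unfolding odd_kernel_def by (rule abs_triangle_ineq4)
    also have "\<dots> \<le> C * (1 + \<bar>y\<bar>) + C * (1 + \<bar>y\<bar>)" by (intro add_mono C)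
    finally show ?thesis by simp
  qed
  then show ?thesis by blast
qed

lemma jump_odd_kernel: "jump (odd_kernel n x) z = odd_kernel (Suc n) x z"
proof -
  obtain B where B: "\<And>x. \<bar>kernel_power n x\<bar> \<le> B"
    using kernel_power_linear_bound by blast
  have "jump (odd_kernel n x) z = (\<integral>y. J (z - y) * kernel_power n (x - y) - J (z - y) * kernel_power n (x + y) \<partial>lborel)"
    unfolding jump_def odd_kernel_def by (simp only: right_diff_distrib)
  also have "\<dots> = jump (\<lambda>y. kernel_power n (x - y)) z - jump (\<lambda>y. kernel_power n (x + y)) z"
    unfolding jump_def using B
    by (intro Bochner_Integration.integral_diff jump_local_integrable(2)[of "\<lambda>y. kernel_power n (x - y)" z B]
        jump_local_integrable(2)[of "\<lambda>y. kernel_power n (x + y)" z B]) auto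
  finally show ?thesis
    by (simp only: jump_kernel_power odd_kernel_def)
qed

text \<open>Extending the killed walk oddly turns the killing into a source supported near the
  origin. Iterating one step of this reflection expresses the killed walk through the free
  walk: the starting density and every exit flux are transported by the antisymmetrised free
  kernel.\<close>

lemma killed_power_reflection:
  assumes f: "walk_density f" and x: "0 < x"
  shows "(killed ^^ Suc n) f x = (\<integral>y. odd_kernel n x y * f y \<partial>lborel)
    + (\<Sum>k<n. \<integral>y. odd_kernel (n - Suc k) x y * exit_flux ((killed ^^ k) f) y \<partial>lborel)
    + exit_flux ((killed ^^ n) f) x"
  using f
proof (induction n arbitrary: f)
  case 0
  note D = walk_densityD[OF 0]
  note [measurable] = D(1)
  obtain C where C: "\<And>x. f x \<le> C" using D(4) by blast
  have "\<bar>f y\<bar> \<le> C" for y using C[of y] D(2)[of y] by simp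
  then have i: "integrable lborel (\<lambda>y. J (z - y) * f y)" for z
    by (intro jump_local_integrable(2)[of _ _ C]) auto
  have J: "J (x + y) = J (- x - y)" for y
    using J_even[of "x + y"] by simp
  have "(\<integral>y. odd_kernel 0 x y * f y \<partial>lborel) = jump f x - jump f (- x)"
    unfolding jump_def Bochner_Integration.integral_diff[OF i i, symmetric] odd_kernel_def
    by (simp add: J left_diff_distrib)
  then show ?case using x by (simp add: killed_def exit_flux_def)
next
  case (Suc n)
  obtain C where C: "\<And>y. \<bar>odd_kernel n x y\<bar> \<le> C * (1 + \<bar>y\<bar>)"
    using odd_kernel_linear_bound by blast
  have odd: "odd_kernel n x (- y) = - odd_kernel n x y" for y
    by (simp add: odd_kernel_def)
  have "(\<integral>y. odd_kernel n x y * killed f y \<partial>lborel) =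
      (\<integral>y. odd_kernel (Suc n) x y * f y \<partial>lborel) + (\<integral>y. odd_kernel n x y * exit_flux f y \<partial>lborel)"
    using odd_pairing(2)[OF Suc.prems _ C odd] by (simp add: jump_odd_kernel mult.commute)
  moreover have "(killed ^^ Suc (Suc n)) f x = (killed ^^ Suc n) (killed f) x"
    by (simp add: funpow_swap1)
  moreover have "(killed ^^ k) (killed f) = (killed ^^ Suc k) f" for k
    by (simp add: funpow_swap1)
  ultimately show ?case
    using Suc.IH[OF killed_density[OF Suc.prems]]
    by (simp add: sum.lessThan_Suc_shift del: funpow.simps sum.lessThan_Suc)
qed

lemma exit_flux_integrable:
  assumes f: "walk_density f"
  shows "integrable lborel (\<lambda>y. y * exit_flux f y)" and "integrable lborel (\<lambda>y. y\<^sup>2 * exit_flux f y)"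
proof -
  note [measurable] = walk_densityD(1)[OF f]
  show i: "integrable lborel (\<lambda>y. y * exit_flux f y)"
    using odd_pairing(1)[OF f, of "\<lambda>x. x" 1] by (simp add: mult.commute)
  have "\<bar>y\<^sup>2 * exit_flux f y\<bar> \<le> \<bar>d * (y * exit_flux f y)\<bar>" for y
  proof -
    consider "y \<le> 0" | "0 < y" "y < d" | "d \<le> y" by linarith
    then show ?thesis
    proof cases
      case 2
      then have "y * (y * exit_flux f y) \<le> d * (y * exit_flux f y)"
        using exit_flux_nonneg[OF f, of y] by (intro mult_right_mono) auto
      then show ?thesis
        using 2 exit_flux_nonneg[OF f, of y] by (simp add: power2_eq_square abs_mult)
    next
      case 3
      then show ?thesis by (simp add: exit_flux_supp[OF f])
    qed (simp add: exit_flux_def)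
  qed
  then show "integrable lborel (\<lambda>y. y\<^sup>2 * exit_flux f y)"
    by (intro Bochner_Integration.integrable_bound[OF integrable_mult_right[OF i, of d]]) auto
qed

lemma exit_flux_moments:
  assumes f: "walk_density f" and b: "\<And>y. exit_flux f y \<le> b"
  shows "0 \<le> first_moment (exit_flux f)" and "first_moment (exit_flux f) \<le> d\<^sup>2 * b"
    and "(\<integral>y. y\<^sup>2 * exit_flux f y \<partial>lborel) \<le> d * first_moment (exit_flux f)"
proof -
  note i = exit_flux_integrable[OF f]
  have p: "0 \<le> y * exit_flux f y" for y
    using exit_flux_nonneg[OF f, of y] by (cases "0 < y") (auto simp: exit_flux_def)
  then show "0 \<le> first_moment (exit_flux f)"
    unfolding first_moment_def by (intro integral_nonneg_AE) auto
  have "0 \<le> b" using exit_flux_nonneg[OF f] b order_trans by blast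
  have "first_moment (exit_flux f) \<le> (\<integral>y. indicator {0..d} y * (d * b) \<partial>lborel)"
    unfolding first_moment_def
  proof (rule integral_mono[OF i(1)])
    show "integrable lborel (\<lambda>y. indicator {0..d} y * (d * b))"
      by (intro integrable_mult_left) (simp add: integrable_indicator_iff emeasure_lborel_Icc_eq)
    fix y
    show "y * exit_flux f y \<le> indicator {0..d} y * (d * b)"
    proof (cases "0 < y \<and> y < d")
      case True
      then have "y * exit_flux f y \<le> d * b"
        using exit_flux_nonneg[OF f] b \<open>0 \<le> b\<close> by (intro mult_mono) auto
      then show ?thesis using True by simp
    next
      case False
      then have "exit_flux f y = 0" using exit_flux_supp[OF f, of y] by (auto simp: exit_flux_def)
      then show ?thesis using \<open>0 \<le> b\<close> d_pos by (simp add: indicator_def)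
    qed
  qed
  also have "\<dots> = d\<^sup>2 * b" using d_pos by (simp add: power2_eq_square)
  finally show "first_moment (exit_flux f) \<le> d\<^sup>2 * b" .
  have "(\<integral>y. y\<^sup>2 * exit_flux f y \<partial>lborel) \<le> (\<integral>y. d * (y * exit_flux f y) \<partial>lborel)"
  proof (rule integral_mono[OF i(2) integrable_mult_right[OF i(1)]])
    fix y
    show "y\<^sup>2 * exit_flux f y \<le> d * (y * exit_flux f y)"
    proof (cases "y < d")
      case True
      then have "y * (y * exit_flux f y) \<le> d * (y * exit_flux f y)"
        using p[of y] by (intro mult_right_mono) auto
      then show ?thesis by (simp add: power2_eq_square mult.assoc)
    qed (simp add: exit_flux_supp[OF f])
  qed
  then show "(\<integral>y. y\<^sup>2 * exit_flux f y \<partial>lborel) \<le> d * first_moment (exit_flux f)"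
    by (simp add: first_moment_def)
qed

text \<open>Transport of a density concentrated on the positive half-line by the antisymmetrised
  kernel, compared with the dipole of matching first moment.\<close>

lemma odd_transport:
  fixes g :: "real \<Rightarrow> real"
  assumes [measurable]: "g \<in> borel_measurable borel" and g0: "\<And>y. 0 \<le> g y" and supp: "\<And>y. y < 0 \<Longrightarrow> g y = 0"
    and i1: "integrable lborel (\<lambda>y. y * g y)" and i2: "integrable lborel (\<lambda>y. y\<^sup>2 * g y)"
  shows "(\<And>y. 0 \<le> y \<Longrightarrow> \<bar>odd_kernel n x y\<bar> \<le> c * y) \<Longrightarrow>
      \<bar>\<integral>y. odd_kernel n x y * g y \<partial>lborel\<bar> \<le> c * first_moment g"
    and "(\<And>y. 0 \<le> y \<Longrightarrow> \<bar>odd_kernel n x y + 2 * y * D\<bar> \<le> y * a + b * y\<^sup>2) \<Longrightarrow>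
      \<bar>(\<integral>y. odd_kernel n x y * g y \<partial>lborel) + 2 * first_moment g * D\<bar> \<le> a * first_moment g + b * (\<integral>y. y\<^sup>2 * g y \<partial>lborel)"
proof -
  obtain C where C: "C > 0" "\<And>n x y. y \<ge> 0 \<Longrightarrow> \<bar>odd_kernel n x y\<bar> \<le> C * y / real (n + 1)"
    using odd_kernel_bound by blast
  have le: "\<bar>odd_kernel n x y * g y\<bar> \<le> c * (y * g y)" if "\<And>y. 0 \<le> y \<Longrightarrow> \<bar>odd_kernel n x y\<bar> \<le> c * y" for y c
  proof (cases "0 \<le> y")
    case True
    then show ?thesis using mult_right_mono[OF that[OF True] g0[of y]] g0[of y] by (simp add: abs_mult mult.assoc)
  qed (simp add: supp)
  have i: "integrable lborel (\<lambda>y. odd_kernel n x y * g y)"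
  proof (rule Bochner_Integration.integrable_bound[OF integrable_mult_right[OF i1, of "C / real (n + 1)"]])
    have "\<bar>odd_kernel n x y * g y\<bar> \<le> C / real (n + 1) * (y * g y)" for y
      by (rule le) (use C(2) in simp)
    then show "AE y in lborel. norm (odd_kernel n x y * g y) \<le> norm (C / real (n + 1) * (y * g y))"
      unfolding real_norm_def by (intro AE_I2) (rule order_trans[OF _ abs_ge_self])
  qed measurable
  show "\<bar>\<integral>y. odd_kernel n x y * g y \<partial>lborel\<bar> \<le> c * first_moment g"
    if "\<And>y. 0 \<le> y \<Longrightarrow> \<bar>odd_kernel n x y\<bar> \<le> c * y"
  proof -
    have "\<bar>\<integral>y. odd_kernel n x y * g y \<partial>lborel\<bar> \<le> (\<integral>y. \<bar>odd_kernel n x y * g y\<bar> \<partial>lborel)"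
      by (rule integral_abs_bound)
    also have "\<dots> \<le> (\<integral>y. c * (y * g y) \<partial>lborel)"
      by (intro integral_mono integrable_abs i integrable_mult_right i1 le that)
    finally show ?thesis by (simp add: first_moment_def)
  qed
  show "\<bar>(\<integral>y. odd_kernel n x y * g y \<partial>lborel) + 2 * first_moment g * D\<bar> \<le> a * first_moment g + b * (\<integral>y. y\<^sup>2 * g y \<partial>lborel)"
    if bd: "\<And>y. 0 \<le> y \<Longrightarrow> \<bar>odd_kernel n x y + 2 * y * D\<bar> \<le> y * a + b * y\<^sup>2"
  proof -
    have iD: "integrable lborel (\<lambda>y. (2 * D) * (y * g y))" by (intro integrable_mult_right i1)
    have "(\<integral>y. odd_kernel n x y * g y \<partial>lborel) + 2 * first_moment g * D =
      (\<integral>y. odd_kernel n x y * g y + (2 * D) * (y * g y) \<partial>lborel)"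
      unfolding Bochner_Integration.integral_add[OF i iD] by (simp add: first_moment_def)
    also have "\<bar>\<dots>\<bar> \<le> (\<integral>y. \<bar>odd_kernel n x y * g y + (2 * D) * (y * g y)\<bar> \<partial>lborel)"
      by (rule integral_abs_bound)
    also have "\<dots> \<le> (\<integral>y. a * (y * g y) + b * (y\<^sup>2 * g y) \<partial>lborel)"
    proof (rule integral_mono)
      show "integrable lborel (\<lambda>y. \<bar>odd_kernel n x y * g y + (2 * D) * (y * g y)\<bar>)"
        by (rule integrable_abs[OF Bochner_Integration.integrable_add[OF i iD]])
      show "integrable lborel (\<lambda>y. a * (y * g y) + b * (y\<^sup>2 * g y))"
        by (rule Bochner_Integration.integrable_add[OF integrable_mult_right[OF i1] integrable_mult_right[OF i2]])
      fix y
      show "\<bar>odd_kernel n x y * g y + (2 * D) * (y * g y)\<bar> \<le> a * (y * g y) + b * (y\<^sup>2 * g y)"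
      proof (cases "0 \<le> y")
        case True
        have "odd_kernel n x y * g y + (2 * D) * (y * g y) = (odd_kernel n x y + 2 * y * D) * g y"
          by (simp add: algebra_simps)
        then have "\<bar>odd_kernel n x y * g y + (2 * D) * (y * g y)\<bar> = \<bar>(odd_kernel n x y + 2 * y * D) * g y\<bar>"
          by (rule arg_cong)
        also have "\<dots> = \<bar>odd_kernel n x y + 2 * y * D\<bar> * g y"
          unfolding abs_mult using g0[of y] by simp
        also have "\<dots> \<le> (y * a + b * y\<^sup>2) * g y"
          by (rule mult_right_mono[OF bd[OF True] g0])
        finally show ?thesis by (simp add: algebra_simps)
      qed (simp add: supp)
    qed
    also have "\<dots> = a * first_moment g + b * (\<integral>y. y\<^sup>2 * g y \<partial>lborel)"
      unfolding Bochner_Integration.integral_add[OF integrable_mult_right[OF i1] integrable_mult_right[OF i2]]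
        integral_mult_right_zero first_moment_def ..
    finally show ?thesis .
  qed
qed

end

section \<open>The dipole limit for the killed walk\<close>

lemma sum_inverse_reversed: "(\<Sum>k<n. 1 / real (n - k)) = harm n"
proof -
  have "harm n = (\<Sum>k<n. 1 / real (Suc k))"
    by (simp add: harm_altdef divide_inverse)
  also have "\<dots> = (\<Sum>k<n. 1 / real (Suc (n - Suc k)))"
    by (rule sum.nat_diff_reindex[symmetric])
  also have "\<dots> = (\<Sum>k<n. 1 / real (n - k))"
    by (intro sum.cong) (auto simp: Suc_diff_Suc)
  finally show ?thesis ..
qed

lemma harm_over_sqrt: "(\<lambda>n. harm n / sqrt (real (n + 1))) \<longlonglongrightarrow> 0"
proof (rule Lim_null_comparison)
  have "norm (harm n / sqrt (real (n + 1))) \<le> (1 + ln (real n)) / sqrt (real (n + 1))" if "n \<ge> 1" for n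
  proof -
    have "harm n - ln (real n) \<le> harm 1 - ln (real 1)"
      using euler_mascheroni_sequence_decreasing[of 1 n] that by simp
    then have "harm n \<le> 1 + ln (real n)" by (simp add: harm_def)
    then show ?thesis using harm_nonneg[of n] by (simp add: divide_right_mono)
  qed
  then show "\<forall>\<^sub>F n in sequentially. norm (harm n / sqrt (real (n + 1))) \<le> (1 + ln (real n)) / sqrt (real (n + 1))"
    using eventually_sequentially by blast
  show "(\<lambda>n. (1 + ln (real n)) / sqrt (real (n + 1))) \<longlonglongrightarrow> 0"
    by real_asymp
qed

context dispersal_kernel
begin

text \<open>Exit fluxes of the first half of the time interval. Each single term tends to zero, and
  all terms are dominated by a multiple of the flux itself, which is summable in time.\<close>

lemma early_flux_sum:
  fixes \<mu> \<epsilon> :: "nat \<Rightarrow> real"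
  assumes \<mu>: "summable \<mu>" "\<And>k. 0 \<le> \<mu> k" and \<epsilon>: "\<epsilon> \<longlonglongrightarrow> 0" and c: "0 \<le> b" "0 \<le> c"
  shows "(\<lambda>n. \<Sum>k<n. if 2 * k < n then 2 * \<mu> k * (\<epsilon> (n - Suc k) + b / sqrt (real (n - k)) + c * real (k + 1) / real (n - k)) else 0) \<longlonglongrightarrow> 0"
proof -
  let ?a = "\<lambda>k n. if 2 * k < n then 2 * \<mu> k * (\<epsilon> (n - Suc k) + b / sqrt (real (n - k)) + c * real (k + 1) / real (n - k)) else 0"
  obtain E where E: "\<And>n. \<bar>\<epsilon> n\<bar> \<le> E"
    using convergent_imp_Bseq[OF convergentI[OF \<epsilon>]] unfolding Bseq_def by auto
  have lim: "?a k \<longlonglongrightarrow> 0" for k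
  proof (rule Lim_transform_eventually)
    have 1: "(\<lambda>n. \<epsilon> (n - Suc k)) \<longlonglongrightarrow> 0"
      by (rule filterlim_compose[OF \<epsilon>]) (rule filterlim_minus_const_nat_at_top)
    have 2: "(\<lambda>n. b / sqrt (real (n - k))) \<longlonglongrightarrow> 0"
    proof -
      have "(\<lambda>m. b / sqrt (real m)) \<longlonglongrightarrow> 0"
      proof -
        have "(\<lambda>m. 1 / sqrt (real m)) \<longlonglongrightarrow> 0" by real_asymp
        from tendsto_mult_right_zero[OF this, of b] show ?thesis by simp
      qed
      then show ?thesis
        by (rule filterlim_compose) (rule filterlim_minus_const_nat_at_top)
    qed
    have 3: "(\<lambda>n. c * real (k + 1) / real (n - k)) \<longlonglongrightarrow> 0"
    proof -
      have "(\<lambda>m. c * real (k + 1) / real m) \<longlonglongrightarrow> 0"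
        by (rule lim_const_over_n)
      then show ?thesis
        by (rule filterlim_compose) (rule filterlim_minus_const_nat_at_top)
    qed
    have "(\<lambda>n. 2 * \<mu> k * (\<epsilon> (n - Suc k) + b / sqrt (real (n - k)) + c * real (k + 1) / real (n - k))) \<longlonglongrightarrow> 2 * \<mu> k * (0 + 0 + 0)"
      by (intro tendsto_mult tendsto_add tendsto_const 1 2 3)
    then show "(\<lambda>n. 2 * \<mu> k * (\<epsilon> (n - Suc k) + b / sqrt (real (n - k)) + c * real (k + 1) / real (n - k))) \<longlonglongrightarrow> 0"
      by simp
    show "\<forall>\<^sub>F n in sequentially. 2 * \<mu> k * (\<epsilon> (n - Suc k) + b / sqrt (real (n - k)) + c * real (k + 1) / real (n - k)) = ?a k n"
      using eventually_gt_at_top[of "2 * k"] by eventually_elim simp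
  qed
  have bound: "norm (?a k n) \<le> \<mu> k * (2 * (E + b + c))" for k n
  proof (cases "2 * k < n")
    case True
    have "1 \<le> n - k" using True by simp
    then have "b / sqrt (real (n - k)) \<le> b / 1" using c by (intro divide_left_mono) auto
    moreover have "\<bar>\<epsilon> (n - Suc k)\<bar> \<le> E" by (rule E)
    moreover have "c * real (k + 1) / real (n - k) \<le> c"
    proof -
      have "real (k + 1) \<le> real (n - k)" using True by simp
      then have "c * real (k + 1) \<le> c * real (n - k)" using c(2) by (rule mult_left_mono)
      then show ?thesis using True by (simp add: pos_divide_le_eq)
    qed
    moreover have "0 \<le> b / sqrt (real (n - k))" "0 \<le> c * real (k + 1) / real (n - k)" using c by auto
    ultimately have bounds: "\<bar>\<epsilon> (n - Suc k)\<bar> \<le> E" "0 \<le> b / sqrt (real (n - k))" "b / sqrt (real (n - k)) \<le> b / 1"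
      "0 \<le> c * real (k + 1) / real (n - k)" "c * real (k + 1) / real (n - k) \<le> c"
      by auto
    have "\<bar>\<epsilon> (n - Suc k) + b / sqrt (real (n - k)) + c * real (k + 1) / real (n - k)\<bar> \<le> E + b + c"
    proof -
      have *: "\<bar>u + v + w\<bar> \<le> E + b + c" if "\<bar>u\<bar> \<le> E" "0 \<le> v" "v \<le> b / 1" "0 \<le> w" "w \<le> c" for u v w
        using that by (simp add: abs_le_iff)
      show ?thesis by (rule *) (rule bounds)+
    qed
    moreover define X where "X = \<epsilon> (n - Suc k) + b / sqrt (real (n - k)) + c * real (k + 1) / real (n - k)"
    ultimately have "2 * \<mu> k * \<bar>X\<bar> \<le> 2 * \<mu> k * (E + b + c)"
      using \<mu>(2) by (intro mult_left_mono) auto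
    moreover have "?a k n = 2 * \<mu> k * X" using True by (simp only: X_def if_True)
    ultimately show ?thesis using \<mu>(2)[of k] by (simp add: abs_mult mult_ac)
  next
    case False
    have "0 \<le> E" using E[of 0] by simp
    then show ?thesis using False \<mu>(2)[of k] c by simp
  qed
  have "(\<lambda>n. \<Sum>k. ?a k n) \<longlonglongrightarrow> (\<Sum>k. 0)"
    using tannerys_theorem[of "\<lambda>k n. ?a k n" "\<lambda>_. 0" sequentially "\<lambda>k. \<mu> k * (2 * (E + b + c))"]
      lim bound summable_mult2[OF \<mu>(1)] by (simp add: always_eventually split_beta)
  moreover have "(\<Sum>k. ?a k n) = (\<Sum>k<n. ?a k n)" for n
    by (rule suminf_finite) auto
  ultimately show ?thesis by simp
qed

text \<open>Exit fluxes of the second half have had little time to spread: the kernel is only of order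
  \<open>1 / (n - k)\<close>, whose sum is logarithmic. The decay of the fluxes themselves, \<open>n\<close> to the power
  \<open>-3/2\<close> against the required \<open>1 / n\<close>, leaves a factor \<open>1 / sqrt n\<close> to absorb the logarithm.\<close>

lemma late_flux_sum:
  fixes \<mu> :: "nat \<Rightarrow> real"
  assumes \<mu>: "\<And>k. \<mu> k \<le> b / sqrt (real (k + 1)) ^ 3" and b: "0 \<le> b" and c: "0 \<le> c"
    and \<mu>0: "\<And>k. 0 \<le> \<mu> k"
  shows "(\<lambda>n. \<Sum>k<n. if 2 * k < n then 0 else real (n + 1) * (c * \<mu> k / real (n - k))) \<longlonglongrightarrow> 0"
proof (rule Lim_null_comparison)
  have "norm (\<Sum>k<n. if 2 * k < n then 0 else real (n + 1) * (c * \<mu> k / real (n - k))) \<le> (c * b * sqrt 2 ^ 3) * (harm n / sqrt (real (n + 1)))" for n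
  proof -
    let ?N = "real (n + 1)"
    let ?f = "\<lambda>k. if 2 * k < n then 0 else ?N * (c * \<mu> k / real (n - k))"
    have "0 \<le> ?f k" for k using \<mu>0[of k] c by simp
    then have "norm (\<Sum>k<n. ?f k) = (\<Sum>k<n. ?f k)"
      by (simp add: sum_nonneg)
    also have "\<dots> \<le> (\<Sum>k<n. (c * b * sqrt 2 ^ 3 / sqrt ?N) * (1 / real (n - k)))"
    proof (rule sum_mono)
      fix k assume "k \<in> {..<n}"
      then have k: "k < n" by simp
      show "?f k \<le> (c * b * sqrt 2 ^ 3 / sqrt ?N) * (1 / real (n - k))"
      proof (cases "2 * k < n")
        case True
        then show ?thesis using b c by simp
      next
        case False
        have "sqrt ?N \<le> sqrt (2 * real (k + 1))" using False by (intro real_sqrt_le_mono) simp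
        then have le: "sqrt ?N ^ 3 \<le> sqrt 2 ^ 3 * sqrt (real (k + 1)) ^ 3"
          unfolding power_mult_distrib[symmetric] real_sqrt_mult[symmetric] by (intro power_mono) auto
        have "\<mu> k \<le> b / sqrt (real (k + 1)) ^ 3" by (rule \<mu>)
        also have "\<dots> \<le> b * sqrt 2 ^ 3 / sqrt ?N ^ 3"
          using mult_left_mono[OF le b] by (simp add: divide_le_eq le_divide_eq mult_ac)
        finally have "?N * (c * \<mu> k / real (n - k)) \<le> ?N * (c * (b * sqrt 2 ^ 3 / sqrt ?N ^ 3) / real (n - k))"
          using c by (intro mult_left_mono divide_right_mono) auto
        also have "\<dots> = (?N / sqrt ?N ^ 3) * (c * b * sqrt 2 ^ 3) * (1 / real (n - k))"
          by simp
        also have "?N / sqrt ?N ^ 3 = 1 / sqrt ?N"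
        proof -
          have "sqrt ?N ^ 3 = ?N * sqrt ?N" by (simp add: power3_eq_cube)
          then show ?thesis by simp
        qed
        finally show ?thesis using False by simp
      qed
    qed
    also have "\<dots> = (c * b * sqrt 2 ^ 3 / sqrt ?N) * harm n"
      unfolding sum_distrib_left[symmetric] sum_inverse_reversed ..
    finally show ?thesis by simp
  qed
  then show "\<forall>\<^sub>F n in sequentially. norm (\<Sum>k<n. if 2 * k < n then 0 else real (n + 1) * (c * \<mu> k / real (n - k))) \<le> (c * b * sqrt 2 ^ 3) * (harm n / sqrt (real (n + 1)))"
    by (intro always_eventually) blast
  show "(\<lambda>n. (c * b * sqrt 2 ^ 3) * (harm n / sqrt (real (n + 1)))) \<longlonglongrightarrow> 0"
    by (rule tendsto_mult_right_zero[OF harm_over_sqrt])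
qed

lemma inverse_sqrt_cube_summable: "summable (\<lambda>k. 1 / sqrt (real (k + 1)) ^ 3)"
proof -
  have "summable (\<lambda>k. real k powr (- 3 / 2))"
    by (subst summable_real_powr_iff) simp
  then have "summable (\<lambda>k. real (Suc k) powr (- 3 / 2))"
    by (subst summable_Suc_iff)
  moreover have "real (Suc k) powr (- 3 / 2) = 1 / sqrt (real (k + 1)) ^ 3" for k
  proof -
    have "real (Suc k) powr (3 / 2) = (real (Suc k) powr (1 / 2)) ^ 3"
      by (subst powr_power) auto
    also have "\<dots> = sqrt (real (k + 1)) ^ 3" by (simp add: powr_half_sqrt)
    finally show ?thesis by (simp add: powr_minus_divide)
  qed
  ultimately show ?thesis by simp
qed

text \<open>The coefficient \<open>M\<close> is the first moment of \<open>f\<close> plus the sum of the first moments \<open>\<mu> k\<close> of all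
  exit fluxes. By \<open>killed_power_reflection\<close> each of these moments sits in front of a dipole, with
  the time that is left after the exit; the errors are collected in \<open>\<eta>\<close>. The restriction
  \<open>n \<ge> 2\<close> ensures that fluxes of the first half are still transported by the kernel of at least
  two jumps, to which the local limit applies.\<close>

theorem killed_walk_dipole_limit:
  assumes f: "walk_density f" and f2: "integrable lborel (\<lambda>x. x\<^sup>2 * f x)"
    and M: "(\<lambda>n. first_moment ((killed ^^ n) f)) \<longlonglongrightarrow> M"
  shows "\<exists>\<eta>. \<eta> \<longlonglongrightarrow> 0 \<and> (\<forall>n\<ge>2. \<forall>x>0.
     real (n + 1) * \<bar>(killed ^^ Suc n) f x + 2 * M * dipole x (diffusivity * real (n + 1))\<bar> \<le> \<eta> n)"
proof -
  let ?q = diffusivity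
  have q: "0 < ?q" by (rule diffusivity_pos)
  note F = killed_power_density[OF f]
  define \<mu> where "\<mu> k = first_moment (exit_flux ((killed ^^ k) f))" for k
  obtain \<epsilon> b where \<epsilon>: "\<epsilon> \<longlonglongrightarrow> 0" "\<And>n. 0 \<le> \<epsilon> n" and b: "0 < b" and local0:
    "\<And>n x y. 1 \<le> n \<Longrightarrow> 0 \<le> y \<Longrightarrow> \<bar>odd_kernel n x y + 2 * y * dipole x (?q * real (n + 1))\<bar> \<le>
       y * \<epsilon> n / real (n + 1) + b * y\<^sup>2 / sqrt (real (n + 1)) ^ 3"
    using odd_kernel_local_limit by blast
  have local: "\<bar>odd_kernel n x y + 2 * y * dipole x (?q * real (n + 1))\<bar> \<le>
       y * (\<epsilon> n / real (n + 1)) + b / sqrt (real (n + 1)) ^ 3 * y\<^sup>2" if "1 \<le> n" "0 \<le> y" for n x y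
    unfolding times_divide_eq_right times_divide_eq_left by (rule local0[OF that])
  obtain a where a: "0 < a" "\<And>n x y. 0 \<le> y \<Longrightarrow> \<bar>odd_kernel n x y\<bar> \<le> a * y / real (n + 1)"
    using odd_kernel_bound by blast
  obtain B where B: "0 < B" "\<And>k y. exit_flux ((killed ^^ k) f) y \<le> B / sqrt (real (k + 1)) ^ 3"
    using exit_flux_decay[OF f] by blast
  define g where "g = gauss_moment 1 / ?q"
  define g3 where "g3 = 2 * gauss_moment 3 / ?q"
  have g: "0 \<le> g" "0 \<le> g3" using gauss_moment_nonneg q by (auto simp: g_def g3_def)
  have dip: "\<bar>dipole x (?q * real n)\<bar> \<le> g / real n" if "1 \<le> n" for n x
    using dipole_bound[of "?q * real n" x] q that by (simp add: g_def)
  have \<mu>0: "0 \<le> \<mu> k" and \<mu>le: "\<mu> k \<le> (d\<^sup>2 * B) / sqrt (real (k + 1)) ^ 3" for k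
    using exit_flux_moments(1,2)[OF F B(2)] by (simp_all add: \<mu>_def)
  have \<mu>sum: "summable \<mu>"
    using \<mu>0 \<mu>le by (intro summable_comparison_test[OF _ summable_mult[OF inverse_sqrt_cube_summable, of "d\<^sup>2 * B"]]) auto
  have moment: "first_moment ((killed ^^ n) f) = first_moment f + (\<Sum>k<n. \<mu> k)" for n
    by (induction n) (simp_all add: first_moment_killed[OF F] \<mu>_def)
  define \<eta> where "\<eta> n = \<epsilon> n * first_moment f + b * (\<integral>y. y\<^sup>2 * f y \<partial>lborel) / sqrt (real (n + 1))
     + (\<Sum>k<n. if 2 * k < n then 2 * \<mu> k * (\<epsilon> (n - Suc k) + (b * d) / sqrt (real (n - k)) + g3 * real (k + 1) / real (n - k)) else 0)
     + (\<Sum>k<n. if 2 * k < n then 0 else real (n + 1) * ((a + 2 * g) * \<mu> k / real (n - k)))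
     + B / sqrt (real (n + 1)) + 2 * g * \<bar>M - first_moment ((killed ^^ n) f)\<bar>" for n
  have "\<eta> \<longlonglongrightarrow> 0"
  proof -
    have s: "(\<lambda>n. c / sqrt (real (n + 1))) \<longlonglongrightarrow> 0" for c
    proof -
      have "(\<lambda>n. 1 / sqrt (real (n + 1))) \<longlonglongrightarrow> 0" by real_asymp
      from tendsto_mult_right_zero[OF this, of c] show ?thesis by simp
    qed
    have M0: "(\<lambda>n. \<bar>M - first_moment ((killed ^^ n) f)\<bar>) \<longlonglongrightarrow> 0"
      using tendsto_rabs[OF tendsto_diff[OF tendsto_const[of M] M]] by simp
    have "\<eta> \<longlonglongrightarrow> 0 + 0 + 0 + 0 + 0 + 0"
      unfolding \<eta>_def[abs_def]
      using b d_pos g a B by (intro tendsto_add s tendsto_mult_left_zero[OF \<epsilon>(1)] tendsto_mult_right_zero[OF M0]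
          early_flux_sum[OF \<mu>sum \<mu>0 \<epsilon>(1)] late_flux_sum[OF \<mu>le _ _ \<mu>0]) auto
    then show ?thesis by simp
  qed
  moreover have "real (n + 1) * \<bar>(killed ^^ Suc n) f x + 2 * M * dipole x (?q * real (n + 1))\<bar> \<le> \<eta> n"
    if n: "2 \<le> n" and x: "0 < x" for n x
  proof -
    have n1: "1 \<le> n" using n by simp
    let ?N = "real (n + 1)"
    let ?D = "dipole x (?q * ?N)"
    let ?f2 = "\<integral>y. y\<^sup>2 * f y \<partial>lborel"
    let ?T = "\<lambda>k. \<integral>y. odd_kernel (n - Suc k) x y * exit_flux ((killed ^^ k) f) y \<partial>lborel"
    let ?E = "\<lambda>k. if 2 * k < n then 2 * \<mu> k * (\<epsilon> (n - Suc k) + (b * d) / sqrt (real (n - k)) + g3 * real (k + 1) / real (n - k)) else 0"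
    let ?L = "\<lambda>k. if 2 * k < n then 0 else ?N * ((a + 2 * g) * \<mu> k / real (n - k))"
    have N3: "sqrt ?N ^ 3 = ?N * sqrt ?N" by (simp add: power3_eq_cube)
    have Dg: "\<bar>?D\<bar> \<le> g / ?N" using dip[of "n + 1" x] by simp
    have t1: "?N * \<bar>(\<integral>y. odd_kernel n x y * f y \<partial>lborel) + 2 * first_moment f * ?D\<bar>
        \<le> \<epsilon> n * first_moment f + b * ?f2 / sqrt ?N"
    proof -
      have "\<bar>(\<integral>y. odd_kernel n x y * f y \<partial>lborel) + 2 * first_moment f * ?D\<bar>
          \<le> \<epsilon> n / ?N * first_moment f + b / sqrt ?N ^ 3 * ?f2"
        using local[OF n1] by (intro odd_transport(2) walk_densityD[OF f] walk_density_integrable[OF f] f2) simp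
      then have "?N * \<bar>(\<integral>y. odd_kernel n x y * f y \<partial>lborel) + 2 * first_moment f * ?D\<bar>
          \<le> ?N * (\<epsilon> n / ?N * first_moment f + b / sqrt ?N ^ 3 * ?f2)"
        by (rule mult_left_mono) simp
      also have "\<dots> = \<epsilon> n * first_moment f + b * ?f2 / sqrt ?N"
        unfolding N3 by (simp add: distrib_left del: of_nat_add of_nat_Suc)
      finally show ?thesis .
    qed
    have t2: "?N * \<bar>?T k + 2 * \<mu> k * ?D\<bar> \<le> ?E k + ?L k" if k: "k < n" for k
    proof -
      let ?m = "real (n - k)"
      have m: "1 \<le> ?m" "real (n - Suc k + 1) = ?m" "?m \<le> ?N" using k by auto
      note fl = exit_flux_measurable[OF walk_densityD(1)[OF F[of k]]] exit_flux_nonneg[OF F[of k]]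
        exit_flux_integrable[OF F[of k]]
      have supp: "exit_flux ((killed ^^ k) f) y = 0" if "y < 0" for y
        using that by (simp add: exit_flux_def)
      show ?thesis
      proof (cases "2 * k < n")
        case True
        \<comment> \<open>The local limit produces the dipole at the shorter time \<open>n - k\<close>, which is then moved to \<open>n + 1\<close>.\<close>
        have nk: "1 \<le> n - Suc k" using True n by (cases k) auto
        have dd: "\<bar>?D - dipole x (?q * ?m)\<bar> \<le> gauss_moment 3 * (?q * real (k + 1)) / (?q * ?m)\<^sup>2"
        proof -
          have "\<bar>?q * ?N - ?q * ?m\<bar> = ?q * real (k + 1)"
            using q k by (simp add: of_nat_diff flip: right_diff_distrib)
          moreover have "?q * ?m \<le> ?q * ?N" using m q by simp
          ultimately show ?thesis
            using dipole_time_lipschitz[of "?q * ?m" "?q * ?N" "?q * ?m" x] q m(1) by simp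
        qed
        have "\<bar>?T k + 2 * first_moment (exit_flux ((killed ^^ k) f)) * dipole x (?q * ?m)\<bar>
            \<le> \<epsilon> (n - Suc k) / ?m * first_moment (exit_flux ((killed ^^ k) f))
              + b / sqrt ?m ^ 3 * (\<integral>y. y\<^sup>2 * exit_flux ((killed ^^ k) f) y \<partial>lborel)"
          using local[OF nk] unfolding m(2) by (intro odd_transport(2) fl supp) simp
        also have "\<dots> \<le> \<epsilon> (n - Suc k) / ?m * \<mu> k + b / sqrt ?m ^ 3 * (d * \<mu> k)"
          unfolding \<mu>_def using exit_flux_moments(3)[OF F B(2)] b by (intro add_left_mono mult_left_mono) auto
        finally have e1: "\<bar>?T k + 2 * \<mu> k * dipole x (?q * ?m)\<bar> \<le> \<mu> k * (\<epsilon> (n - Suc k) / ?m + b * d / sqrt ?m ^ 3)"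
          by (simp add: \<mu>_def algebra_simps)
        have e2: "\<bar>2 * \<mu> k * (?D - dipole x (?q * ?m))\<bar> \<le> \<mu> k * (g3 * real (k + 1) / ?m\<^sup>2)"
        proof -
          have "\<bar>2 * \<mu> k * (?D - dipole x (?q * ?m))\<bar> \<le> 2 * \<mu> k * (gauss_moment 3 * (?q * real (k + 1)) / (?q * ?m)\<^sup>2)"
            unfolding abs_mult using dd \<mu>0[of k] by (intro mult_mono) auto
          also have "\<dots> = \<mu> k * (g3 * real (k + 1) / ?m\<^sup>2)"
          proof -
            have "2 * u * (v * (?q * w) / (?q * z)\<^sup>2) = u * (2 * v / ?q * w / z\<^sup>2)" for u v w z
              using q by (cases "z = 0") (auto simp: power2_eq_square field_simps)
            then show ?thesis unfolding g3_def .
          qed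
          finally show ?thesis .
        qed
        have "?T k + 2 * \<mu> k * ?D = (?T k + 2 * \<mu> k * dipole x (?q * ?m)) + 2 * \<mu> k * (?D - dipole x (?q * ?m))"
          by (simp add: right_diff_distrib)
        then have "\<bar>?T k + 2 * \<mu> k * ?D\<bar> \<le> \<mu> k * (\<epsilon> (n - Suc k) / ?m + b * d / sqrt ?m ^ 3)
            + \<mu> k * (g3 * real (k + 1) / ?m\<^sup>2)"
          by (simp only: order_trans[OF abs_triangle_ineq add_mono[OF e1 e2]])
        also have "\<dots> = \<mu> k * (\<epsilon> (n - Suc k) + (b * d) / sqrt ?m + g3 * real (k + 1) / ?m) / ?m"
        proof -
          have "sqrt ?m ^ 3 = ?m * sqrt ?m" by (simp add: power3_eq_cube)
          then show ?thesis by (simp add: power2_eq_square add_divide_distrib distrib_left)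
        qed
        finally have "?N * \<bar>?T k + 2 * \<mu> k * ?D\<bar> \<le>
            ?N * (\<mu> k * (\<epsilon> (n - Suc k) + (b * d) / sqrt ?m + g3 * real (k + 1) / ?m) / ?m)"
          by (rule mult_left_mono) simp
        also have "\<dots> = (?N / ?m) * (\<mu> k * (\<epsilon> (n - Suc k) + (b * d) / sqrt ?m + g3 * real (k + 1) / ?m))"
          by simp
        also have "\<dots> \<le> 2 * (\<mu> k * (\<epsilon> (n - Suc k) + (b * d) / sqrt ?m + g3 * real (k + 1) / ?m))"
        proof (rule mult_right_mono)
          have "n + 1 \<le> 2 * (n - k)" using True by simp
          then have "?N \<le> real (2 * (n - k))" by (rule of_nat_mono)
          then have "?N \<le> 2 * ?m" by (simp only: of_nat_mult of_nat_numeral)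
          then show "?N / ?m \<le> 2" using m(1) by (simp add: pos_divide_le_eq)
          show "0 \<le> \<mu> k * (\<epsilon> (n - Suc k) + (b * d) / sqrt ?m + g3 * real (k + 1) / ?m)"
            using \<mu>0 \<epsilon>(2) b d_pos g by (intro mult_nonneg_nonneg add_nonneg_nonneg divide_nonneg_nonneg) auto
        qed
        also have "\<dots> = ?E k + ?L k" using True by simp
        finally show ?thesis .
      next
        case False
        have "\<bar>?T k\<bar> \<le> a / ?m * \<mu> k"
        proof -
          have "\<bar>odd_kernel (n - Suc k) x y\<bar> \<le> a / ?m * y" if "0 \<le> y" for y
            using a(2)[OF that, of "n - Suc k" x] unfolding m(2) times_divide_eq_left .
          then show ?thesis
            unfolding \<mu>_def by (intro odd_transport(1) fl supp)
        qed
        moreover have "\<bar>2 * \<mu> k * ?D\<bar> \<le> 2 * \<mu> k * (g / ?m)"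
          unfolding abs_mult
        proof (intro mult_mono)
          show "\<bar>?D\<bar> \<le> g / ?m"
            using Dg divide_left_mono[OF m(3) g(1)] m(1) by fastforce
        qed (use \<mu>0[of k] in auto)
        ultimately have "\<bar>?T k + 2 * \<mu> k * ?D\<bar> \<le> a / ?m * \<mu> k + 2 * \<mu> k * (g / ?m)"
          by (rule order_trans[OF abs_triangle_ineq add_mono])
        also have "\<dots> = (a + 2 * g) * \<mu> k / ?m" by (simp add: algebra_simps add_divide_distrib)
        finally have "?N * \<bar>?T k + 2 * \<mu> k * ?D\<bar> \<le> ?N * ((a + 2 * g) * \<mu> k / ?m)"
          by (rule mult_left_mono) simp
        then show ?thesis using False by simp
      qed
    qed
    have t3: "?N * \<bar>exit_flux ((killed ^^ n) f) x\<bar> \<le> B / sqrt ?N"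
    proof -
      have "?N * \<bar>exit_flux ((killed ^^ n) f) x\<bar> \<le> ?N * (B / sqrt ?N ^ 3)"
        using B(2)[of n x] exit_flux_nonneg[OF F[of n], of x] by (intro mult_left_mono) auto
      also have "\<dots> = B / sqrt ?N" unfolding N3 by simp
      finally show ?thesis .
    qed
    have t4: "?N * \<bar>2 * (M - first_moment ((killed ^^ n) f)) * ?D\<bar> \<le> 2 * g * \<bar>M - first_moment ((killed ^^ n) f)\<bar>"
    proof -
      have "?N * \<bar>2 * (M - first_moment ((killed ^^ n) f)) * ?D\<bar> = 2 * \<bar>M - first_moment ((killed ^^ n) f)\<bar> * (?N * \<bar>?D\<bar>)"
        by (simp only: abs_mult abs_numeral mult_ac)
      also have "\<dots> \<le> 2 * \<bar>M - first_moment ((killed ^^ n) f)\<bar> * g"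
        using Dg by (intro mult_left_mono) (auto simp: pos_le_divide_eq mult.commute)
      finally show ?thesis by (simp add: mult_ac)
    qed
    have split: "(killed ^^ Suc n) f x + 2 * M * ?D =
        ((\<integral>y. odd_kernel n x y * f y \<partial>lborel) + 2 * first_moment f * ?D) + (\<Sum>k<n. ?T k + 2 * \<mu> k * ?D)
        + exit_flux ((killed ^^ n) f) x + 2 * (M - first_moment ((killed ^^ n) f)) * ?D"
      unfolding killed_power_reflection[OF f x] moment
      by (simp add: sum.distrib algebra_simps sum_distrib_left sum_distrib_right)
    have "?N * \<bar>(killed ^^ Suc n) f x + 2 * M * ?D\<bar> \<le> ?N * \<bar>(\<integral>y. odd_kernel n x y * f y \<partial>lborel) + 2 * first_moment f * ?D\<bar>
        + (\<Sum>k<n. ?N * \<bar>?T k + 2 * \<mu> k * ?D\<bar>)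
        + ?N * \<bar>exit_flux ((killed ^^ n) f) x\<bar> + ?N * \<bar>2 * (M - first_moment ((killed ^^ n) f)) * ?D\<bar>"
    proof -
      have tri: "N * \<bar>u + (\<Sum>k<n. v k) + w + z\<bar> \<le> N * \<bar>u\<bar> + (\<Sum>k<n. N * \<bar>v k\<bar>) + N * \<bar>w\<bar> + N * \<bar>z\<bar>"
        if "0 \<le> N" for N u w z :: real and v :: "nat \<Rightarrow> real"
      proof -
        have "\<bar>u + (\<Sum>k<n. v k) + w + z\<bar> \<le> \<bar>u\<bar> + (\<Sum>k<n. \<bar>v k\<bar>) + \<bar>w\<bar> + \<bar>z\<bar>"
          using sum_abs[of v "{..<n}"] by linarith
        from mult_left_mono[OF this that] show ?thesis
          by (simp add: distrib_left sum_distrib_left)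
      qed
      show ?thesis unfolding split by (rule tri) simp
    qed
    also have "\<dots> \<le> (\<epsilon> n * first_moment f + b * ?f2 / sqrt ?N) + (\<Sum>k<n. ?E k + ?L k)
        + B / sqrt ?N + 2 * g * \<bar>M - first_moment ((killed ^^ n) f)\<bar>"
    proof -
      have "(\<Sum>k<n. ?N * \<bar>?T k + 2 * \<mu> k * ?D\<bar>) \<le> (\<Sum>k<n. ?E k + ?L k)"
      proof (rule sum_mono)
        fix k assume "k \<in> {..<n}"
        then show "?N * \<bar>?T k + 2 * \<mu> k * ?D\<bar> \<le> ?E k + ?L k" by (intro t2) simp
      qed
      from add_mono[OF add_mono[OF add_mono[OF t1 this] t3] t4] show ?thesis .
    qed
    also have "\<dots> = \<eta> n"
      unfolding \<eta>_def sum.distrib by (simp only: add.assoc)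
    finally show ?thesis .
  qed
  ultimately show ?thesis by blast
qed

end

section \<open>From the number of jumps to continuous time\<close>

lemma exponential_series_sums: "(\<lambda>n. t ^ n / fact n) sums exp t" for t :: real
  using exp_converges[of t] by (simp add: field_simps)

lemma poisson_mean_sums: "(\<lambda>n. t ^ n / fact n * real n) sums (t * exp t)"
proof -
  have "(\<lambda>n. t * (t ^ n / fact n)) sums (t * exp t)"
    by (rule sums_mult[OF exponential_series_sums])
  moreover have "t * (t ^ n / fact n) = t ^ Suc n / fact (Suc n) * real (Suc n)" for n
    by (simp add: fact_Suc del: of_nat_Suc)
  ultimately have "(\<lambda>n. t ^ Suc n / fact (Suc n) * real (Suc n)) sums (t * exp t)"
    by simp
  from sums_Suc[OF this] show ?thesis by simp
qed

lemma poisson_variance_sums: "(\<lambda>n. t ^ n / fact n * (real n - t)\<^sup>2) sums (t * exp t)"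
proof -
  have "(\<lambda>n. t * (t ^ n / fact n * real n)) sums (t * (t * exp t))"
    by (rule sums_mult[OF poisson_mean_sums])
  moreover have "t * (t ^ n / fact n * real n) = t ^ Suc n / fact (Suc n) * (real (Suc n) * real n)" for n
    by (simp add: fact_Suc del: of_nat_Suc)
  ultimately have "(\<lambda>n. t ^ Suc n / fact (Suc n) * (real (Suc n) * (real (Suc n) - 1))) sums (t * (t * exp t))"
    by simp
  from sums_Suc[OF this] have 2: "(\<lambda>n. t ^ n / fact n * (real n * (real n - 1))) sums (t * (t * exp t))"
    by simp
  have "(\<lambda>n. t ^ n / fact n * (real n * (real n - 1)) + (1 - 2 * t) * (t ^ n / fact n * real n) + t\<^sup>2 * (t ^ n / fact n))
      sums (t * (t * exp t) + (1 - 2 * t) * (t * exp t) + t\<^sup>2 * exp t)"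
    by (intro sums_add sums_mult 2 poisson_mean_sums exponential_series_sums)
  moreover have "t ^ n / fact n * (real n * (real n - 1)) + (1 - 2 * t) * (t ^ n / fact n * real n) + t\<^sup>2 * (t ^ n / fact n)
      = t ^ n / fact n * (real n - t)\<^sup>2" for n
  proof -
    have "p * (m * (m - 1)) + (1 - 2 * t) * (p * m) + t\<^sup>2 * p = p * (m - t)\<^sup>2" for p m :: real
      by (simp add: power2_eq_square algebra_simps)
    then show ?thesis .
  qed
  moreover have "t * (t * exp t) + (1 - 2 * t) * (t * exp t) + t\<^sup>2 * exp t = t * exp t"
    by (simp add: algebra_simps power2_eq_square)
  ultimately show ?thesis by simp
qed

text \<open>The geometric term in the majorant controls indices far below \<open>t\<close>: its Poisson average is
  exponentially small.\<close>

lemma poisson_average_bound: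
  fixes r :: "nat \<Rightarrow> real"
  assumes t: "0 \<le> t" and r: "\<And>n. \<bar>r n\<bar> \<le> a + b * (real n - t)\<^sup>2 + c * (1 / 2) ^ n"
  shows "summable (\<lambda>n. t ^ n / fact n * r n)"
    and "\<bar>exp (- t) * (\<Sum>n. t ^ n / fact n * r n)\<bar> \<le> a + b * t + c * exp (- t / 2)"
proof -
  let ?p = "\<lambda>n. t ^ n / fact n"
  let ?m = "\<lambda>n. a * ?p n + b * (?p n * (real n - t)\<^sup>2) + c * ((t / 2) ^ n / fact n)"
  have m: "?m sums (a * exp t + b * (t * exp t) + c * exp (t / 2))"
    by (intro sums_add sums_mult poisson_variance_sums exponential_series_sums)
  have le: "norm (?p n * r n) \<le> ?m n" for n
  proof -
    have "norm (?p n * r n) = ?p n * \<bar>r n\<bar>" using t by (simp add: abs_mult)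
    also have "\<dots> \<le> ?p n * (a + b * (real n - t)\<^sup>2 + c * (1 / 2) ^ n)"
      using t by (intro mult_left_mono r) simp
    also have "\<dots> = ?m n" by (simp add: algebra_simps power_divide)
    finally show ?thesis .
  qed
  have s: "summable (\<lambda>n. norm (?p n * r n))"
    by (rule summable_comparison_test[OF _ sums_summable[OF m]]) (use le in auto)
  then show "summable (\<lambda>n. ?p n * r n)" by (rule summable_norm_cancel)
  have "\<bar>\<Sum>n. ?p n * r n\<bar> \<le> (\<Sum>n. norm (?p n * r n))"
    using summable_norm[OF s] by simp
  also have "\<dots> \<le> (\<Sum>n. ?m n)"
    by (rule suminf_le[OF le s sums_summable[OF m]])
  also have "\<dots> = a * exp t + b * (t * exp t) + c * exp (t / 2)"
    by (rule sums_unique[OF m, symmetric])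
  finally have "exp (- t) * \<bar>\<Sum>n. ?p n * r n\<bar> \<le> exp (- t) * (a * exp t + b * (t * exp t) + c * exp (t / 2))"
    by (rule mult_left_mono) simp
  also have "\<dots> = a + b * t + c * exp (- t / 2)"
  proof -
    have e: "exp (- t) * exp t = 1" "exp (- t) * exp (t / 2) = exp (- t / 2)"
      by (simp_all flip: exp_add)
    have "u * (a * v + b * (t * v) + c * w) = a * (u * v) + b * t * (u * v) + c * (u * w)" for u v w :: real
      by (simp add: algebra_simps)
    then show ?thesis by (simp only: e mult_1_right)
  qed
  finally show "\<bar>exp (- t) * (\<Sum>n. ?p n * r n)\<bar> \<le> a + b * t + c * exp (- t / 2)"
    by (simp add: abs_mult)
qed

context dispersal_kernel
begin

text \<open>The density at time \<open>t\<close> of the killed walk whose jumps occur at the times of a Poisson process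
  of rate one.\<close>

definition poissonized :: "(real \<Rightarrow> real) \<Rightarrow> real \<Rightarrow> real \<Rightarrow> real" where
  "poissonized f x t = exp (- t) * (\<Sum>n. t ^ n / fact n * (killed ^^ n) f x)"

text \<open>In continuous time the number of jumps before \<open>t\<close> is Poisson with mean and variance
  \<open>t\<close>. Since the dipole is Lipschitz in time with constant of order \<open>1 / t\<^sup>2\<close>, fluctuations of
  order \<open>sqrt t\<close> are negligible against \<open>1 / t\<close>.\<close>

theorem poissonized_dipole_limit:
  assumes f: "walk_density f" and f2: "integrable lborel (\<lambda>x. x\<^sup>2 * f x)"
    and M: "(\<lambda>n. first_moment ((killed ^^ n) f)) \<longlonglongrightarrow> M" and \<delta>: "0 < \<delta>"
  shows "\<exists>T>0. \<forall>t\<ge>T. \<forall>x>0. t * \<bar>poissonized f x t + 2 * M * dipole x (diffusivity * t)\<bar> \<le> \<delta>"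
proof -
  let ?q = diffusivity
  have q: "0 < ?q" by (rule diffusivity_pos)
  obtain \<eta> where \<eta>: "\<eta> \<longlonglongrightarrow> 0" and lim: "\<And>n x. 2 \<le> n \<Longrightarrow> 0 < x \<Longrightarrow>
     real (n + 1) * \<bar>(killed ^^ Suc n) f x + 2 * M * dipole x (?q * real (n + 1))\<bar> \<le> \<eta> n"
    using killed_walk_dipole_limit[OF f f2 M] by blast
  obtain B where B: "0 < B" "\<And>x. f x \<le> B" using walk_densityD(4)[OF f] by blast
  define L where "L = 2 * \<bar>M\<bar> * (4 * gauss_moment 3 / ?q)"
  define B' where "B' = B + 2 * \<bar>M\<bar> * (gauss_moment 1 / ?q)"
  have L: "0 \<le> L" using gauss_moment_nonneg[of 3] q by (simp add: L_def)
  have B': "0 \<le> B'" using gauss_moment_nonneg[of 1] q B by (simp add: B'_def)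
  define c0 :: real where "c0 = (1 - ln 2) / 2"
  have c0: "0 < c0" using ln_2_less_1 by (simp add: c0_def)
  have "eventually (\<lambda>n. \<bar>\<eta> n\<bar> < \<delta> / 4) sequentially"
    using order_tendstoD(2)[OF tendsto_rabs_zero[OF \<eta>], of "\<delta> / 4"] \<delta> by simp
  then obtain N where N: "\<And>n. N \<le> n \<Longrightarrow> \<bar>\<eta> n\<bar> < \<delta> / 4"
    unfolding eventually_sequentially by blast
  define N' where "N' = max N 2"
  have "((\<lambda>t. L * (1 / sqrt t) + B' * (t * exp (- c0 * t))) \<longlongrightarrow> L * 0 + B' * 0) at_top"
  proof (intro tendsto_intros)
    show "((\<lambda>t::real. 1 / sqrt t) \<longlongrightarrow> 0) at_top" by real_asymp
    show "((\<lambda>t::real. t * exp (- c0 * t)) \<longlongrightarrow> 0) at_top" using c0 by real_asymp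
  qed
  then have "eventually (\<lambda>t. L * (1 / sqrt t) + B' * (t * exp (- c0 * t)) < \<delta> / 2) at_top"
    using \<delta> by (intro order_tendstoD(2)) auto
  then obtain T0 where T0: "\<And>t. T0 \<le> t \<Longrightarrow> L * (1 / sqrt t) + B' * (t * exp (- c0 * t)) < \<delta> / 2"
    unfolding eventually_at_top_linorder by blast
  define T where "T = max T0 (2 * real (N' + 2))"
  have "t * \<bar>poissonized f x t + 2 * M * dipole x (?q * t)\<bar> \<le> \<delta>" if t: "T \<le> t" and x: "0 < x" for t x
  proof -
    have t1: "T0 \<le> t" "2 * real (N' + 2) \<le> t" "1 \<le> t" using t by (auto simp: T_def)
    let ?w = "\<lambda>n. (killed ^^ n) f x"
    let ?D = "dipole x (?q * t)"
    \<comment> \<open>Near \<open>t\<close> the deviation \<open>\<bar>n - t\<bar>\<close> is replaced by a constant plus a multiple of its square, so that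
      only the variance is needed. The geometric term is at least \<open>B'\<close> as soon as \<open>n < t / 2\<close>, and
      its Poisson average is \<open>B' exp (- c0 t)\<close>.\<close>
    define a where "a = \<delta> / 2 / t + L * sqrt t / (2 * t\<^sup>2)"
    define b where "b = L / (2 * sqrt t * t\<^sup>2)"
    define c where "c = B' * exp (ln 2 * (t / 2))"
    have abc: "0 \<le> a" "0 \<le> b" "0 \<le> c" using \<delta> L B' t1 by (auto simp: a_def b_def c_def)
    have r: "\<bar>?w n + 2 * M * ?D\<bar> \<le> a + b * (real n - t)\<^sup>2 + c * (1 / 2) ^ n" for n
    proof (cases "t / 2 \<le> real n")
      case True
      with t1 have n: "N' + 2 \<le> n" by simp
      then obtain m where m: "n = Suc m" "N' \<le> m" by (cases n) auto
      let ?Dn = "dipole x (?q * real n)"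
      have 1: "\<bar>?w n + 2 * M * ?Dn\<bar> \<le> \<delta> / 2 / t"
      proof -
        have "real n * \<bar>?w n + 2 * M * ?Dn\<bar> \<le> \<eta> m"
          using lim[of m x] m x by (simp add: N'_def add.commute)
        also have "\<dots> \<le> \<delta> / 4" using N[of m] m by (simp add: N'_def)
        finally have "real n * \<bar>?w n + 2 * M * ?Dn\<bar> \<le> \<delta> / 4" .
        moreover have "t / 2 * \<bar>?w n + 2 * M * ?Dn\<bar> \<le> real n * \<bar>?w n + 2 * M * ?Dn\<bar>"
          using True by (rule mult_right_mono) simp
        ultimately have "\<bar>?w n + 2 * M * ?Dn\<bar> * t \<le> \<delta> / 2" by (simp add: mult.commute)
        then show ?thesis using t1 by (simp only: pos_le_divide_eq)
      qed
      have 2: "\<bar>2 * M * (?D - ?Dn)\<bar> \<le> L * \<bar>real n - t\<bar> / t\<^sup>2"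
      proof -
        have "\<bar>?D - ?Dn\<bar> \<le> gauss_moment 3 * \<bar>?q * t - ?q * real n\<bar> / (?q * (t / 2))\<^sup>2"
          using q t1 True by (intro dipole_time_lipschitz) auto
        also have "\<bar>?q * t - ?q * real n\<bar> = ?q * \<bar>real n - t\<bar>"
          unfolding right_diff_distrib[symmetric] abs_mult using q by (simp add: abs_minus_commute)
        also have "gauss_moment 3 * (?q * \<bar>real n - t\<bar>) / (?q * (t / 2))\<^sup>2 = 4 * gauss_moment 3 / ?q * \<bar>real n - t\<bar> / t\<^sup>2"
        proof -
          have "v * (?q * w) / (?q * (z / 2))\<^sup>2 = 4 * v / ?q * w / z\<^sup>2" for v w z
            using q by (cases "z = 0") (auto simp: power2_eq_square field_simps)
          then show ?thesis .
        qed
        finally have "2 * \<bar>M\<bar> * \<bar>?D - ?Dn\<bar> \<le> 2 * \<bar>M\<bar> * (4 * gauss_moment 3 / ?q * \<bar>real n - t\<bar> / t\<^sup>2)"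
          by (rule mult_left_mono) simp
        then show ?thesis by (simp add: L_def abs_mult)
      qed
      have 3: "\<bar>real n - t\<bar> \<le> sqrt t / 2 + (real n - t)\<^sup>2 / (2 * sqrt t)"
      proof -
        have "0 \<le> (\<bar>real n - t\<bar> - sqrt t)\<^sup>2" by simp
        then have "\<bar>real n - t\<bar> * (2 * sqrt t) \<le> (real n - t)\<^sup>2 + t"
          using t1 by (simp add: power2_diff mult_ac)
        then have "\<bar>real n - t\<bar> \<le> ((real n - t)\<^sup>2 + t) / (2 * sqrt t)"
          using t1 by (simp only: pos_le_divide_eq mult_pos_pos real_sqrt_gt_zero zero_less_numeral)
        also have "\<dots> = sqrt t / 2 + (real n - t)\<^sup>2 / (2 * sqrt t)"
          using t1 by (simp add: add_divide_distrib real_div_sqrt)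
        finally show ?thesis .
      qed
      have "L * \<bar>real n - t\<bar> / t\<^sup>2 \<le> L * (sqrt t / 2 + (real n - t)\<^sup>2 / (2 * sqrt t)) / t\<^sup>2"
        using 3 L by (intro divide_right_mono mult_left_mono) auto
      also have "\<dots> = L * sqrt t / (2 * t\<^sup>2) + b * (real n - t)\<^sup>2"
        by (simp add: b_def distrib_left add_divide_distrib)
      finally have 4: "L * \<bar>real n - t\<bar> / t\<^sup>2 \<le> L * sqrt t / (2 * t\<^sup>2) + b * (real n - t)\<^sup>2" .
      have "?w n + 2 * M * ?D = (?w n + 2 * M * ?Dn) + 2 * M * (?D - ?Dn)"
        by (simp add: right_diff_distrib)
      then have "\<bar>?w n + 2 * M * ?D\<bar> \<le> \<bar>?w n + 2 * M * ?Dn\<bar> + \<bar>2 * M * (?D - ?Dn)\<bar>"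
        by (simp only: abs_triangle_ineq)
      also have "\<dots> \<le> a + b * (real n - t)\<^sup>2"
        using 1 2 4 unfolding a_def by linarith
      also have "\<dots> \<le> a + b * (real n - t)\<^sup>2 + c * (1 / 2) ^ n"
        using abc by simp
      finally show ?thesis .
    next
      case False
      have "\<bar>?w n\<bar> \<le> B"
        using killed_power_le[OF f B(2), of n x] walk_densityD(2)[OF killed_power_density[OF f], of n x] by simp
      moreover have "\<bar>2 * M * ?D\<bar> \<le> 2 * \<bar>M\<bar> * (gauss_moment 1 / ?q)"
      proof -
        have "\<bar>?D\<bar> \<le> gauss_moment 1 / (?q * t)" using q t1 by (intro dipole_bound) simp
        also have "\<dots> \<le> gauss_moment 1 / (?q * 1)"
          using q t1 gauss_moment_nonneg[of 1] by (intro divide_left_mono mult_left_mono) auto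
        finally have "\<bar>?D\<bar> \<le> gauss_moment 1 / ?q" by (simp only: mult_1_right)
        then have "2 * \<bar>M\<bar> * \<bar>?D\<bar> \<le> 2 * \<bar>M\<bar> * (gauss_moment 1 / ?q)"
          by (rule mult_left_mono) simp
        then show ?thesis by (simp only: abs_mult abs_numeral)
      qed
      ultimately have "\<bar>?w n + 2 * M * ?D\<bar> \<le> B' * 1"
        unfolding B'_def mult_1_right by (rule order_trans[OF abs_triangle_ineq add_mono])
      also have "\<dots> \<le> B' * (exp (ln 2 * (t / 2)) * (1 / 2) ^ n)"
      proof (rule mult_left_mono[OF _ B'])
        have "(1 / 2 :: real) ^ n = exp (- (ln 2 * real n))"
          by (simp add: exp_minus exp_of_nat2_mult power_one_over inverse_eq_divide)
        then have "exp (ln 2 * (t / 2)) * (1 / 2) ^ n = exp (ln 2 * (t / 2 - real n))"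
          by (simp add: right_diff_distrib flip: exp_add)
        moreover have "0 \<le> ln (2::real) * (t / 2 - real n)" using False by simp
        ultimately show "1 \<le> exp (ln 2 * (t / 2)) * (1 / 2) ^ n" by simp
      qed
      also have "\<dots> = c * (1 / 2) ^ n" by (simp add: c_def)
      also have "\<dots> \<le> a + b * (real n - t)\<^sup>2 + c * (1 / 2) ^ n" using abc by simp
      finally show ?thesis .
    qed
    have w: "summable (\<lambda>n. t ^ n / fact n * ?w n)"
    proof (rule poisson_average_bound(1)[where a = B and b = 0 and c = 0])
      show "\<bar>?w n\<bar> \<le> B + 0 * (real n - t)\<^sup>2 + 0 * (1 / 2) ^ n" for n
        using killed_power_le[OF f B(2), of n x] walk_densityD(2)[OF killed_power_density[OF f], of n x] by simp
    qed (use t1 in simp)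
    have "(\<lambda>n. t ^ n / fact n * ?w n + (2 * M * ?D) * (t ^ n / fact n)) sums
        ((\<Sum>n. t ^ n / fact n * ?w n) + (2 * M * ?D) * exp t)"
      by (intro sums_add summable_sums[OF w] sums_mult exponential_series_sums)
    then have "(\<Sum>n. t ^ n / fact n * (?w n + 2 * M * ?D)) = (\<Sum>n. t ^ n / fact n * ?w n) + (2 * M * ?D) * exp t"
      by (simp add: sums_iff distrib_left mult_ac)
    then have "exp (- t) * (\<Sum>n. t ^ n / fact n * (?w n + 2 * M * ?D)) = poissonized f x t + 2 * M * ?D"
      by (simp add: poissonized_def distrib_left exp_minus)
    then have "\<bar>poissonized f x t + 2 * M * ?D\<bar> \<le> a + b * t + c * exp (- t / 2)"
      using poisson_average_bound(2)[OF _ r] t1 by simp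
    then have "t * \<bar>poissonized f x t + 2 * M * ?D\<bar> \<le> t * (a + b * t + c * exp (- t / 2))"
      using t1 by (intro mult_left_mono) auto
    also have "\<dots> = \<delta> / 2 + (L * (1 / sqrt t) + B' * (t * exp (- c0 * t)))"
    proof -
      have s: "sqrt t * sqrt t = t" "0 < sqrt t" using t1 by auto
      have "t * a = \<delta> / 2 + L * (1 / sqrt t) / 2"
      proof -
        have "sqrt t / t = 1 / sqrt t" using s t1 by (simp add: field_simps)
        moreover have "t * a = \<delta> / 2 + L * (sqrt t / t) / 2"
          using t1 by (simp add: a_def power2_eq_square field_simps)
        ultimately show ?thesis by simp
      qed
      moreover have "t * (b * t) = L * (1 / sqrt t) / 2"
        using t1 by (simp add: b_def power2_eq_square)
      moreover have "t * (c * exp (- t / 2)) = B' * (t * exp (- c0 * t))"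
      proof -
        have "exp (ln 2 * (t / 2)) * exp (- t / 2) = exp (- c0 * t)"
          unfolding exp_add[symmetric] by (simp add: c0_def field_simps)
        then show ?thesis by (simp add: c_def mult_ac)
      qed
      ultimately show ?thesis by (simp only: distrib_left)
    qed
    also have "\<dots> \<le> \<delta>" using T0[OF t1(1)] by linarith
    finally show ?thesis .
  qed
  moreover have "0 < T" by (simp add: T_def max_def)
  ultimately show ?thesis by blast
qed

end

section \<open>Identification of the solution\<close>

lemma integral_lebesgue_cong_AE:
  fixes f g :: "real \<Rightarrow> real"
  assumes g: "g \<in> borel_measurable lebesgue" and eq: "AE x in lebesgue. f x = g x"
  shows "f \<in> borel_measurable lebesgue" and "integral\<^sup>L lebesgue f = integral\<^sup>L lebesgue g"
proof -
  have "AE x in lebesgue. g x = f x" using eq by eventually_elim simp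
  then show "f \<in> borel_measurable lebesgue" by (rule borel_measurable_AE[OF g])
  then show "integral\<^sup>L lebesgue f = integral\<^sup>L lebesgue g" by (intro integral_cong_AE g eq)
qed

lemma borel_imp_lebesgue_measurable:
  fixes f :: "real \<Rightarrow> real"
  assumes "f \<in> borel_measurable borel"
  shows "f \<in> borel_measurable lebesgue"
  using assms by (simp add: measurable_completion)

lemma AE_lebesgue_on_iff:
  assumes "S \<in> sets lebesgue"
  shows "(AE x in lebesgue_on S. P x) \<longleftrightarrow> (AE x in lebesgue. x \<in> S \<longrightarrow> P x)"
  by (rule AE_restrict_space_iff) (use assms in simp)

lemma AE_lebesgue_neq: "AE x in lebesgue. x \<noteq> (c::real)"
  by (intro AE_completion AE_lborel_singleton)

lemma weighted_integrable_measurable: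
  fixes g :: "real \<Rightarrow> real"
  assumes "integrable (lebesgue_on {0<..}) (\<lambda>x. (1 + x) * g x)"
  shows "g \<in> borel_measurable (lebesgue_on {0<..})"
proof -
  have "(\<lambda>x. (1 + x) * g x / (1 + x)) \<in> borel_measurable (lebesgue_on {0<..})"
    using borel_measurable_integrable[OF assms]
    by (intro borel_measurable_divide borel_measurable_add)
       (auto intro!: measurable_restrict_space1 borel_imp_lebesgue_measurable)
  then show ?thesis
    by (rule measurable_cong[THEN iffD1, rotated]) (auto simp: space_restrict_space)
qed

text \<open>Repeated integration of a derivative bound from a starting time that is only accessible
  as a limit.\<close>

lemma derivative_power_bound:
  fixes g g' :: "real \<Rightarrow> real" and z :: "nat \<Rightarrow> real"
  assumes t: "0 < t"
    and der: "\<And>s. 0 < s \<Longrightarrow> s \<le> t \<Longrightarrow> (g has_real_derivative g' s) (at s)"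
    and le: "\<And>s. 0 < s \<Longrightarrow> s \<le> t \<Longrightarrow> \<bar>g' s\<bar> \<le> c * (s ^ n / fact n)"
    and z: "\<And>k. 0 < z k" "z \<longlonglongrightarrow> 0" and L: "(\<lambda>k. g (z k)) \<longlonglongrightarrow> L"
  shows "\<bar>g t - L\<bar> \<le> c * (t ^ Suc n / fact (Suc n))"
proof -
  have *: "\<sigma> * (g t - L) \<le> c * (t ^ Suc n / fact (Suc n))" if \<sigma>: "\<bar>\<sigma>\<bar> = 1" for \<sigma> :: real
  proof -
    define h where "h s = c * (s ^ Suc n / fact (Suc n)) - \<sigma> * g s" for s
    have mono: "h r \<le> h t" if r: "0 < r" "r \<le> t" for r
    proof (rule DERIV_nonneg_imp_nondecreasing[OF r(2)])
      fix s assume s: "r \<le> s" "s \<le> t"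
      have "((\<lambda>s. s ^ Suc n / fact (Suc n)) has_real_derivative (real (Suc n) * s ^ n / fact (Suc n))) (at s)"
        by (rule derivative_eq_intros refl | simp)+
      moreover have "real (Suc n) * s ^ n / fact (Suc n) = s ^ n / fact n"
        by (simp add: fact_Suc del: of_nat_Suc)
      ultimately have "((\<lambda>s. s ^ Suc n / fact (Suc n)) has_real_derivative (s ^ n / fact n)) (at s)"
        by simp
      then have "(h has_real_derivative (c * (s ^ n / fact n) - \<sigma> * g' s)) (at s)"
        unfolding h_def[abs_def] using der[of s] r s by (intro DERIV_diff DERIV_cmult) auto
      moreover have "\<sigma> * g' s \<le> \<bar>g' s\<bar>"
        using abs_ge_self[of "\<sigma> * g' s"] \<sigma> by (simp add: abs_mult)
      then have "0 \<le> c * (s ^ n / fact n) - \<sigma> * g' s"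
        using le[of s] r s by simp
      ultimately show "\<exists>y. (h has_real_derivative y) (at s) \<and> 0 \<le> y" by blast
    qed
    have "eventually (\<lambda>k. z k < t) sequentially"
      using order_tendstoD(2)[OF z(2) t] .
    then have "eventually (\<lambda>k. h (z k) \<le> h t) sequentially"
      by eventually_elim (use mono z(1) in \<open>simp add: less_imp_le\<close>)
    moreover have "(\<lambda>k. h (z k)) \<longlonglongrightarrow> c * (0 ^ Suc n / fact (Suc n)) - \<sigma> * L"
      unfolding h_def by (intro tendsto_intros z(2) L) simp
    ultimately have "c * (0 ^ Suc n / fact (Suc n)) - \<sigma> * L \<le> h t"
      by (intro tendsto_upperbound) auto
    then show ?thesis by (simp add: h_def right_diff_distrib)
  qed
  show ?thesis using *[of 1] *[of "-1"] by (simp add: abs_le_iff)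
qed

context dispersal_kernel
begin

lemma convolve_lebesgue_bound:
  assumes [measurable]: "e \<in> borel_measurable lebesgue" and e: "AE y in lebesgue. \<bar>e y\<bar> \<le> c"
  shows "integrable lebesgue (\<lambda>y. J (x - y) * e y)" and "\<bar>\<integral>y. J (x - y) * e y \<partial>lebesgue\<bar> \<le> c"
proof -
  have J: "(\<lambda>y. J (x - y)) \<in> borel_measurable borel" by measurable
  note [measurable] = borel_imp_lebesgue_measurable[OF J]
  have "integrable lborel (\<lambda>y. J (x - y))" "(\<integral>y. J (x - y) \<partial>lborel) = 1"
    using lborel_integrable_real_affine[OF J_integrable, of "-1" x]
      lborel_integral_real_affine[of "-1" J x] by (simp_all add: J_integral)
  then have iJ: "integrable lebesgue (\<lambda>y. J (x - y))" "(\<integral>y. J (x - y) \<partial>lebesgue) = 1"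
    using J by (simp_all add: integrable_completion integral_completion)
  have le: "AE y in lebesgue. \<bar>J (x - y) * e y\<bar> \<le> c * J (x - y)"
    using e
  proof eventually_elim
    case (elim y)
    then show ?case using J_nonneg[of "x - y"] by (simp add: abs_mult mult.commute mult_right_mono)
  qed
  have ic: "integrable lebesgue (\<lambda>y. c * J (x - y))" using iJ(1) by simp
  show i: "integrable lebesgue (\<lambda>y. J (x - y) * e y)"
  proof (rule Bochner_Integration.integrable_bound[OF ic])
    show "AE y in lebesgue. norm (J (x - y) * e y) \<le> norm (c * J (x - y))"
      using le by eventually_elim (simp only: real_norm_def order_trans[OF _ abs_ge_self])
  qed measurable
  have "\<bar>\<integral>y. J (x - y) * e y \<partial>lebesgue\<bar> \<le> (\<integral>y. \<bar>J (x - y) * e y\<bar> \<partial>lebesgue)"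
    by (rule integral_abs_bound)
  also have "\<dots> \<le> (\<integral>y. c * J (x - y) \<partial>lebesgue)"
    by (rule integral_mono_AE) (use i ic le in auto)
  also have "\<dots> = c" using iJ by simp
  finally show "\<bar>\<integral>y. J (x - y) * e y \<partial>lebesgue\<bar> \<le> c" .
qed

text \<open>Continuity in time with values in the weighted \<open>L\<^sup>1\<close> space gives a bound on compact time
  intervals, from which the Taylor expansion of the solution is started.\<close>

lemma weighted_L1_bounded:
  assumes u: "continuous_weighted_L1 u"
  shows "\<exists>C. \<forall>t\<in>{0..T}. (\<integral>x. (1 + x) * \<bar>u x t\<bar> \<partial>lebesgue_on {0<..}) \<le> C"
proof -
  let ?M = "lebesgue_on {0<..} :: real measure"
  let ?m = "\<lambda>t. \<integral>x. (1 + x) * \<bar>u x t\<bar> \<partial>?M"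
  have i: "integrable ?M (\<lambda>x. (1 + x) * u x t)" if "0 \<le> t" for t
    using u that by (simp add: continuous_weighted_L1_def)
  have ia: "integrable ?M (\<lambda>x. (1 + x) * \<bar>u x t\<bar>)" if "0 \<le> t" for t
    by (rule iffD1[OF Bochner_Integration.integrable_cong[OF refl] integrable_abs[OF i[OF that]]])
       (auto simp: abs_mult space_restrict_space)
  have id: "integrable ?M (\<lambda>x. (1 + x) * \<bar>u x s - u x t\<bar>)" if "0 \<le> s" "0 \<le> t" for s t
    by (rule iffD1[OF Bochner_Integration.integrable_cong[OF refl]
          integrable_abs[OF Bochner_Integration.integrable_diff[OF i[OF that(1)] i[OF that(2)]]]])
       (auto simp: abs_mult space_restrict_space simp flip: right_diff_distrib)
  have d: "\<bar>?m s - ?m t\<bar> \<le> (\<integral>x. (1 + x) * \<bar>u x s - u x t\<bar> \<partial>?M)" if st: "0 \<le> s" "0 \<le> t" for s t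
  proof -
    have "?m s - ?m t = (\<integral>x. (1 + x) * \<bar>u x s\<bar> - (1 + x) * \<bar>u x t\<bar> \<partial>?M)"
      by (rule Bochner_Integration.integral_diff[OF ia[OF st(1)] ia[OF st(2)], symmetric])
    also have "\<bar>\<dots>\<bar> \<le> (\<integral>x. \<bar>(1 + x) * \<bar>u x s\<bar> - (1 + x) * \<bar>u x t\<bar>\<bar> \<partial>?M)"
      by (rule integral_abs_bound)
    also have "\<dots> \<le> (\<integral>x. (1 + x) * \<bar>u x s - u x t\<bar> \<partial>?M)"
    proof (rule integral_mono)
      show "integrable ?M (\<lambda>x. \<bar>(1 + x) * \<bar>u x s\<bar> - (1 + x) * \<bar>u x t\<bar>\<bar>)"
        by (intro integrable_abs Bochner_Integration.integrable_diff ia st)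
      fix x assume "x \<in> space ?M"
      then have "0 < x" by (simp add: space_restrict_space)
      then show "\<bar>(1 + x) * \<bar>u x s\<bar> - (1 + x) * \<bar>u x t\<bar>\<bar> \<le> (1 + x) * \<bar>u x s - u x t\<bar>"
        unfolding right_diff_distrib[symmetric] abs_mult
        by (intro mult_mono abs_triangle_ineq3) auto
    qed (rule id[OF st])
    finally show ?thesis .
  qed
  have "continuous_on {0..T} ?m"
  proof (rule continuous_on_subset[of "{0..}"])
    show "continuous_on {0..} ?m"
      unfolding continuous_on_def
    proof
      fix t :: real assume t: "t \<in> {0..}"
      have "((\<lambda>s. \<integral>x. (1 + x) * \<bar>u x s - u x t\<bar> \<partial>?M) \<longlongrightarrow> 0) (at t within {0..})"
        using u t by (simp add: continuous_weighted_L1_def)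
      moreover have "\<forall>\<^sub>F s in at t within {0..}. norm (?m s - ?m t) \<le> (\<integral>x. (1 + x) * \<bar>u x s - u x t\<bar> \<partial>?M)"
        unfolding eventually_at_filter using d t by (auto intro!: always_eventually)
      ultimately have "((\<lambda>s. ?m s - ?m t) \<longlongrightarrow> 0) (at t within {0..})"
        by (rule Lim_null_comparison[rotated])
      then show "(?m \<longlongrightarrow> ?m t) (at t within {0..})"
        by (rule LIM_zero_cancel)
    qed
  qed simp
  then have "bounded (?m ` {0..T})"
    by (intro compact_imp_bounded compact_continuous_image) auto
  then obtain C where "\<And>t. t \<in> {0..T} \<Longrightarrow> \<bar>?m t\<bar> \<le> C"
    unfolding bounded_iff real_norm_def by blast
  then show ?thesis by (meson abs_le_D1)
qed

text \<open>A solution has a time derivative at almost every point, but only for positive times; its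
  initial value enters through the \<open>L\<^sup>1\<close> limit, hence pointwise along a sequence of times.
  From there the Taylor expansion in time of \<open>exp t * u\<close> can be integrated up order by order,
  which proves uniqueness and gives the series at once.\<close>

theorem evolution_solution_poissonized:
  assumes sol: "evolution_solution J u0 u" and f: "walk_density f"
    and init: "AE x in lebesgue. u0 x = f x"
  shows "AE x in lebesgue. 0 < x \<longrightarrow> (\<forall>t>0. u x t = poissonized f x t)"
proof -
  let ?M = "lebesgue_on {0<..} :: real measure"
  have S: "{0<..} \<in> sets (lebesgue :: real measure)" by simp
  have wL1: "continuous_weighted_L1 u"
    using sol by (simp add: evolution_solution_def)
  have i: "integrable ?M (\<lambda>x. (1 + x) * u x t)" if "0 \<le> t" for t
    using wL1 that by (simp add: continuous_weighted_L1_def)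
  have mM: "(\<lambda>x. u x t) \<in> borel_measurable ?M" if "0 \<le> t" for t
  proof -
    have "(\<lambda>x. (1 + x) * u x t / (1 + x)) \<in> borel_measurable ?M"
      using borel_measurable_integrable[OF i[OF that]]
      by (intro borel_measurable_divide borel_measurable_add)
         (auto intro!: measurable_restrict_space1 borel_imp_lebesgue_measurable)
    then show ?thesis
      by (rule measurable_cong[THEN iffD1, rotated]) (auto simp: space_restrict_space)
  qed
  define z :: "nat \<Rightarrow> real" where "z k = 1 / real (Suc k)" for k
  have z: "0 < z k" "z \<longlonglongrightarrow> 0" for k
    unfolding z_def by (simp, real_asymp)
  obtain \<kappa> where \<kappa>: "strict_mono \<kappa>" and AEz: "AE x in ?M. (\<lambda>k. (1 + x) * (u x (z (\<kappa> k)) - u x 0)) \<longlonglongrightarrow> 0"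
  proof -
    have "integrable ?M (\<lambda>x. (1 + x) * (u x (z k) - u x 0))" for k
      unfolding right_diff_distrib using z(1)[of k] by (intro Bochner_Integration.integrable_diff i) auto
    moreover have "(\<lambda>k. \<integral>x. norm ((1 + x) * (u x (z k) - u x 0)) \<partial>?M) \<longlonglongrightarrow> 0"
    proof -
      have "((\<lambda>s. \<integral>x. (1 + x) * \<bar>u x s - u x 0\<bar> \<partial>?M) \<longlongrightarrow> 0) (at 0 within {0..})"
        using wL1 by (simp add: continuous_weighted_L1_def)
      moreover have "filterlim z (at 0 within {0..}) sequentially"
        using z by (auto simp: filterlim_at less_imp_le intro!: always_eventually)
          (metis less_irrefl)+
      ultimately have "(\<lambda>k. \<integral>x. (1 + x) * \<bar>u x (z k) - u x 0\<bar> \<partial>?M) \<longlonglongrightarrow> 0"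
        by (rule filterlim_compose)
      moreover have "(\<integral>x. norm ((1 + x) * (u x (z k) - u x 0)) \<partial>?M) = (\<integral>x. (1 + x) * \<bar>u x (z k) - u x 0\<bar> \<partial>?M)" for k
        by (intro Bochner_Integration.integral_cong) (auto simp: space_restrict_space abs_mult)
      ultimately show ?thesis by simp
    qed
    ultimately show ?thesis
      using that tendsto_L1_AE_subseq[of ?M "\<lambda>k x. (1 + x) * (u x (z k) - u x 0)"] by blast
  qed
  define zz where "zz k = z (\<kappa> k)" for k
  have zz: "0 < zz k" "zz \<longlonglongrightarrow> 0" for k
    using z LIMSEQ_subseq_LIMSEQ[OF z(2) \<kappa>] by (auto simp: zz_def[abs_def] o_def)
  \<comment> \<open>One null set serves all times. The initial value is attached to the limit along \<open>zz\<close> because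
    nothing is assumed about continuity of the single functions \<open>s \<mapsto> u x s\<close> at \<open>0\<close>.\<close>
  define good where "good x \<longleftrightarrow> (if x < 0 then \<forall>t\<ge>0. u x t = 0
     else (\<forall>t>0. ((\<lambda>s. u x s) has_real_derivative (convolve J (\<lambda>y. u y t) x - u x t)) (at t))
       \<and> (\<lambda>k. u x (zz k)) \<longlonglongrightarrow> f x)" for x
  have good: "AE x in lebesgue. good x"
  proof -
    have 1: "AE x in lebesgue. x \<ge> 0 \<longrightarrow>
        (\<forall>t>0. ((\<lambda>s. u x s) has_real_derivative (convolve J (\<lambda>y. u y t) x - u x t)) (at t))"
      and 2: "AE x in lebesgue. x < 0 \<longrightarrow> (\<forall>t>0. u x t = 0)"
      and 3: "AE x in lebesgue. u x 0 = u0 x"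
      using sol by (auto simp: evolution_solution_def)
    have 4: "AE x in lebesgue. x \<in> {0<..} \<longrightarrow> (\<lambda>k. (1 + x) * (u x (z (\<kappa> k)) - u x 0)) \<longlonglongrightarrow> 0"
      using AEz unfolding AE_lebesgue_on_iff[OF S] .
    from 1 2 3 4 init AE_lebesgue_neq[of 0] show ?thesis
    proof eventually_elim
      case (elim x)
      have u0x: "u x 0 = f x" using elim by simp
      show ?case
      proof (cases "x < 0")
        case True
        then have "u x t = 0" if "0 \<le> t" for t
          using that elim(2) u0x walk_densityD(3)[OF f True] by (cases "t = 0") auto
        then show ?thesis using True by (simp add: good_def)
      next
        case False
        with elim have x: "0 < x" by simp
        have "(\<lambda>k. inverse (1 + x) * ((1 + x) * (u x (zz k) - u x 0))) \<longlonglongrightarrow> inverse (1 + x) * 0"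
          using elim(4) x by (intro tendsto_mult tendsto_const) (simp add: zz_def)
        then have "(\<lambda>k. u x (zz k) - u x 0) \<longlonglongrightarrow> 0"
          using x by (simp add: mult.assoc[symmetric])
        then have "(\<lambda>k. u x (zz k)) \<longlonglongrightarrow> f x"
          unfolding u0x by (rule LIM_zero_cancel)
        then show ?thesis using False elim(1) x by (simp add: good_def)
      qed
    qed
  qed
  have mu: "(\<lambda>x. u x t) \<in> borel_measurable lebesgue"
    and eq_pos: "AE x in lebesgue. u x t = indicator {0<..} x *\<^sub>R u x t" if t: "0 \<le> t" for t
  proof -
    have "(\<lambda>x. indicator {0<..} x *\<^sub>R u x t) \<in> borel_measurable lebesgue"
      using mM[OF t] by (subst (asm) borel_measurable_restrict_space_iff) auto
    moreover show "AE x in lebesgue. u x t = indicator {0<..} x *\<^sub>R u x t"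
      using good AE_lebesgue_neq[of 0]
    proof eventually_elim
      case (elim x)
      then show ?case using t by (cases "0 < x") (auto simp: good_def)
    qed
    ultimately show "(\<lambda>x. u x t) \<in> borel_measurable lebesgue"
      by (rule integral_lebesgue_cong_AE(1))
  qed
  obtain B where B: "B > 0" "\<And>x. f x \<le> B" using walk_densityD(4)[OF f] by blast
  have K: "(killed ^^ k) f \<in> borel_measurable borel" "\<bar>(killed ^^ k) f y\<bar> \<le> B" for k y
    using walk_densityD(1,2)[OF killed_power_density[OF f]] killed_power_le[OF f B(2)] by simp_all
  define P where "P n y s = (\<Sum>k<n. s ^ k / fact k * (killed ^^ k) f y)" for n y and s :: real
  \<comment> \<open>Induction on \<open>n\<close>: the time derivative of the remainder of order \<open>n + 1\<close> is the convolution of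
    \<open>J\<close> with the remainder of order \<open>n\<close>, and convolution does not increase uniform bounds.\<close>
  have expansion: "\<exists>C. \<forall>x s. good x \<longrightarrow> 0 < s \<longrightarrow> s \<le> T \<longrightarrow>
     (\<forall>n. \<bar>exp s * u x s - P n x s\<bar> \<le> C * (s ^ n / fact n))" if T: "0 < T" for T
  proof -
    obtain C0 where C0: "\<And>t. t \<in> {0..T} \<Longrightarrow> (\<integral>x. (1 + x) * \<bar>u x t\<bar> \<partial>?M) \<le> C0"
      using weighted_L1_bounded[OF wL1] by blast
    obtain Jm where Jm: "Jm > 0" "\<And>z. J z \<le> Jm" using J_bounded by blast
    have conv: "\<bar>convolve J (\<lambda>y. u y s) x\<bar> \<le> Jm * C0" if s: "0 < s" "s \<le> T" for x s
    proof -
      have J: "(\<lambda>y. J (x - y)) \<in> borel_measurable lebesgue"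
        by (intro borel_imp_lebesgue_measurable) measurable
      have "convolve J (\<lambda>y. u y s) x = (\<integral>y. indicator {0<..} y *\<^sub>R (J (x - y) * u y s) \<partial>lebesgue)"
        unfolding convolve_def
      proof (rule integral_cong_AE)
        show "(\<lambda>y. J (x - y) * u y s) \<in> borel_measurable lebesgue"
          using J mu[of s] s by simp
        then show "(\<lambda>y. indicator {0<..} y *\<^sub>R (J (x - y) * u y s)) \<in> borel_measurable lebesgue"
          by (intro borel_measurable_scaleR borel_measurable_indicator) auto
        show "AE y in lebesgue. J (x - y) * u y s = indicator {0<..} y *\<^sub>R (J (x - y) * u y s)"
          using eq_pos[of s] s by (auto elim!: eventually_mono simp: indicator_def)
      qed
      also have "\<dots> = (\<integral>y. J (x - y) * u y s \<partial>?M)"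
        by (rule integral_restrict_space[symmetric]) simp
      also have "\<bar>\<dots>\<bar> \<le> (\<integral>y. \<bar>J (x - y) * u y s\<bar> \<partial>?M)"
        by (rule integral_abs_bound)
      also have "\<dots> \<le> (\<integral>y. Jm * ((1 + y) * \<bar>u y s\<bar>) \<partial>?M)"
      proof (rule integral_mono')
        have ia: "integrable ?M (\<lambda>x. (1 + x) * \<bar>u x s\<bar>)"
          by (rule iffD1[OF Bochner_Integration.integrable_cong[OF refl] integrable_abs[OF i[of s]]])
             (use s in \<open>auto simp: abs_mult space_restrict_space\<close>)
        then show "integrable ?M (\<lambda>y. Jm * ((1 + y) * \<bar>u y s\<bar>))" by (rule integrable_mult_right)
        fix y assume "y \<in> space ?M"
        then have y: "0 < y" by (simp add: space_restrict_space)
        have "\<bar>u y s\<bar> \<le> (1 + y) * \<bar>u y s\<bar>" using y by (simp add: distrib_right)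
        then show "\<bar>J (x - y) * u y s\<bar> \<le> Jm * ((1 + y) * \<bar>u y s\<bar>)"
          unfolding abs_mult using Jm J_nonneg[of "x - y"] by (intro mult_mono) auto
        show "0 \<le> Jm * ((1 + y) * \<bar>u y s\<bar>)" using y Jm by simp
      qed
      also have "\<dots> \<le> Jm * C0" using C0[of s] s Jm by simp
      finally show ?thesis .
    qed
    have derE: "((\<lambda>s. exp s * u x s) has_real_derivative (exp s * convolve J (\<lambda>y. u y s) x)) (at s)"
      if x: "good x" "0 \<le> x" and s: "0 < s" for x s
    proof -
      have "((\<lambda>s. u x s) has_real_derivative (convolve J (\<lambda>y. u y s) x - u x s)) (at s)"
        using x s by (simp add: good_def)
      then show ?thesis
        by (auto intro!: derivative_eq_intros simp: algebra_simps)
    qed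
    have limE: "(\<lambda>k. exp (zz k) * u x (zz k)) \<longlonglongrightarrow> f x" if x: "good x" "0 \<le> x" for x
    proof -
      have "(\<lambda>k. exp (zz k) * u x (zz k)) \<longlonglongrightarrow> exp 0 * f x"
        using x by (intro tendsto_intros zz(2)) (simp add: good_def)
      then show ?thesis by simp
    qed
    define C where "C = B + exp T * (Jm * C0) * T"
    have C0pos: "0 \<le> C0"
      using C0[of 0] T by (intro order_trans[OF integral_nonneg_AE C0[of 0]])
        (auto intro!: AE_I2 simp: space_restrict_space)
    then have Cpos: "0 \<le> C" using B Jm T by (simp add: C_def)
    have "\<bar>exp s * u x s - P n x s\<bar> \<le> C * (s ^ n / fact n)" if "good x" "0 < s" "s \<le> T" for n x s
      using that
    proof (induction n arbitrary: x s)
      case 0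
      show ?case
      proof (cases "x < 0")
        case False
        have "\<bar>exp s * u x s - f x\<bar> \<le> exp T * (Jm * C0) * (s ^ Suc 0 / fact (Suc 0))"
        proof (rule derivative_power_bound[where z = zz])
          fix r assume r: "0 < r" "r \<le> s"
          show "((\<lambda>s. exp s * u x s) has_real_derivative (exp r * convolve J (\<lambda>y. u y r) x)) (at r)"
            using 0 False r by (intro derE) auto
          have "exp r * \<bar>convolve J (\<lambda>y. u y r) x\<bar> \<le> exp T * (Jm * C0)"
            using conv[of r x] r 0 by (intro mult_mono) auto
          then show "\<bar>exp r * convolve J (\<lambda>y. u y r) x\<bar> \<le> exp T * (Jm * C0) * (r ^ 0 / fact 0)"
            by (simp add: abs_mult)
        next
          show "(\<lambda>k. exp (zz k) * u x (zz k)) \<longlonglongrightarrow> f x" using 0 False by (intro limE) auto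
        qed (use 0 zz in auto)
        also have "\<dots> = exp T * (Jm * C0) * s" by simp
        also have "\<dots> \<le> exp T * (Jm * C0) * T"
          using 0 Jm C0pos by (intro mult_left_mono) auto
        finally have "\<bar>exp s * u x s\<bar> \<le> B + exp T * (Jm * C0) * T"
          using K(2)[of 0 x] by simp
        then show ?thesis by (simp add: P_def C_def)
      qed (use 0 Cpos in \<open>simp add: P_def good_def\<close>)
    next
      case (Suc n)
      show ?case
      proof (cases "x < 0")
        case True
        have "P (Suc n) x s = 0"
          unfolding P_def using walk_densityD(3)[OF killed_power_density[OF f] True] by simp
        then show ?thesis using Suc.prems True Cpos by (simp add: good_def)
      next
        case False
        then have x: "0 \<le> x" by simp
        let ?g = "\<lambda>s. exp s * u x s - P (Suc n) x s"
        let ?g' = "\<lambda>s. exp s * convolve J (\<lambda>y. u y s) x - (\<Sum>k<n. s ^ k / fact k * (killed ^^ Suc k) f x)"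
        have "\<bar>?g s - 0\<bar> \<le> C * (s ^ Suc n / fact (Suc n))"
        proof (rule derivative_power_bound[where z = zz and g' = ?g'])
          fix r assume r: "0 < r" "r \<le> s"
          have "((\<lambda>s. P (Suc n) x s) has_real_derivative (\<Sum>k<n. r ^ k / fact k * (killed ^^ Suc k) f x)) (at r)"
          proof -
            have "((\<lambda>s. s ^ Suc k / fact (Suc k)) has_real_derivative (r ^ k / fact k)) (at r)" for k
            proof -
              have "((\<lambda>s. s ^ Suc k / fact (Suc k)) has_real_derivative (real (Suc k) * r ^ k / fact (Suc k))) (at r)"
                by (rule derivative_eq_intros refl | simp)+
              moreover have "real (Suc k) * r ^ k / fact (Suc k) = r ^ k / fact k"
                by (simp add: fact_Suc del: of_nat_Suc)
              ultimately show ?thesis by simp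
            qed
            then have "((\<lambda>s. f x + (\<Sum>k<n. s ^ Suc k / fact (Suc k) * (killed ^^ Suc k) f x)) has_real_derivative
               (0 + (\<Sum>k<n. r ^ k / fact k * (killed ^^ Suc k) f x))) (at r)"
              by (intro DERIV_add DERIV_const DERIV_sum DERIV_cmult_right)
            moreover have "P (Suc n) x s = f x + (\<Sum>k<n. s ^ Suc k / fact (Suc k) * (killed ^^ Suc k) f x)" for s
              unfolding P_def by (subst sum.lessThan_Suc_shift) simp
            ultimately show ?thesis by simp
          qed
          then show "(?g has_real_derivative ?g' r) (at r)"
            using derE[of x r] Suc.prems x r by (intro DERIV_diff) auto
          let ?e = "\<lambda>y. exp r * u y r - P n y r"
          have Pm: "(\<lambda>y. P n y r) \<in> borel_measurable borel"
            unfolding P_def using K(1) by (intro borel_measurable_sum borel_measurable_times) auto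
          have em: "?e \<in> borel_measurable lebesgue"
            using mu[of r] r borel_imp_lebesgue_measurable[OF Pm] by (intro borel_measurable_diff borel_measurable_times) auto
          have eb: "AE y in lebesgue. \<bar>?e y\<bar> \<le> C * (r ^ n / fact n)"
            using good by eventually_elim (use Suc.IH r Suc.prems in auto)
          have ik: "integrable lborel (\<lambda>y. J (x - y) * (killed ^^ k) f y)" for k
            by (rule jump_local_integrable(2)[OF K(1), where C = B]) (use K(2) in auto)
          have PJ: "integrable lebesgue (\<lambda>y. J (x - y) * P n y r)"
            "(\<integral>y. J (x - y) * P n y r \<partial>lebesgue) = (\<Sum>k<n. r ^ k / fact k * (killed ^^ Suc k) f x)"
          proof -
            have eq: "(\<lambda>y. J (x - y) * P n y r) = (\<lambda>y. \<Sum>k<n. r ^ k / fact k * (J (x - y) * (killed ^^ k) f y))"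
              unfolding P_def by (simp only: sum_distrib_left mult.left_commute)
            have m: "(\<lambda>y. J (x - y) * P n y r) \<in> borel_measurable lborel"
              using Pm by simp
            have il: "integrable lborel (\<lambda>y. J (x - y) * P n y r)"
              unfolding eq by (intro Bochner_Integration.integrable_sum integrable_mult_right ik)
            then show "integrable lebesgue (\<lambda>y. J (x - y) * P n y r)"
              using m by (simp add: integrable_completion)
            have "(\<integral>y. J (x - y) * P n y r \<partial>lebesgue) = (\<integral>y. J (x - y) * P n y r \<partial>lborel)"
              using m by (rule integral_completion)
            also have "\<dots> = (\<Sum>k<n. r ^ k / fact k * (killed ^^ Suc k) f x)"
              unfolding eq using x
              by (subst Bochner_Integration.integral_sum)
                 (auto intro!: integrable_mult_right ik sum.cong simp: killed_def jump_def)
            finally show "(\<integral>y. J (x - y) * P n y r \<partial>lebesgue) = (\<Sum>k<n. r ^ k / fact k * (killed ^^ Suc k) f x)" .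
          qed
          have "exp r * convolve J (\<lambda>y. u y r) x = (\<integral>y. J (x - y) * ?e y + J (x - y) * P n y r \<partial>lebesgue)"
            unfolding convolve_def integral_mult_right_zero[symmetric] by (simp add: algebra_simps)
          also have "\<dots> = (\<integral>y. J (x - y) * ?e y \<partial>lebesgue) + (\<Sum>k<n. r ^ k / fact k * (killed ^^ Suc k) f x)"
            unfolding Bochner_Integration.integral_add[OF convolve_lebesgue_bound(1)[OF em eb] PJ(1)] PJ(2) ..
          finally have "?g' r = (\<integral>y. J (x - y) * ?e y \<partial>lebesgue)" by simp
          then show "\<bar>?g' r\<bar> \<le> C * (r ^ n / fact n)"
            using convolve_lebesgue_bound(2)[OF em eb, of x] by simp
        next
          have "(\<lambda>k. P (Suc n) x (zz k)) \<longlonglongrightarrow> P (Suc n) x 0"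
            unfolding P_def by (intro tendsto_intros zz(2)) simp
          moreover have "P (Suc n) x 0 = f x"
            unfolding P_def by (subst sum.lessThan_Suc_shift) simp
          ultimately have "(\<lambda>k. ?g (zz k)) \<longlonglongrightarrow> f x - f x"
            using limE[of x] Suc.prems x by (intro tendsto_diff) auto
          then show "(\<lambda>k. ?g (zz k)) \<longlonglongrightarrow> 0" by simp
        qed (use Suc.prems zz in auto)
        then show ?thesis by simp
      qed
    qed
    then show ?thesis by blast
  qed
  show ?thesis
    using good
  proof eventually_elim
    case (elim x)
    show ?case
    proof (intro impI allI)
      fix t :: real assume "0 < x" and t: "0 < t"
      obtain C where C: "\<And>n. \<bar>exp t * u x t - P n x t\<bar> \<le> C * (t ^ n / fact n)"
        using expansion[OF t] elim t by blast
      have "(\<lambda>n. t ^ n / fact n) \<longlonglongrightarrow> 0"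
        by (rule summable_LIMSEQ_zero[OF sums_summable[OF exponential_series_sums]])
      then have "(\<lambda>n. C * (t ^ n / fact n)) \<longlonglongrightarrow> 0"
        by (rule tendsto_mult_right_zero)
      then have "(\<lambda>n. exp t * u x t - P n x t) \<longlonglongrightarrow> 0"
        by (rule Lim_null_comparison[rotated]) (use C in \<open>auto intro: always_eventually\<close>)
      then have "(\<lambda>n. exp t * u x t - (exp t * u x t - P n x t)) \<longlonglongrightarrow> exp t * u x t - 0"
        by (intro tendsto_diff tendsto_const)
      then have "(\<lambda>n. t ^ n / fact n * (killed ^^ n) f x) sums (exp t * u x t)"
        by (simp add: sums_def P_def)
      then show "u x t = poissonized f x t"
        by (simp add: poissonized_def sums_iff exp_minus)
    qed
  qed
qed

end

section \<open>Initial datum, harmonic profile and conclusion\<close>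

context dispersal_kernel
begin

text \<open>A version of the initial datum that is Borel measurable and a density at every point.\<close>

lemma initial_density:
  assumes u0: "\<And>x. 0 \<le> u0 x" "bounded (range u0)" "\<And>x. x < 0 \<Longrightarrow> u0 x = 0"
    and i: "integrable (lebesgue_on {0<..}) (\<lambda>x. (1 + x + x\<^sup>2) * u0 x)"
  obtains f where "walk_density f" and "integrable lborel (\<lambda>x. x\<^sup>2 * f x)" and "AE x in lebesgue. u0 x = f x"
proof -
  have "integrable lebesgue (\<lambda>x. indicator {0<..} x *\<^sub>R ((1 + x + x\<^sup>2) * u0 x))"
    using i by (subst (asm) integrable_restrict_space) auto
  then have m: "(\<lambda>x. indicator {0<..} x *\<^sub>R ((1 + x + x\<^sup>2) * u0 x)) \<in> borel_measurable lebesgue"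
    and il: "integrable lebesgue (\<lambda>x. indicator {0<..} x *\<^sub>R ((1 + x + x\<^sup>2) * u0 x))"
    by auto
  have pos: "0 < 1 + x + x\<^sup>2" for x :: real
  proof -
    have "0 \<le> (x + 1 / 2)\<^sup>2" by simp
    then show ?thesis by (simp add: power2_eq_square algebra_simps)
  qed
  have w: "(\<lambda>x::real. 1 + x + x\<^sup>2) \<in> borel_measurable lebesgue"
    by (intro borel_imp_lebesgue_measurable) measurable
  have "(\<lambda>x. (indicator {0<..} x *\<^sub>R ((1 + x + x\<^sup>2) * u0 x)) / (1 + x + x\<^sup>2)) \<in> borel_measurable lebesgue"
    using m w by (rule borel_measurable_divide)
  moreover have "(indicator {0<..} x *\<^sub>R ((1 + x + x\<^sup>2) * u0 x)) / (1 + x + x\<^sup>2) = indicator {0<..} x *\<^sub>R u0 x" for x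
    using pos[of x] by (simp add: indicator_def)
  ultimately have "(\<lambda>x. indicator {0<..} x *\<^sub>R u0 x) \<in> borel_measurable lebesgue"
    by simp
  then obtain g where g [measurable]: "g \<in> borel_measurable lborel"
    and ug: "AE x in lborel. indicator {0<..} x *\<^sub>R u0 x = g x"
    using completion_ex_borel_measurable_real by blast
  obtain B where B: "\<And>x. \<bar>u0 x\<bar> \<le> B"
    using u0(2) unfolding bounded_iff by auto
  have B0: "0 \<le> B" using B[of 0] by simp
  define f where "f x = (if 0 < x then max 0 (min B (g x)) else 0)" for x
  have f [measurable]: "f \<in> borel_measurable borel"
    unfolding f_def using g by simp
  have AEf: "AE x in lebesgue. u0 x = f x"
    using AE_completion[OF ug] AE_lebesgue_neq[of 0]
  proof eventually_elim
    case (elim x)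
    show ?case
    proof (cases "0 < x")
      case True
      then have "g x = u0 x" using elim by simp
      then show ?thesis using True u0(1)[of x] B[of x] by (simp add: f_def)
    next
      case False
      then show ?thesis using elim u0(3)[of x] by (simp add: f_def)
    qed
  qed
  have fp: "0 \<le> f x" "f x \<le> B" and f0: "x \<le> 0 \<Longrightarrow> f x = 0" for x
    using B0 by (auto simp: f_def)
  have "integrable lebesgue (\<lambda>x. (1 + x + x\<^sup>2) * f x)"
  proof (rule iffD1[OF integrable_cong_AE il])
    have "(\<lambda>x. (1 + x + x\<^sup>2) * f x) \<in> borel_measurable borel" by measurable
    then show "(\<lambda>x. (1 + x + x\<^sup>2) * f x) \<in> borel_measurable lebesgue"
      by (rule borel_imp_lebesgue_measurable)
    show "AE x in lebesgue. indicator {0<..} x *\<^sub>R ((1 + x + x\<^sup>2) * u0 x) = (1 + x + x\<^sup>2) * f x"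
      using AEf by eventually_elim (auto simp: indicator_def f0)
  qed (rule m)
  then have iw: "integrable lborel (\<lambda>x. (1 + x + x\<^sup>2) * f x)"
    by (subst (asm) integrable_completion) auto
  have sub: "integrable lborel (\<lambda>x. w x * f x)"
    if "w \<in> borel_measurable borel" "\<And>x. 0 < x \<Longrightarrow> \<bar>w x\<bar> \<le> 1 + x + x\<^sup>2" for w
  proof (rule Bochner_Integration.integrable_bound[OF iw])
    note [measurable] = that(1)
    show "(\<lambda>x. w x * f x) \<in> borel_measurable lborel" by measurable
    have "\<bar>w x * f x\<bar> \<le> \<bar>(1 + x + x\<^sup>2) * f x\<bar>" for x
    proof (cases "0 < x")
      case True
      then show ?thesis
        using mult_right_mono[OF that(2)[OF True] fp(1)[of x]] fp(1)[of x] pos[of x]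
        by (simp add: abs_mult)
    qed (simp add: f0)
    then show "AE x in lborel. norm (w x * f x) \<le> norm ((1 + x + x\<^sup>2) * f x)" by simp
  qed
  show thesis
  proof
    show "AE x in lebesgue. u0 x = f x" by (rule AEf)
    show "integrable lborel (\<lambda>x. x\<^sup>2 * f x)" by (rule sub) auto
    have "integrable lborel (\<lambda>x. (1 + \<bar>x\<bar>) * f x)" by (rule sub) auto
    then show "walk_density f"
      unfolding walk_density_def using f fp f0 by (auto intro: less_imp_le)
  qed
qed

text \<open>The profile is replaced by a Borel function that keeps the distance to the identity bounded
  at every point. It may vanish on the whole negative half-line, because from a point of the
  half-line \<open>J\<close> reaches only beyond \<open>- d\<close>, where \<open>\<phi>\<close> vanishes as well.\<close>

lemma stationary_version:
  assumes \<phi>: "stationary_solution d J \<phi>"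
  obtains \<psi> C where "\<psi> \<in> borel_measurable borel" and "\<And>x. x < 0 \<Longrightarrow> \<psi> x = 0"
    and "\<And>x. 0 \<le> x \<Longrightarrow> \<bar>\<psi> x - x\<bar> \<le> C"
    and "AE x in lebesgue. 0 < x \<longrightarrow> \<phi> x = \<psi> x" and "AE x in lebesgue. 0 < x \<longrightarrow> jump \<psi> x = \<psi> x"
proof -
  have harm: "\<And>x. 0 \<le> x \<Longrightarrow> convolve J \<phi> x = \<phi> x" and zero: "\<And>x. - d < x \<Longrightarrow> x < 0 \<Longrightarrow> \<phi> x = 0"
    and L: "L_infinity_on {0<..} (\<lambda>x. \<phi> x - x)"
    using \<phi> by (auto simp: stationary_solution_def)
  have S: "{0<..} \<in> sets (lebesgue :: real measure)" by simp
  obtain C where AEC: "AE x in lebesgue. x \<in> {0<..} \<longrightarrow> \<bar>\<phi> x - x\<bar> \<le> C"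
    using L unfolding L_infinity_on_def AE_lebesgue_on_iff[OF S] by blast
  have "(\<lambda>x. indicator {0<..} x *\<^sub>R (\<phi> x - x)) \<in> borel_measurable lebesgue"
    using L unfolding L_infinity_on_def by (subst (asm) borel_measurable_restrict_space_iff) auto
  then obtain g where g: "g \<in> borel_measurable lborel"
    and \<phi>g: "AE x in lborel. indicator {0<..} x *\<^sub>R (\<phi> x - x) = g x"
    using completion_ex_borel_measurable_real by blast
  define \<psi> where "\<psi> x = (if 0 \<le> x then x + max (- \<bar>C\<bar>) (min \<bar>C\<bar> (g x)) else 0)" for x
  have \<psi> [measurable]: "\<psi> \<in> borel_measurable borel"
    unfolding \<psi>_def using g by simp
  have eq: "AE x in lebesgue. 0 < x \<longrightarrow> \<phi> x = \<psi> x"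
    using AE_completion[OF \<phi>g] AEC
  proof eventually_elim
    case (elim x)
    show ?case
    proof
      assume x: "0 < x"
      then have "g x = \<phi> x - x" "\<bar>\<phi> x - x\<bar> \<le> \<bar>C\<bar>" using elim by auto
      then show "\<phi> x = \<psi> x" using x by (auto simp: \<psi>_def)
    qed
  qed
  have "AE x in lebesgue. 0 < x \<longrightarrow> jump \<psi> x = \<psi> x"
    using eq
  proof eventually_elim
    case (elim x)
    show ?case
    proof
      assume x: "0 < x"
      have m: "(\<lambda>y. J (x - y) * \<psi> y) \<in> borel_measurable borel" by measurable
      have "jump \<psi> x = (\<integral>y. J (x - y) * \<psi> y \<partial>lebesgue)"
        unfolding jump_def using m by (simp add: integral_completion)
      also have "\<dots> = convolve J \<phi> x"
        unfolding convolve_def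
      proof (rule integral_lebesgue_cong_AE(2)[symmetric, OF borel_imp_lebesgue_measurable[OF m]])
        show "AE y in lebesgue. J (x - y) * \<phi> y = J (x - y) * \<psi> y"
          using eq AE_lebesgue_neq[of 0]
        proof eventually_elim
          case (elim y)
          consider "0 < y" | "- d < y" "y < 0" | "y \<le> - d" using elim by linarith
          then show ?case
          proof cases
            case 2
            then show ?thesis using zero by (simp add: \<psi>_def)
          next
            case 3
            then show ?thesis using x by (simp add: J_supp)
          qed (use elim in simp)
        qed
      qed
      finally show "jump \<psi> x = \<psi> x" using harm[of x] x elim by simp
    qed
  qed
  moreover have "\<bar>\<psi> x - x\<bar> \<le> \<bar>C\<bar>" if "0 \<le> x" for x
    using that by (auto simp: \<psi>_def)
  moreover have "\<psi> x = 0" if "x < 0" for x using that by (simp add: \<psi>_def)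
  ultimately show thesis using that \<psi> eq by blast
qed

text \<open>Pairing with the harmonic profile is conserved by the killed walk. Since the profile is
  at bounded distance from the identity and the mass dies out, the conserved quantity is the
  limit of the first moments.\<close>

lemma first_moment_limit:
  assumes f: "walk_density f" and \<psi> [measurable]: "\<psi> \<in> borel_measurable borel"
    and \<psi>0: "\<And>x. x < 0 \<Longrightarrow> \<psi> x = 0" and C: "\<And>x. 0 \<le> x \<Longrightarrow> \<bar>\<psi> x - x\<bar> \<le> C"
    and harm: "AE x in lebesgue. 0 < x \<longrightarrow> jump \<psi> x = \<psi> x"
  shows "(\<lambda>n. first_moment ((killed ^^ n) f)) \<longlonglongrightarrow> (\<integral>x. f x * \<psi> x \<partial>lborel)"
proof -
  have C0: "0 \<le> C" using C[of 0] by simp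
  have lin: "\<bar>\<psi> x\<bar> \<le> (1 + C) * (1 + \<bar>x\<bar>)" for x
  proof (cases "0 \<le> x")
    case True
    have "0 \<le> C * x" using C0 True by simp
    moreover have "\<bar>\<psi> x\<bar> \<le> x + C" using C[OF True] True by linarith
    ultimately show ?thesis using True by (simp add: algebra_simps)
  qed (use \<psi>0 C0 in simp)
  have harm': "AE x in lborel. 0 < x \<longrightarrow> jump \<psi> x = \<psi> x"
    using harm by (simp add: AE_completion_iff)
  have step: "(\<integral>x. killed g x * \<psi> x \<partial>lborel) = (\<integral>x. g x * \<psi> x \<partial>lborel)" if g: "walk_density g" for g
  proof -
    note [measurable] = walk_densityD(1)[OF g]
    have "(\<integral>x. killed g x * \<psi> x \<partial>lborel) = (\<integral>x. g x * jump \<psi> x \<partial>lborel)"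
      by (rule killed_pairing[OF g \<psi> lin \<psi>0])
    also have "\<dots> = (\<integral>x. g x * \<psi> x \<partial>lborel)"
    proof (rule integral_cong_AE)
      show "AE x in lborel. g x * jump \<psi> x = g x * \<psi> x"
        using harm' AE_lborel_singleton[of 0]
      proof eventually_elim
        case (elim x)
        then show ?case using walk_densityD(3)[OF g, of x] by (cases "0 < x") auto
      qed
    qed auto
    finally show ?thesis .
  qed
  have conserved: "(\<integral>x. (killed ^^ n) f x * \<psi> x \<partial>lborel) = (\<integral>x. f x * \<psi> x \<partial>lborel)" for n
    by (induction n) (simp_all add: step killed_power_density[OF f])
  obtain A where A: "A > 0" "\<And>n. 1 \<le> n \<Longrightarrow> mass ((killed ^^ n) f) \<le> A * shifted_moment f / sqrt (real n)"
    using survival_bound f by blast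
  have diff: "\<bar>first_moment ((killed ^^ n) f) - (\<integral>x. f x * \<psi> x \<partial>lborel)\<bar> \<le> C * mass ((killed ^^ n) f)" for n
  proof -
    let ?g = "(killed ^^ n) f"
    have g: "walk_density ?g" by (rule killed_power_density[OF f])
    have i1: "integrable lborel (\<lambda>x. x * ?g x)" by (rule walk_density_integrable[OF g])
    have i2: "integrable lborel (\<lambda>x. ?g x * \<psi> x)"
      by (rule walk_density_integrable_mult[OF g \<psi>, of "1 + C"]) (use lin in \<open>metis abs_of_nonneg\<close>)
    have eq: "first_moment ?g - (\<integral>x. f x * \<psi> x \<partial>lborel) = (\<integral>x. x * ?g x - ?g x * \<psi> x \<partial>lborel)"
      unfolding first_moment_def conserved[of n, symmetric] by (rule Bochner_Integration.integral_diff[OF i1 i2, symmetric])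
    have "\<bar>first_moment ?g - (\<integral>x. f x * \<psi> x \<partial>lborel)\<bar> \<le> (\<integral>x. \<bar>x * ?g x - ?g x * \<psi> x\<bar> \<partial>lborel)"
      unfolding eq by (rule integral_abs_bound)
    also have "\<dots> \<le> (\<integral>x. C * ?g x \<partial>lborel)"
    proof (rule integral_mono)
      show "integrable lborel (\<lambda>x. \<bar>x * ?g x - ?g x * \<psi> x\<bar>)"
        by (intro integrable_abs Bochner_Integration.integrable_diff i1 i2)
      show "integrable lborel (\<lambda>x. C * ?g x)"
        by (intro integrable_mult_right walk_density_integrable[OF g])
      fix x
      show "\<bar>x * ?g x - ?g x * \<psi> x\<bar> \<le> C * ?g x"
      proof (cases "0 \<le> x")
        case True
        have "x * ?g x - ?g x * \<psi> x = (x - \<psi> x) * ?g x" by (simp add: algebra_simps)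
        then have "\<bar>x * ?g x - ?g x * \<psi> x\<bar> = \<bar>x - \<psi> x\<bar> * ?g x"
          using walk_densityD(2)[OF g, of x] by (simp add: abs_mult)
        also have "\<dots> \<le> C * ?g x"
          using C[OF True] walk_densityD(2)[OF g, of x] by (intro mult_right_mono) (auto simp: abs_minus_commute)
        finally show ?thesis .
      qed (simp add: walk_densityD(3)[OF g])
    qed
    finally show ?thesis by (simp add: mass_def)
  qed
  have "(\<lambda>n. first_moment ((killed ^^ n) f) - (\<integral>x. f x * \<psi> x \<partial>lborel)) \<longlonglongrightarrow> 0"
  proof (rule Lim_null_comparison)
    have "norm (first_moment ((killed ^^ n) f) - (\<integral>x. f x * \<psi> x \<partial>lborel)) \<le> C * (A * shifted_moment f) * (1 / sqrt (real n))" if "1 \<le> n" for n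
      using order_trans[OF diff[of n] mult_left_mono[OF A(2)[OF that] C0]] by simp
    then show "\<forall>\<^sub>F n in sequentially. norm (first_moment ((killed ^^ n) f) - (\<integral>x. f x * \<psi> x \<partial>lborel)) \<le> C * (A * shifted_moment f) * (1 / sqrt (real n))"
      using eventually_sequentially by blast
    have "(\<lambda>n. 1 / sqrt (real n)) \<longlonglongrightarrow> 0" by real_asymp
    then show "(\<lambda>n. C * (A * shifted_moment f) * (1 / sqrt (real n))) \<longlonglongrightarrow> 0"
      by (rule tendsto_mult_right_zero)
  qed
  then show ?thesis by (rule LIM_zero_cancel)
qed

end

theorem theorem4p1:
  fixes d q M1 :: real and J u0 \<phi> :: "real \<Rightarrow> real" and u :: "real \<Rightarrow> real \<Rightarrow> real"
  assumes "d > 0" and "nonlocal_kernel d J"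
    and "q = 1 / 2 * (\<integral>z. J z * z\<^sup>2 \<partial>lebesgue)"
    and "\<And>x. u0 x \<ge> 0" and "bounded (range u0)" and "\<And>x. x < 0 \<Longrightarrow> u0 x = 0"
    and "integrable (lebesgue_on {0<..}) (\<lambda>x. (1 + x + x\<^sup>2) * u0 x)"
    and "evolution_solution J u0 u"
    and "stationary_solution d J \<phi>"
    and "M1 = (\<integral>x. u0 x * \<phi> x \<partial>lebesgue_on {0<..})"
  shows "((\<lambda>t. ereal t * Linf_norm_on {0<..} (\<lambda>x. u x t + 2 * M1 * dipole x (q * t)))
            \<longlongrightarrow> 0) at_top"
proof -
  interpret dispersal_kernel d J
    by unfold_locales (use assms(1,2) in auto)
  have "(\<lambda>z. J z * z\<^sup>2) \<in> borel_measurable lborel" by measurable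
  then have q: "q = diffusivity"
    using assms(3) by (simp add: diffusivity_def integral_completion)
  obtain f where f: "walk_density f" and f2: "integrable lborel (\<lambda>x. x\<^sup>2 * f x)" and uf: "AE x in lebesgue. u0 x = f x"
    using initial_density[OF assms(4-7)] by blast
  obtain \<psi> C where \<psi>: "\<psi> \<in> borel_measurable borel" "\<And>x. x < 0 \<Longrightarrow> \<psi> x = 0" "\<And>x. 0 \<le> x \<Longrightarrow> \<bar>\<psi> x - x\<bar> \<le> C"
    and \<phi>\<psi>: "AE x in lebesgue. 0 < x \<longrightarrow> \<phi> x = \<psi> x" and harm: "AE x in lebesgue. 0 < x \<longrightarrow> jump \<psi> x = \<psi> x"
    by (rule stationary_version[OF assms(9)], rule that, assumption+)
  have M1: "M1 = (\<integral>x. f x * \<psi> x \<partial>lborel)"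
  proof -
    have m: "(\<lambda>x. f x * \<psi> x) \<in> borel_measurable borel"
      using \<psi>(1) walk_densityD(1)[OF f] by measurable
    have "M1 = (\<integral>x. indicator {0<..} x *\<^sub>R (u0 x * \<phi> x) \<partial>lebesgue)"
      unfolding assms(10) by (rule integral_restrict_space) simp
    also have "\<dots> = (\<integral>x. f x * \<psi> x \<partial>lebesgue)"
    proof (rule integral_lebesgue_cong_AE(2)[OF borel_imp_lebesgue_measurable[OF m]])
      show "AE x in lebesgue. indicator {0<..} x *\<^sub>R (u0 x * \<phi> x) = f x * \<psi> x"
        using uf \<phi>\<psi> AE_lebesgue_neq[of 0]
      proof eventually_elim
        case (elim x)
        then show ?case using \<psi>(2)[of x] by (cases "0 < x") auto
      qed
    qed
    also have "\<dots> = (\<integral>x. f x * \<psi> x \<partial>lborel)" using m by (simp add: integral_completion)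
    finally show ?thesis .
  qed
  have lim: "(\<lambda>n. first_moment ((killed ^^ n) f)) \<longlonglongrightarrow> M1"
    unfolding M1 by (rule first_moment_limit[OF f \<psi> harm])
  let ?N = "\<lambda>t. Linf_norm_on {0<..} (\<lambda>x. u x t + 2 * M1 * dipole x (q * t))"
  have upper: "\<exists>T>0. \<forall>t\<ge>T. ereal t * ?N t \<le> ereal \<delta>" if \<delta>: "0 < \<delta>" for \<delta>
  proof -
    obtain T where T: "T > 0" "\<And>t x. T \<le> t \<Longrightarrow> 0 < x \<Longrightarrow> t * \<bar>poissonized f x t + 2 * M1 * dipole x (q * t)\<bar> \<le> \<delta>"
      using poissonized_dipole_limit[OF f f2 lim \<delta>] unfolding q by blast
    have "ereal t * ?N t \<le> ereal \<delta>" if t: "T \<le> t" for t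
    proof -
      have t0: "0 < t" using t T(1) by simp
      have "?N t \<le> ereal (\<delta> / t)"
        unfolding Linf_norm_on_def
      proof (rule esssup_I)
        have um: "(\<lambda>x. u x t) \<in> borel_measurable (lebesgue_on {0<..})"
          using assms(8) t0 by (intro weighted_integrable_measurable)
            (simp add: evolution_solution_def continuous_weighted_L1_def)
        have "dipole x (q * t) = - (\<integral>\<xi>. \<xi> * exp (- (q * t * \<xi>\<^sup>2)) * sin (x * \<xi>) \<partial>lborel) / (2 * pi)" for x
          using dipole_fourier[of "q * t" x] t0 diffusivity_pos q by (simp add: field_simps)
        then have "(\<lambda>x. dipole x (q * t)) \<in> borel_measurable borel" by simp
        then have "(\<lambda>x. dipole x (q * t)) \<in> borel_measurable (lebesgue_on {0<..})"
          by (intro measurable_restrict_space1 borel_imp_lebesgue_measurable)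
        with um show "(\<lambda>x. ereal \<bar>u x t + 2 * M1 * dipole x (q * t)\<bar>) \<in> borel_measurable (lebesgue_on {0<..})"
          by simp
        have "AE x in lebesgue. x \<in> {0<..} \<longrightarrow> ereal \<bar>u x t + 2 * M1 * dipole x (q * t)\<bar> \<le> ereal (\<delta> / t)"
          using evolution_solution_poissonized[OF assms(8) f uf]
        proof eventually_elim
          case (elim x)
          show ?case
          proof
            assume x: "x \<in> {0<..}"
            then have "u x t = poissonized f x t" using elim t0 by simp
            then show "ereal \<bar>u x t + 2 * M1 * dipole x (q * t)\<bar> \<le> ereal (\<delta> / t)"
              using T(2)[OF t, of x] x t0 by (simp add: pos_le_divide_eq mult.commute)
          qed
        qed
        then show "AE x in lebesgue_on {0<..}. ereal \<bar>u x t + 2 * M1 * dipole x (q * t)\<bar> \<le> ereal (\<delta> / t)"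
          by (subst AE_lebesgue_on_iff) auto
      qed
      then have "ereal t * ?N t \<le> ereal t * ereal (\<delta> / t)"
        using t0 by (intro ereal_mult_left_mono) auto
      also have "\<dots> = ereal \<delta>" using t0 by simp
      finally show ?thesis .
    qed
    then show ?thesis using T(1) by blast
  qed
  have lower: "0 \<le> ?N t" for t
  proof -
    have pos: "emeasure (lebesgue_on {0<..}) (space (lebesgue_on {0<..} :: real measure)) \<noteq> 0"
    proof
      assume "emeasure (lebesgue_on {0<..}) (space (lebesgue_on {0<..} :: real measure)) = 0"
      then have "emeasure lebesgue {0::real<..} = 0"
        by (simp add: emeasure_restrict_space space_restrict_space)
      moreover have "emeasure lebesgue {0::real<..1} \<le> emeasure lebesgue {0::real<..}"
        by (rule emeasure_mono) auto
      ultimately show False by simp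
    qed
    have "AE x in lebesgue_on {0<..}. ereal \<bar>u x t + 2 * M1 * dipole x (q * t)\<bar> \<le> ?N t"
      unfolding Linf_norm_on_def by (rule esssup_AE)
    then have "AE x in lebesgue_on {0::real<..}. 0 \<le> ?N t"
      by eventually_elim (auto intro: order_trans[rotated])
    then show ?thesis
      using pos by (cases "0 \<le> ?N t") (simp_all add: eventually_False ae_filter_eq_bot_iff)
  qed
  show ?thesis
  proof (rule order_tendstoI)
    fix a :: ereal assume a: "a < 0"
    have "a < ereal t * ?N t" if "0 < t" for t
      using a lower[of t] that by (meson ereal_0_le_mult ereal_less_eq(5) less_imp_le order_less_le_trans)
    then show "\<forall>\<^sub>F t in at_top. a < ereal t * ?N t"
      using eventually_gt_at_top[of 0] by (rule eventually_mono[rotated])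
  next
    fix a :: ereal assume "0 < a"
    then obtain \<delta> where \<delta>: "0 < ereal \<delta>" "ereal \<delta> < a"
      using ereal_dense2 by blast
    then obtain T where "\<And>t. T \<le> t \<Longrightarrow> ereal t * ?N t \<le> ereal \<delta>"
      using upper[of \<delta>] by auto
    then show "\<forall>\<^sub>F t in at_top. ereal t * ?N t < a"
      using \<delta>(2) unfolding eventually_at_top_linorder by (meson order_le_less_trans)
  qed
qed

end
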